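(* Let $k$ be an algebraically closed field of characteristic zero, let $G$ be a finite group and $\omega: G\times G\times G\to k^\times$ a normalized 3-cocycle. Then the exponent of the twisted quantum double $D^\omega G$ divides $(\exp G)^2$.
   Context: $\exp G$ is the least common multiple of the orders of the elements of $G$. The twisted quantum double $D^\omega G$ (Dijkgraaf–Pasquier–Roche) is the following quasitriangular semisimple quasi-Hopf algebra over $k$, with basis $\{e_g\# x: g,x\in G\}$ (the underlying vector space is $k^G\otimes kG$, $e_g\in k^G$ being the canonical idempotents $e_g(h)=\delta_{g,h}$). Put $$\theta_g(x,y)=\frac{\omega(g,x,y)\,\omega(x,y,(xy)^{-1}g(xy))}{\omega(x,x^{-1}gx,y)},\qquad \gamma_g(x,y)=\frac{\omega(x,y,g)\,\omega(g,g^{-1}xg,g^{-1}yg)}{\omega(x,g,g^{-1}yg)}.$$ Then $(e_g\#x)(e_h\#y)=\delta_{g,xhx^{-1}}\theta_g(x,y)\,e_g\#xy$, unit $\sum_g e_g\#e$, $\Delta(e_g\#x)=\sum_{st=g}\gamma_x(s,t)\,e_s\#x\otimes e_t\#x$, $\epsilon(e_g\#x)=\delta_{g,e}$, antipode $\mathcal S(e_g\#x)=\theta_{g^{-1}}(x,x^{-1})^{-1}\gamma_x(g,g^{-1})^{-1}e_{x^{-1}g^{-1}x}\#x^{-1}$ with $\alpha=1$, $\beta=\sum_g\omega(g,g^{-1},g)e_g$, associator $\phi=\sum_{a,b,c}\omega(a,b,c)^{-1}e_a\otimes e_b\otimes e_c$ and $R$-matrix $\mathcal R=\sum_g e_g\otimes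 g$. Here $e_g$ and $g$ also denote $e_g\#e$ and $\sum_h e_h\#g$, respectively. The exponent of a fusion category $\mathcal C$ is the smallest integer $N\ge 1$ such that $(c_{V,U}c_{U,V})^N=\operatorname{id}$ for all objects $U,V$ of the Drinfeld center $\mathcal Z(\mathcal C)$, where $c$ is the canonical braiding of $\mathcal Z(\mathcal C)$. One has $\exp\mathcal C=\exp\mathcal Z(\mathcal C)$. The exponent $\exp H$ of a finite-dimensional semisimple quasi-Hopf algebra $H$ is the exponent of its category of finite-dimensional representations $\operatorname{Rep}H$. Since $\operatorname{Rep}D^\omega G$ is equivalent to $\mathcal Z(\operatorname{Vec}^G_\omega)$ (where $\operatorname{Vec}^G_\omega$ is the category of finite-dimensional $G$-graded vector spaces with associativity given by $\omega$), $\exp D^\omega G$ equals the order of $\mathcal R_{21}\mathcal R$. *)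

theory Defs
  imports
    "Jordan_Normal_Form.Matrix"
    "HOL-Algebra.Multiplicative_Group"
    "HOL-Computational_Algebra.Polynomial"
begin

section \<open>Groups and cocycles\<close>

definition group_exponent :: "('g, 'm) monoid_scheme \<Rightarrow> nat" where
  "group_exponent G = Lcm (group.ord G ` carrier G)"

text \<open>Group cochains take values in the field; being \<open>k\<^sup>\<times>\<close>-valued is the first clause.\<close>

definition normalized_3cocycle ::
  "('g, 'm) monoid_scheme \<Rightarrow> ('g \<Rightarrow> 'g \<Rightarrow> 'g \<Rightarrow> 'k::field) \<Rightarrow> bool" where
  "normalized_3cocycle G \<omega> \<longleftrightarrow>
     (\<forall>a\<in>carrier G. \<forall>b\<in>carrier G. \<forall>c\<in>carrier G. \<omega> a b c \<noteq> 0) \<and>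
     (\<forall>a\<in>carrier G. \<forall>b\<in>carrier G. \<forall>c\<in>carrier G. \<forall>d\<in>carrier G.
        \<omega> b c d * \<omega> a (b \<otimes>\<^bsub>G\<^esub> c) d * \<omega> a b c = \<omega> (a \<otimes>\<^bsub>G\<^esub> b) c d * \<omega> a b (c \<otimes>\<^bsub>G\<^esub> d)) \<and>
     (\<forall>a\<in>carrier G. \<forall>b\<in>carrier G.
        \<omega> \<one>\<^bsub>G\<^esub> a b = 1 \<and> \<omega> a \<one>\<^bsub>G\<^esub> b = 1 \<and> \<omega> a b \<one>\<^bsub>G\<^esub> = 1)"

section \<open>Quasi-Hopf algebras in coordinates\<close>

text \<open>
  The structure of a finite-dimensional quasitriangular quasi-Hopf algebra \<open>H\<close> with respect to
  a finite basis. An element of \<open>H\<close>, of \<open>H \<otimes> H\<close> or of \<open>H \<otimes> H \<otimes> H\<close> is given by its coordinates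
  on basis vectors, pairs or triples of them; values outside the basis play no role. Linear maps
  are given by their values on the basis. The associator \<open>\<phi>\<close> is normalised by
  \<open>(id \<otimes> \<Delta>) \<Delta>(h) \<phi> = \<phi> (\<Delta> \<otimes> id) \<Delta>(h)\<close>, so that it acts as
  \<open>(U \<otimes> V) \<otimes> W \<rightarrow> U \<otimes> (V \<otimes> W)\<close>.
\<close>

record ('b, 'k) quasi_hopf =
  qbasis :: "'b set"
  qmult :: "'b \<Rightarrow> 'b \<Rightarrow> 'b \<Rightarrow> 'k"
  qunit :: "'b \<Rightarrow> 'k"
  comult :: "'b \<Rightarrow> 'b \<times> 'b \<Rightarrow> 'k"
  counit :: "'b \<Rightarrow> 'k"
  associator :: "'b \<times> 'b \<times> 'b \<Rightarrow> 'k"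
  antipode :: "'b \<Rightarrow> 'b \<Rightarrow> 'k"
  antipode_alpha :: "'b \<Rightarrow> 'k"
  antipode_beta :: "'b \<Rightarrow> 'k"
  R_matrix :: "'b \<times> 'b \<Rightarrow> 'k"

section \<open>The twisted quantum double\<close>

definition conj_by :: "('g, 'm) monoid_scheme \<Rightarrow> 'g \<Rightarrow> 'g \<Rightarrow> 'g" where
  "conj_by G x g = inv\<^bsub>G\<^esub> x \<otimes>\<^bsub>G\<^esub> g \<otimes>\<^bsub>G\<^esub> x"

definition tqd_theta ::
  "('g, 'm) monoid_scheme \<Rightarrow> ('g \<Rightarrow> 'g \<Rightarrow> 'g \<Rightarrow> 'k::field) \<Rightarrow> 'g \<Rightarrow> 'g \<Rightarrow> 'g \<Rightarrow> 'k" where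
  "tqd_theta G \<omega> g x y =
     \<omega> g x y * \<omega> x y (conj_by G (x \<otimes>\<^bsub>G\<^esub> y) g) / \<omega> x (conj_by G x g) y"

definition tqd_gamma ::
  "('g, 'm) monoid_scheme \<Rightarrow> ('g \<Rightarrow> 'g \<Rightarrow> 'g \<Rightarrow> 'k::field) \<Rightarrow> 'g \<Rightarrow> 'g \<Rightarrow> 'g \<Rightarrow> 'k" where
  "tqd_gamma G \<omega> g x y =
     \<omega> x y g * \<omega> g (conj_by G g x) (conj_by G g y) / \<omega> x g (conj_by G g y)"

text \<open>The pair \<open>(g, x)\<close> stands for the basis vector \<open>e\<^sub>g # x\<close>.\<close>

definition twisted_quantum_double ::
  "('g, 'm) monoid_scheme \<Rightarrow> ('g \<Rightarrow> 'g \<Rightarrow> 'g \<Rightarrow> 'k::field) \<Rightarrow> ('g \<times> 'g, 'k) quasi_hopf" where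
  "twisted_quantum_double G \<omega> = \<lparr>
     qbasis = carrier G \<times> carrier G,
     qmult = (\<lambda>(g, x) (h, y) (f, z).
       if g = x \<otimes>\<^bsub>G\<^esub> h \<otimes>\<^bsub>G\<^esub> inv\<^bsub>G\<^esub> x \<and> f = g \<and> z = x \<otimes>\<^bsub>G\<^esub> y then tqd_theta G \<omega> g x y else 0),
     qunit = (\<lambda>(g, x). if x = \<one>\<^bsub>G\<^esub> then 1 else 0),
     comult = (\<lambda>(g, x) ((s, y), (t, z)).
       if s \<otimes>\<^bsub>G\<^esub> t = g \<and> y = x \<and> z = x then tqd_gamma G \<omega> x s t else 0),
     counit = (\<lambda>(g, x). if g = \<one>\<^bsub>G\<^esub> then 1 else 0),
     associator = (\<lambda>((a, x), (b, y), (c, z)).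
       if x = \<one>\<^bsub>G\<^esub> \<and> y = \<one>\<^bsub>G\<^esub> \<and> z = \<one>\<^bsub>G\<^esub> then inverse (\<omega> a b c) else 0),
     antipode = (\<lambda>(g, x) (f, z).
       if f = inv\<^bsub>G\<^esub> x \<otimes>\<^bsub>G\<^esub> inv\<^bsub>G\<^esub> g \<otimes>\<^bsub>G\<^esub> x \<and> z = inv\<^bsub>G\<^esub> x
       then inverse (tqd_theta G \<omega> (inv\<^bsub>G\<^esub> g) x (inv\<^bsub>G\<^esub> x))
          * inverse (tqd_gamma G \<omega> x g (inv\<^bsub>G\<^esub> g))
       else 0),
     antipode_alpha = (\<lambda>(g, x). if x = \<one>\<^bsub>G\<^esub> then 1 else 0),
     antipode_beta = (\<lambda>(g, x). if x = \<one>\<^bsub>G\<^esub> then \<omega> g (inv\<^bsub>G\<^esub> g) g else 0),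
     R_matrix = (\<lambda>((g, x), (h, y)). if x = \<one>\<^bsub>G\<^esub> \<and> y = g then 1 else 0)
   \<rparr>"

section \<open>Finite-dimensional representations\<close>

text \<open>
  \<open>Rep H\<close> is represented by its equivalent full subcategory on the spaces \<open>k\<^sup>n\<close>. With the Kronecker
  product as tensor product of matrices, the tensor product of vector spaces is strictly
  associative, with \<open>k\<^sup>n \<otimes> k\<^sup>m = k\<^sup>n\<^sup>m\<close>, so the associativity constraint of \<open>Rep H\<close> is just the
  action of \<open>\<phi>\<close>.
\<close>

definition kron :: "'k::semiring_1 mat \<Rightarrow> 'k mat \<Rightarrow> 'k mat" where
  "kron A B = mat (dim_row A * dim_row B) (dim_col A * dim_col B)
     (\<lambda>(i, j). A $$ (i div dim_row B, j div dim_col B) * B $$ (i mod dim_row B, j mod dim_col B))"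

definition mat_lincomb ::
  "nat \<Rightarrow> 'a set \<Rightarrow> ('a \<Rightarrow> 'k::semiring_1) \<Rightarrow> ('a \<Rightarrow> 'k mat) \<Rightarrow> 'k mat" where
  "mat_lincomb n A x F = mat n n (\<lambda>(i, j). \<Sum>a\<in>A. x a * F a $$ (i, j))"

record ('b, 'k) hrep =
  rdim :: nat
  raction :: "'b \<Rightarrow> 'k mat"

definition is_rep :: "('b, 'k::field) quasi_hopf \<Rightarrow> ('b, 'k) hrep \<Rightarrow> bool" where
  "is_rep H V \<longleftrightarrow>
     (\<forall>a\<in>qbasis H. raction V a \<in> carrier_mat (rdim V) (rdim V)) \<and>
     (\<forall>a\<in>qbasis H. \<forall>b\<in>qbasis H.
        raction V a * raction V b = mat_lincomb (rdim V) (qbasis H) (qmult H a b) (raction V)) \<and>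
     mat_lincomb (rdim V) (qbasis H) (qunit H) (raction V) = 1\<^sub>m (rdim V)"

definition is_rep_hom ::
  "('b, 'k::field) quasi_hopf \<Rightarrow> ('b, 'k) hrep \<Rightarrow> ('b, 'k) hrep \<Rightarrow> 'k mat \<Rightarrow> bool" where
  "is_rep_hom H V W f \<longleftrightarrow>
     f \<in> carrier_mat (rdim W) (rdim V) \<and>
     (\<forall>a\<in>qbasis H. f * raction V a = raction W a * f)"

definition rep_tensor ::
  "('b, 'k::field) quasi_hopf \<Rightarrow> ('b, 'k) hrep \<Rightarrow> ('b, 'k) hrep \<Rightarrow> ('b, 'k) hrep" where
  "rep_tensor H V W = \<lparr>
     rdim = rdim V * rdim W,
     raction = (\<lambda>a. mat_lincomb (rdim V * rdim W) (qbasis H \<times> qbasis H) (comult H a)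
       (\<lambda>(b, c). kron (raction V b) (raction W c))) \<rparr>"

definition rep_assoc ::
  "('b, 'k::field) quasi_hopf \<Rightarrow> ('b, 'k) hrep \<Rightarrow> ('b, 'k) hrep \<Rightarrow> ('b, 'k) hrep \<Rightarrow> 'k mat" where
  "rep_assoc H U V W =
     mat_lincomb (rdim U * rdim V * rdim W) (qbasis H \<times> qbasis H \<times> qbasis H) (associator H)
       (\<lambda>(a, b, c). kron (raction U a) (kron (raction V b) (raction W c)))"

section \<open>The Drinfeld center and the exponent\<close>

text \<open>
  A half-braiding on \<open>Z\<close> is a natural isomorphism \<open>u\<^sub>X : Z \<otimes> X \<rightarrow> X \<otimes> Z\<close> satisfying the hexagon
  \<open>a\<^sub>X\<^sub>Y\<^sub>Z u\<^sub>X\<^sub>\<otimes>\<^sub>Y a\<^sub>Z\<^sub>X\<^sub>Y = (id\<^sub>X \<otimes> u\<^sub>Y) a\<^sub>X\<^sub>Z\<^sub>Y (u\<^sub>X \<otimes> id\<^sub>Y)\<close>.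
\<close>

definition half_braiding ::
  "('b, 'k::field) quasi_hopf \<Rightarrow> ('b, 'k) hrep \<Rightarrow> (('b, 'k) hrep \<Rightarrow> 'k mat) \<Rightarrow> bool" where
  "half_braiding H Z u \<longleftrightarrow>
     (\<forall>X. is_rep H X \<longrightarrow>
        is_rep_hom H (rep_tensor H Z X) (rep_tensor H X Z) (u X) \<and> invertible_mat (u X)) \<and>
     (\<forall>X Y f. is_rep H X \<longrightarrow> is_rep H Y \<longrightarrow> is_rep_hom H X Y f \<longrightarrow>
        u Y * kron (1\<^sub>m (rdim Z)) f = kron f (1\<^sub>m (rdim Z)) * u X) \<and>
     (\<forall>X Y. is_rep H X \<longrightarrow> is_rep H Y \<longrightarrow>
        rep_assoc H X Y Z * u (rep_tensor H X Y) * rep_assoc H Z X Y =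
        kron (1\<^sub>m (rdim X)) (u Y) * rep_assoc H X Z Y * kron (u X) (1\<^sub>m (rdim Y)))"

definition drinfeld_center ::
  "('b, 'k::field) quasi_hopf \<Rightarrow> (('b, 'k) hrep \<times> (('b, 'k) hrep \<Rightarrow> 'k mat)) set" where
  "drinfeld_center H = {(Z, u). is_rep H Z \<and> half_braiding H Z u}"

definition center_braiding ::
  "('b, 'k) hrep \<times> (('b, 'k) hrep \<Rightarrow> 'k mat) \<Rightarrow> ('b, 'k) hrep \<times> (('b, 'k) hrep \<Rightarrow> 'k mat)
    \<Rightarrow> 'k mat" where
  "center_braiding U V = (snd U) (fst V)"

text \<open>The exponent of \<open>H\<close>, that is, of the fusion category \<open>Rep H\<close>.\<close>

definition quasi_hopf_exponent :: "('b, 'k::field) quasi_hopf \<Rightarrow> nat" where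
  "quasi_hopf_exponent H = (LEAST N. N \<ge> 1 \<and>
     (\<forall>U\<in>drinfeld_center H. \<forall>V\<in>drinfeld_center H.
        (center_braiding V U * center_braiding U V) ^\<^sub>m N = 1\<^sub>m (rdim (fst U) * rdim (fst V))))"

end

theory Submission
  imports Defs
begin

text \<open>
  Write \<open>e\<close> for the exponent of \<open>G\<close>. In a braided category with a twist, the double braiding of \<open>U\<close>
  and \<open>V\<close> is the twist of \<open>U \<otimes> V\<close> divided by the twists of \<open>U\<close> and \<open>V\<close> (\<open>balancing\<close>), and the
  twist commutes with everything. So it suffices that every twist in the center has order dividing
  \<open>e * e\<close> (\<open>twist_order\<close>).

  The twist is understood through two gradings. A module of the double of \<open>G\<close> is graded by \<open>G\<close>,
  and a half-braiding on it adds a second grading by the group element \<open>x\<close> with which it acts on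
  other modules. On vectors of degree \<open>h\<close> and second degree \<open>x\<close>, put \<open>k = x ^-1 h\<close>. The twist is
  there a product of commuting operators \<open>L\<close> and \<open>R\<close>, the actions of \<open>x\<close> and of \<open>k\<close> under
  two actions of \<open>G\<close>, as if the object were a module of a double of \<open>G \<times> G\<close>. Because
  \<open>x ^ e = 1\<close>, the power \<open>L ^ e\<close> is the scalar \<open>\<Prod>j<e. \<omega> x (x ^ j) x\<close>, and \<open>R ^ e\<close> is the inverse of
  the same expression in \<open>k\<close>. Such a scalar is an \<open>e\<close>-th root of unity
  (\<open>slant_root_of_unity\<close>), which accounts for the square in the bound.

  The gradings and operators are read off from an arbitrary half-braiding by evaluating it on free
  modules: naturality determines it from there, the hexagon gives the composition law of its
  coefficients (\<open>braid_braid\<close>), and linearity over the double gives their commutation with the action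
  of \<open>G\<close> (\<open>act_braid\<close>). The scalar identities needed for tensor products and for balancing
  follow from the cocycle condition, mostly in its forms for the prism over a tetrahedron
  (\<open>psi_row\<close>) and for a product of two triangles (\<open>psi_block\<close>).
\<close>

section \<open>Identities for three-cocycles\<close>

locale three_cocycle = group G for G :: "('g, 'm) monoid_scheme" (structure) +
  fixes \<omega> :: "'g \<Rightarrow> 'g \<Rightarrow> 'g \<Rightarrow> 'k :: field"
  assumes normalized: "normalized_3cocycle G \<omega>"
begin

lemma cocycle_nonzero [simp]:
  "\<lbrakk>a \<in> carrier G; b \<in> carrier G; c \<in> carrier G\<rbrakk> \<Longrightarrow> \<omega> a b c \<noteq> 0"
  using normalized by (auto simp: normalized_3cocycle_def)

lemma cocycle_one [simp]:
  assumes "a \<in> carrier G" "b \<in> carrier G"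
  shows "\<omega> \<one> a b = 1" "\<omega> a \<one> b = 1" "\<omega> a b \<one> = 1"
  using normalized assms by (auto simp: normalized_3cocycle_def)

lemma cocycle:
  "\<lbrakk>a \<in> carrier G; b \<in> carrier G; c \<in> carrier G; d \<in> carrier G\<rbrakk> \<Longrightarrow>
   \<omega> b c d * \<omega> a (b \<otimes> c) d * \<omega> a b c = \<omega> (a \<otimes> b) c d * \<omega> a b (c \<otimes> d)"
  using normalized by (auto simp: normalized_3cocycle_def)

lemma cancel_words:
  assumes "x \<in> carrier G" "y \<in> carrier G"
  shows "x \<otimes> (inv x \<otimes> y) = y" "inv x \<otimes> (x \<otimes> y) = y"
  using assms by (simp_all flip: m_assoc)

text \<open>
  With these rules the simplifier reduces a word in group elements and their inverses to its
  freely reduced right-associated form, so that two arguments of \<open>\<omega>\<close> that agree in every group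
  become syntactically equal.
\<close>

lemmas word_simps = m_assoc inv_mult_group cancel_words

text \<open>
  Let \<open>b0\<close> cross \<open>g\<close> and then \<open>f\<close>, that is, \<open>b0 g = g' b1\<close> and \<open>b1 f = f' b2\<close>. The value of \<open>\<omega>\<close>
  on the prism over the triangle \<open>(g, f)\<close> with vertical edges \<open>b0, b1, b2\<close> is \<open>psi\<close>: one factor for each of
  the three simplices that triangulate the prism. The structure functions \<open>\<theta>\<close> and \<open>\<gamma>\<close> of the double
  are the cases in which the primed edges agree with the unprimed ones, and in which all \<open>b\<close> agree.
\<close>

definition psi :: "'g \<Rightarrow> 'g \<Rightarrow> 'g \<Rightarrow> 'g \<Rightarrow> 'g \<Rightarrow> 'g \<Rightarrow> 'g \<Rightarrow> 'k" where
  "psi b0 b1 b2 g f g' f' = \<omega> b0 g f * \<omega> g' f' b2 / \<omega> g' b1 f"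

text \<open>
  The cocycle condition on the prism over a tetrahedron \<open>(g, f, e)\<close>, which consists of four
  simplices. For \<open>\<theta>\<close> it is the associativity of the double, for \<open>\<gamma>\<close> its quasi-coassociativity.
\<close>

lemma psi_row:
  assumes [simp]: "b0 \<in> carrier G" "b1 \<in> carrier G" "b2 \<in> carrier G" "b3 \<in> carrier G"
      "g \<in> carrier G" "f \<in> carrier G" "e \<in> carrier G"
      "g' \<in> carrier G" "f' \<in> carrier G" "e' \<in> carrier G"
    and sq: "b0 \<otimes> g = g' \<otimes> b1" "b1 \<otimes> f = f' \<otimes> b2" "b2 \<otimes> e = e' \<otimes> b3"
  shows "psi b0 b1 b2 g f g' f' * psi b0 b2 b3 (g \<otimes> f) e (g' \<otimes> f') e' * \<omega> g f e =
         psi b1 b2 b3 f e f' e' * psi b0 b1 b3 g (f \<otimes> e) g' (f' \<otimes> e') * \<omega> g' f' e'"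
proof -
  have 1: "\<omega> b0 g f = \<omega> (g' \<otimes> b1) f e * \<omega> b0 g (f \<otimes> e) / (\<omega> g f e * \<omega> b0 (g \<otimes> f) e)"
    using cocycle[of b0 g f e] by (simp add: field_simps sq)
  have 2: "\<omega> b1 f e = \<omega> (g' \<otimes> b1) f e * \<omega> g' b1 (f \<otimes> e) / (\<omega> g' (f' \<otimes> b2) e * \<omega> g' b1 f)"
    using cocycle[of g' b1 f e] by (simp add: field_simps sq)
  have 3: "\<omega> g' f' b2 = \<omega> (g' \<otimes> f') b2 e * \<omega> g' f' (e' \<otimes> b3) / (\<omega> f' b2 e * \<omega> g' (f' \<otimes> b2) e)"
    using cocycle[of g' f' b2 e] by (simp add: field_simps sq)
  have 4: "\<omega> g' f' e' = \<omega> (g' \<otimes> f') e' b3 * \<omega> g' f' (e' \<otimes> b3) / (\<omega> f' e' b3 * \<omega> g' (f' \<otimes> e') b3)"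
    using cocycle[of g' f' e' b3] by (simp add: field_simps)
  show ?thesis
    unfolding psi_def 1 2 3 4 by (simp add: field_simps)
qed

text \<open>
  The cocycle condition on the product of the triangles \<open>(h, l)\<close> and \<open>(g, f)\<close>. Its six simplices are
  the shuffles of two steps in one direction with two steps in the other, and they enter with
  alternating signs. It expresses that the two ways of merging a two by two block of crossings agree.
\<close>

lemma psi_block:
  assumes [simp]: "h \<in> carrier G" "h' \<in> carrier G" "h'' \<in> carrier G"
      "l \<in> carrier G" "l' \<in> carrier G" "l'' \<in> carrier G"
      "g \<in> carrier G" "g1 \<in> carrier G" "g2 \<in> carrier G"
      "f \<in> carrier G" "f1 \<in> carrier G" "f2 \<in> carrier G"
    and sq: "h \<otimes> g1 = g2 \<otimes> h'" "l \<otimes> g = g1 \<otimes> l'" "h' \<otimes> f1 = f2 \<otimes> h''" "l' \<otimes> f = f1 \<otimes> l''"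
  shows "psi h h' h'' g1 f1 g2 f2 * psi l l' l'' g f g1 f1 *
           psi g2 g1 g h' l' h l * psi f2 f1 f h'' l'' h' l' =
         psi (h \<otimes> l) (h' \<otimes> l') (h'' \<otimes> l'') g f g2 f2 *
           psi (g2 \<otimes> f2) (g1 \<otimes> f1) (g \<otimes> f) h'' l'' h l"
proof -
  have 1: "\<omega> l g f * \<omega> h (g1 \<otimes> l') f * \<omega> h l g = \<omega> (h \<otimes> l) g f * \<omega> h l (g \<otimes> f)"
    using cocycle[of h l g f] by (simp add: sq)
  have 2: "\<omega> g1 l' f * \<omega> h (g1 \<otimes> l') f * \<omega> h g1 l' = \<omega> (g2 \<otimes> h') l' f * \<omega> h g1 (f1 \<otimes> l'')"
    using cocycle[of h g1 l' f] by (simp add: sq)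
  have 3: "\<omega> g1 f1 l'' * \<omega> h (g1 \<otimes> f1) l'' * \<omega> h g1 f1 = \<omega> (g2 \<otimes> h') f1 l'' * \<omega> h g1 (f1 \<otimes> l'')"
    using cocycle[of h g1 f1 l''] by (simp add: sq)
  have 4: "\<omega> h' l' f * \<omega> g2 (h' \<otimes> l') f * \<omega> g2 h' l' = \<omega> (g2 \<otimes> h') l' f * \<omega> g2 h' (f1 \<otimes> l'')"
    using cocycle[of g2 h' l' f] by (simp add: sq)
  have 5: "\<omega> h' f1 l'' * \<omega> g2 (f2 \<otimes> h'') l'' * \<omega> g2 h' f1 = \<omega> (g2 \<otimes> h') f1 l'' * \<omega> g2 h' (f1 \<otimes> l'')"
    using cocycle[of g2 h' f1 l''] by (simp add: sq)
  have 6: "\<omega> f2 h'' l'' * \<omega> g2 (f2 \<otimes> h'') l'' * \<omega> g2 f2 h'' = \<omega> (g2 \<otimes> f2) h'' l'' * \<omega> g2 f2 (h'' \<otimes> l'')"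
    using cocycle[of g2 f2 h'' l''] by (simp add: sq)
  have field: "c3 * f3 / e3 * (a1 * c1 / b1) * (d3 * a2 / b3) * (f1 * d1 / e1) = a4 * f5 / d2 * (f4 * a5 / c2)"
    if "a1 * a3 * a2 = a4 * a5" "b1 * a3 * b3 = b4 * b5" "c1 * c2 * c3 = c4 * b5"
      "d1 * d2 * d3 = b4 * d5" "e1 * e2 * e3 = c4 * d5" "f1 * e2 * f3 = f4 * f5"
      and nz: "b1 \<noteq> 0" "b3 \<noteq> 0" "c2 \<noteq> 0" "d2 \<noteq> 0" "e1 \<noteq> 0" "e3 \<noteq> 0" "a3 \<noteq> 0" "e2 \<noteq> 0"
    for a1 a2 a3 a4 a5 b1 b3 b4 b5 c1 c2 c3 c4 d1 d2 d3 d5 e1 e2 e3 f1 f3 f4 f5 :: 'k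
  proof -
    \<comment> \<open>The two faces interior to the product, here a3 and e2, cancel in the alternating product.\<close>
    have "(c3 * f3 * a1 * c1 * d3 * a2 * f1 * d1 * d2 * c2) * (a3 * e2) =
        (a1 * a3 * a2) * (c1 * c2 * c3) * (d1 * d2 * d3) * (f1 * e2 * f3)"
      by (simp only: mult_ac)
    also have "\<dots> = (b4 * b5) * (c4 * d5) * (a4 * a5 * f4 * f5)"
      unfolding that by (simp only: mult_ac)
    also have "\<dots> = (b1 * a3 * b3) * (e1 * e2 * e3) * (a4 * a5 * f4 * f5)"
      unfolding that ..
    also have "\<dots> = (a4 * f5 * f4 * a5 * e3 * b1 * b3 * e1) * (a3 * e2)"
      by (simp only: mult_ac)
    finally have "c3 * f3 * a1 * c1 * d3 * a2 * f1 * d1 * d2 * c2 = a4 * f5 * f4 * a5 * e3 * b1 * b3 * e1"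
      using nz by simp
    then have "(c3 * f3 * a1 * c1 * d3 * a2 * f1 * d1) * (d2 * c2) =
        (a4 * f5 * f4 * a5) * (e3 * b1 * b3 * e1)"
      by (simp only: mult_ac)
    with nz have "(c3 * f3 * a1 * c1 * d3 * a2 * f1 * d1) / (e3 * b1 * b3 * e1) = (a4 * f5 * f4 * a5) / (d2 * c2)"
      by (simp add: frac_eq_eq)
    then show ?thesis
      by (simp only: times_divide_times_eq mult.assoc)
  qed
  show ?thesis
    unfolding psi_def by (rule field[OF 1 2 3 4 5 6]) simp_all
qed

abbreviation theta where "theta \<equiv> tqd_theta G \<omega>"
abbreviation gamma where "gamma \<equiv> tqd_gamma G \<omega>"

abbreviation conjg :: "'g \<Rightarrow> 'g \<Rightarrow> 'g" where "conjg y g \<equiv> y \<otimes> g \<otimes> inv y"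

lemma theta_psi: "theta g x y = psi g (conj_by G x g) (conj_by G (x \<otimes> y) g) x y x y"
  by (simp add: psi_def tqd_theta_def)

lemma gamma_psi: "gamma x a b = psi x x x (conj_by G x a) (conj_by G x b) a b"
  by (simp add: psi_def tqd_gamma_def mult_ac)

lemma theta_cocycle:
  assumes [simp]: "g \<in> carrier G" "x \<in> carrier G" "y \<in> carrier G" "z \<in> carrier G"
  shows "theta g x y * theta g (x \<otimes> y) z = theta (conj_by G x g) y z * theta g x (y \<otimes> z)"
proof -
  let ?h = "conj_by G x g" and ?k = "conj_by G (x \<otimes> y) g" and ?l = "conj_by G (x \<otimes> y \<otimes> z) g"
  have "psi g ?h ?k x y x y * psi g ?k ?l (x \<otimes> y) z (x \<otimes> y) z * \<omega> x y z =
         psi ?h ?k ?l y z y z * psi g ?h ?l x (y \<otimes> z) x (y \<otimes> z) * \<omega> x y z"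
    by (rule psi_row) (simp_all add: conj_by_def word_simps)
  then show ?thesis
    by (simp add: theta_psi conj_by_def word_simps)
qed

lemma gamma_coassoc:
  assumes [simp]: "x \<in> carrier G" "a \<in> carrier G" "b \<in> carrier G" "c \<in> carrier G"
  shows "gamma x a b * gamma x (a \<otimes> b) c * \<omega> (conj_by G x a) (conj_by G x b) (conj_by G x c) =
         gamma x b c * gamma x a (b \<otimes> c) * \<omega> a b c"
  using psi_row[of x x x x "conj_by G x a" "conj_by G x b" "conj_by G x c" a b c]
  by (simp add: gamma_psi conj_by_def word_simps)

text \<open>
  This identity makes the comultiplication of the double multiplicative.
\<close>

lemma gamma_theta:
  assumes [simp]: "x \<in> carrier G" "y \<in> carrier G" "a \<in> carrier G" "b \<in> carrier G"
  shows "theta a x y * theta b x y * gamma x a b * gamma y (conj_by G x a) (conj_by G x b) =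
         theta (a \<otimes> b) x y * gamma (x \<otimes> y) a b"
proof -
  let ?a = "conj_by G x a" and ?a' = "conj_by G (x \<otimes> y) a"
  let ?b = "conj_by G x b" and ?b' = "conj_by G (x \<otimes> y) b"
  have "psi a ?a ?a' x y x y * psi b ?b ?b' x y x y *
          psi x x x ?a ?b a b * psi y y y ?a' ?b' ?a ?b =
        psi (a \<otimes> b) (?a \<otimes> ?b) (?a' \<otimes> ?b') x y x y *
          psi (x \<otimes> y) (x \<otimes> y) (x \<otimes> y) ?a' ?b' a b"
    by (rule psi_block) (simp_all add: conj_by_def word_simps)
  then show ?thesis
    by (simp add: theta_psi gamma_psi conj_by_def word_simps)
qed

text \<open>
  Rewriting rules that supplement \<open>word_simps\<close> when two of the letters commute: \<open>x\<close> moves to the left of \<open>c\<close>.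
\<close>

lemma commute_words:
  assumes "x \<in> carrier G" "c \<in> carrier G" "x \<otimes> c = c \<otimes> x"
  shows "c \<otimes> x = x \<otimes> c" "c \<otimes> inv x = inv x \<otimes> c"
    "inv c \<otimes> x = x \<otimes> inv c" "inv c \<otimes> inv x = inv x \<otimes> inv c"
    "\<And>w. w \<in> carrier G \<Longrightarrow> c \<otimes> (x \<otimes> w) = x \<otimes> (c \<otimes> w)"
    "\<And>w. w \<in> carrier G \<Longrightarrow> c \<otimes> (inv x \<otimes> w) = inv x \<otimes> (c \<otimes> w)"
    "\<And>w. w \<in> carrier G \<Longrightarrow> inv c \<otimes> (x \<otimes> w) = x \<otimes> (inv c \<otimes> w)"
    "\<And>w. w \<in> carrier G \<Longrightarrow> inv c \<otimes> (inv x \<otimes> w) = inv x \<otimes> (inv c \<otimes> w)"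
proof -
  show 1: "c \<otimes> x = x \<otimes> c" using assms by simp
  show 2: "c \<otimes> inv x = inv x \<otimes> c"
    by (metis assms inv_closed m_closed m_assoc inv_solve_left inv_solve_right)
  show 3: "inv c \<otimes> x = x \<otimes> inv c"
    by (metis assms inv_closed m_closed m_assoc inv_solve_left inv_solve_right)
  show 4: "inv c \<otimes> inv x = inv x \<otimes> inv c"
    using assms by (metis inv_mult_group)
  fix w assume w: "w \<in> carrier G"
  show "c \<otimes> (x \<otimes> w) = x \<otimes> (c \<otimes> w)" using assms w 1 by (metis m_assoc)
  show "c \<otimes> (inv x \<otimes> w) = inv x \<otimes> (c \<otimes> w)" using assms w 2 by (metis m_assoc inv_closed)
  show "inv c \<otimes> (x \<otimes> w) = x \<otimes> (inv c \<otimes> w)" using assms w 3 by (metis m_assoc inv_closed)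
  show "inv c \<otimes> (inv x \<otimes> w) = inv x \<otimes> (inv c \<otimes> w)" using assms w 4 by (metis m_assoc inv_closed)
qed

text \<open>
  The function \<open>F b = (\<Prod>j<e. \<omega> b (x ^ j) x)\<close> is multiplicative on the powers of \<open>x\<close>: in the product of
  the cocycle identities for \<open>(x ^ i, x, x ^ j, x)\<close> over \<open>j\<close>, the two factors that contain both
  \<open>x ^ i\<close> and a shifted \<open>x ^ j\<close> cancel against their unshifted counterparts because \<open>x ^ e = 1\<close>.
  Hence \<open>F x ^ e = F (x ^ e) = F 1 = 1\<close>.
\<close>

lemma slant_root_of_unity:
  assumes x: "x \<in> carrier G" and e: "x [^] e = \<one>"
  shows "(\<Prod>j<e. \<omega> x (x [^] j) x) ^ e = 1"
proof -
  define F where "F b = (\<Prod>j<e. \<omega> b (x [^] j) x)" for b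
  have shift: "(\<Prod>j<e. f (x [^] Suc j)) = (\<Prod>j<e. f (x [^] j))" for f :: "'g \<Rightarrow> 'k"
  proof (cases e)
    case (Suc n)
    define h where "h j = f (x [^] j)" for j :: nat
    have "h (Suc n) = h 0" using e Suc by (simp add: h_def del: nat_pow_Suc)
    then have "(\<Prod>j<Suc n. h (Suc j)) = (\<Prod>j<Suc n. h j)"
      by (subst (2) prod.lessThan_Suc_shift) (simp add: mult.commute)
    then show ?thesis unfolding h_def Suc .
  qed simp
  have step: "F x * F (x [^] i) = F (x [^] Suc i)" for i :: nat
  proof -
    have cl [simp]: "x [^] j \<in> carrier G" for j :: nat using x by simp
    have cm: "x \<otimes> x [^] j = x [^] Suc j" for j :: nat
      using x nat_pow_comm[of x 1 j] by simp
    have "(\<Prod>j<e. \<omega> x (x [^] j) x * \<omega> (x [^] i) (x [^] Suc j) x * \<omega> (x [^] i) x (x [^] j)) =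
          (\<Prod>j<e. \<omega> (x [^] Suc i) (x [^] j) x * \<omega> (x [^] i) x (x [^] Suc j))"
    proof (intro prod.cong refl)
      fix j :: nat
      show "\<omega> x (x [^] j) x * \<omega> (x [^] i) (x [^] Suc j) x * \<omega> (x [^] i) x (x [^] j) =
          \<omega> (x [^] Suc i) (x [^] j) x * \<omega> (x [^] i) x (x [^] Suc j)"
        using cocycle[of "x [^] i" x "x [^] j" x] x by (simp add: cm)
    qed
    then have "F x * F (x [^] i) * (\<Prod>j<e. \<omega> (x [^] i) x (x [^] j)) =
        F (x [^] Suc i) * (\<Prod>j<e. \<omega> (x [^] i) x (x [^] j))"
      unfolding prod.distrib shift[of "\<lambda>t. \<omega> (x [^] i) t x"] shift[of "\<lambda>t. \<omega> (x [^] i) x t"]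
      by (simp add: F_def)
    moreover have "(\<Prod>j<e. \<omega> (x [^] i) x (x [^] j)) \<noteq> 0" using x by simp
    ultimately show ?thesis by simp
  qed
  have "F x ^ i = F (x [^] i)" for i :: nat
  proof (induction i)
    case 0 show ?case using x by (simp add: F_def)
  next
    case (Suc i) then show ?case by (simp only: power_Suc step)
  qed
  from this[of e] show ?thesis
    using x e by (simp add: F_def)
qed

text \<open>
  The solution \<open>h'\<close> of \<open>h g = (x g x^-1) h'\<close>: the degree of a vector of degree \<open>h\<close> after an object of
  degree \<open>g\<close> has been moved past it and been acted upon by \<open>x\<close>.
\<close>

definition shift :: "'g \<Rightarrow> 'g \<Rightarrow> 'g \<Rightarrow> 'g" where
  "shift x g h = x \<otimes> inv g \<otimes> inv x \<otimes> h \<otimes> g"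

text \<open>
  The scalars in the composition laws of a half-braiding: \<open>tau\<close> comes from the hexagon, with \<open>psi\<close> of
  \<open>x\<close> for the action on a tensor product and \<open>psi\<close> of \<open>h\<close> for the three associators; \<open>kappa\<close> comes from
  linearity over the double.
\<close>

definition tau :: "'g \<Rightarrow> 'g \<Rightarrow> 'g \<Rightarrow> 'g \<Rightarrow> 'k" where
  "tau x h g f =
     psi x x x g f (conjg x g) (conjg x f) /
     psi h (shift x g h) (shift x f (shift x g h)) g f (conjg x g) (conjg x f)"

definition kappa :: "'g \<Rightarrow> 'g \<Rightarrow> 'g \<Rightarrow> 'g \<Rightarrow> 'k" where
  "kappa y x h g =
     gamma y (conjg y h) (conjg y g) * theta (conjg (y \<otimes> x) g) (conjg y x) y /
     (gamma y (conjg (y \<otimes> x) g) (conjg y (shift x g h)) * theta (conjg (y \<otimes> x) g) y x)"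

lemma shift_closed [simp]:
  "\<lbrakk>x \<in> carrier G; g \<in> carrier G; h \<in> carrier G\<rbrakk> \<Longrightarrow> shift x g h \<in> carrier G"
  by (simp add: shift_def)

lemma conj_by_closed [simp]:
  "\<lbrakk>x \<in> carrier G; g \<in> carrier G\<rbrakk> \<Longrightarrow> conj_by G x g \<in> carrier G"
  by (simp add: conj_by_def)

lemma theta_nonzero [simp]:
  "\<lbrakk>g \<in> carrier G; x \<in> carrier G; y \<in> carrier G\<rbrakk> \<Longrightarrow> theta g x y \<noteq> 0"
  by (simp add: tqd_theta_def)

lemma gamma_nonzero [simp]:
  "\<lbrakk>g \<in> carrier G; x \<in> carrier G; y \<in> carrier G\<rbrakk> \<Longrightarrow> gamma g x y \<noteq> 0"
  by (simp add: tqd_gamma_def)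

lemmas scalar_defs = tau_def kappa_def psi_def tqd_theta_def tqd_gamma_def conj_by_def shift_def

end

section \<open>The twist and its order\<close>

text \<open>
  The multiplicative structure carried by the homogeneous vectors of an object of the center.
  Besides its degree \<open>hd\<close> as a module of the double, a vector has the degree \<open>xd\<close>, the group element
  by which the half-braiding acts on the objects that it moves past the vector. The operator \<open>Y y\<close> is the
  action of \<open>y\<close>, and \<open>T g\<close> is what the half-braiding with an object of degree \<open>g\<close> does to the vector.
  Addition is left out so that pure tensors are again an instance.
\<close>

locale twisted_module = three_cocycle G \<omega>
  for G :: "('g, 'm) monoid_scheme" (structure) and \<omega> :: "'g \<Rightarrow> 'g \<Rightarrow> 'g \<Rightarrow> 'k :: field" +
  fixes V :: "'v set" and hd xd :: "'v \<Rightarrow> 'g" and sc :: "'k \<Rightarrow> 'v \<Rightarrow> 'v"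
    and Y T :: "'g \<Rightarrow> 'v \<Rightarrow> 'v"
  assumes degree_closed [simp]: "v \<in> V \<Longrightarrow> hd v \<in> carrier G" "v \<in> V \<Longrightarrow> xd v \<in> carrier G"
    and sc_closed [simp]: "v \<in> V \<Longrightarrow> sc a v \<in> V"
    and sc_degree [simp]: "v \<in> V \<Longrightarrow> hd (sc a v) = hd v" "v \<in> V \<Longrightarrow> xd (sc a v) = xd v"
    and sc_sc [simp]: "v \<in> V \<Longrightarrow> sc a (sc b v) = sc (a * b) v"
    and sc_one [simp]: "v \<in> V \<Longrightarrow> sc 1 v = v"
    and Y_closed [simp]: "\<lbrakk>y \<in> carrier G; v \<in> V\<rbrakk> \<Longrightarrow> Y y v \<in> V"
    and Y_degree [simp]:
      "\<lbrakk>y \<in> carrier G; v \<in> V\<rbrakk> \<Longrightarrow> hd (Y y v) = conjg y (hd v)"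
      "\<lbrakk>y \<in> carrier G; v \<in> V\<rbrakk> \<Longrightarrow> xd (Y y v) = conjg y (xd v)"
    and T_closed [simp]: "\<lbrakk>g \<in> carrier G; v \<in> V\<rbrakk> \<Longrightarrow> T g v \<in> V"
    and T_degree [simp]:
      "\<lbrakk>g \<in> carrier G; v \<in> V\<rbrakk> \<Longrightarrow> hd (T g v) = shift (xd v) g (hd v)"
      "\<lbrakk>g \<in> carrier G; v \<in> V\<rbrakk> \<Longrightarrow> xd (T g v) = xd v"
    and Y_sc [simp]: "\<lbrakk>y \<in> carrier G; v \<in> V\<rbrakk> \<Longrightarrow> Y y (sc a v) = sc a (Y y v)"
    and T_sc [simp]: "\<lbrakk>g \<in> carrier G; v \<in> V\<rbrakk> \<Longrightarrow> T g (sc a v) = sc a (T g v)"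
    and Y_one [simp]: "v \<in> V \<Longrightarrow> Y \<one> v = v"
    and T_one [simp]: "v \<in> V \<Longrightarrow> T \<one> v = v"
    and Y_Y: "\<lbrakk>y \<in> carrier G; z \<in> carrier G; v \<in> V\<rbrakk> \<Longrightarrow>
      Y y (Y z v) = sc (theta (conjg (y \<otimes> z) (hd v)) y z) (Y (y \<otimes> z) v)"
    and T_T: "\<lbrakk>g \<in> carrier G; f \<in> carrier G; v \<in> V\<rbrakk> \<Longrightarrow>
      T f (T g v) = sc (tau (xd v) (hd v) g f) (T (g \<otimes> f) v)"
    and Y_T: "\<lbrakk>y \<in> carrier G; g \<in> carrier G; v \<in> V\<rbrakk> \<Longrightarrow>
      Y y (T g v) = sc (kappa y (xd v) (hd v) g) (T (conjg y g) (Y y v))"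
begin

text \<open>
  The half-braiding of an object with itself moves \<open>w\<close> past \<open>v\<close> by letting \<open>xd v\<close> act on \<open>w\<close> and \<open>T (hd w)\<close>
  act on \<open>v\<close>. Contracting the two strands, so that both act on the same vector, gives the twist of the
  braided category.
\<close>

definition twist :: "'v \<Rightarrow> 'v" where
  "twist v = T (hd v) (Y (xd v) v)"

lemma twist_closed [simp]: "v \<in> V \<Longrightarrow> twist v \<in> V"
  by (simp add: twist_def)

lemma twist_degree [simp]:
  assumes [simp]: "v \<in> V"
  shows "hd (twist v) = hd v" "xd (twist v) = xd v"
  by (simp_all add: twist_def shift_def word_simps)

lemma twist_sc [simp]: "v \<in> V \<Longrightarrow> twist (sc a v) = sc a (twist v)"
  by (simp add: twist_def)

text \<open>
  Naturality: the twist commutes with all operators, and therefore with the double braiding, which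
  is composed of them.
\<close>

lemma twist_Y:
  assumes [simp]: "y \<in> carrier G" "v \<in> V"
  shows "twist (Y y v) = Y y (twist v)"
proof -
  let ?x = "xd v" and ?h = "hd v"
  have "kappa y ?x (conjg ?x ?h) ?h * theta (conjg (y \<otimes> ?x) ?h) y ?x =
      theta (conjg (y \<otimes> ?x) ?h) (conjg y ?x) y"
    by (simp add: kappa_def shift_def word_simps)
  then show ?thesis
    by (simp add: twist_def Y_T Y_Y word_simps)
qed

lemma twist_T:
  assumes [simp]: "g \<in> carrier G" "v \<in> V"
  shows "twist (T g v) = T g (twist v)"
proof -
  let ?x = "xd v" and ?h = "hd v"
  have "kappa ?x ?x ?h g * tau ?x (conjg ?x ?h) (conjg ?x g) (shift ?x g ?h) =
      tau ?x (conjg ?x ?h) ?h g"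
    by (simp add: scalar_defs word_simps field_simps)
  then show ?thesis
    by (simp add: twist_def Y_T T_T shift_def word_simps)
qed

text \<open>
  The center of the modules of the double of \<open>G\<close> consists of modules of a double of \<open>G \<times> G\<close>, with
  opposite multiplication in the second factor. In these terms a vector has degree
  \<open>(xd v, (xd v) ^-1 hd v)\<close>. On vectors with \<open>xd v\<close> in the centralizer of \<open>c\<close>, the following operator is
  the action of \<open>(c, 1)\<close>; it preserves both degrees.
\<close>

definition left_action :: "'g \<Rightarrow> 'v \<Rightarrow> 'v" where
  "left_action c v = T c (Y c v)"

lemma left_action:
  assumes [simp]: "v \<in> V" "c \<in> carrier G" and c: "xd v \<otimes> c = c \<otimes> xd v"
  shows "left_action c v \<in> V" "hd (left_action c v) = hd v" "xd (left_action c v) = xd v"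
  by (simp_all add: left_action_def shift_def word_simps commute_words[OF _ _ c])

text \<open>
  Besides \<open>\<omega> x c x\<close>, every factor from \<open>\<theta>\<close>, \<open>kappa\<close> and \<open>tau\<close> occurs once in the numerator and once in
  the denominator.
\<close>

lemma left_action_mult:
  assumes [simp]: "v \<in> V" "c \<in> carrier G" and c: "xd v \<otimes> c = c \<otimes> xd v"
  shows "left_action (xd v) (left_action c v) = sc (\<omega> (xd v) c (xd v)) (left_action (xd v \<otimes> c) v)"
proof -
  let ?x = "xd v" and ?h = "hd v"
  note cw = commute_words[OF _ _ c]
  have "theta (conjg (?x \<otimes> c) ?h) ?x c * kappa ?x ?x (conjg c ?h) c *
      tau ?x (conjg (?x \<otimes> c) ?h) c ?x = \<omega> ?x c ?x"
    by (simp add: scalar_defs word_simps cw field_simps)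
  then show ?thesis
    by (simp add: left_action_def T_T Y_T Y_Y shift_def word_simps cw mult_ac)
qed

text \<open>
  The action of \<open>(1, c)\<close> for \<open>c\<close> in the centralizer of \<open>k = (xd v) ^-1 hd v\<close>. The scalar compares the
  two groupings of \<open>x\<close>, \<open>k\<close> and \<open>c\<close> before and after the crossing; it makes the composition law depend on
  \<open>k\<close> alone.
\<close>

definition right_action :: "'g \<Rightarrow> 'v \<Rightarrow> 'v" where
  "right_action c v = (let x = xd v; k = inv x \<otimes> hd v in
     sc (\<omega> x k c * \<omega> (conjg x c) x k / \<omega> x c k) (T c v))"

lemma right_action:
  assumes [simp]: "v \<in> V" "c \<in> carrier G" and h: "hd v = xd v \<otimes> k"
    and [simp]: "k \<in> carrier G" and c: "k \<otimes> c = c \<otimes> k"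
  shows "right_action c v = sc (\<omega> (xd v) k c * \<omega> (conjg (xd v) c) (xd v) k / \<omega> (xd v) c k) (T c v)"
    "right_action c v \<in> V" "hd (right_action c v) = hd v" "xd (right_action c v) = xd v"
  by (simp_all add: right_action_def Let_def h shift_def word_simps commute_words[OF _ _ c])

text \<open>
  The cocycle identities for \<open>(x c x ^-1, x k x ^-1, x, k)\<close> and \<open>(x, k, c, k)\<close> split \<open>psi\<close> of
  \<open>h = x k\<close> in the denominator of \<open>tau\<close> into \<open>psi\<close> of \<open>x\<close>, which cancels, \<open>psi\<close> of \<open>k\<close>, which is
  \<open>\<omega> k c k\<close>, and the scalars in the definition of \<open>right_action\<close>.
\<close>

lemma right_action_mult:
  assumes [simp]: "v \<in> V" "c \<in> carrier G" and h: "hd v = xd v \<otimes> k"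
    and [simp]: "k \<in> carrier G" and c: "k \<otimes> c = c \<otimes> k"
  shows "right_action k (right_action c v) = sc (1 / \<omega> k c k) (right_action (k \<otimes> c) v)"
proof -
  let ?x = "xd v" and ?h = "hd v"
  note cw = commute_words[OF _ _ c]
  have 1: "\<omega> (conjg ?x k) ?x k * \<omega> (conjg ?x c) (?x \<otimes> k) k * \<omega> (conjg ?x c) (conjg ?x k) ?x =
      \<omega> (conjg ?x (k \<otimes> c)) ?x k * \<omega> (conjg ?x c) (conjg ?x k) (?x \<otimes> k)"
    using cocycle[of "conjg ?x c" "conjg ?x k" ?x k] by (simp add: word_simps cw)
  have 2: "\<omega> k c k * \<omega> ?x (k \<otimes> c) k * \<omega> ?x k c = \<omega> (?x \<otimes> k) c k * \<omega> ?x k (k \<otimes> c)"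
    using cocycle[of ?x k c k] by (simp add: word_simps cw)
  have a: "\<omega> (conjg ?x c) (conjg ?x k) (?x \<otimes> k) = \<omega> (conjg ?x k) ?x k * \<omega> (conjg ?x c) (?x \<otimes> k) k * \<omega> (conjg ?x c) (conjg ?x k) ?x / \<omega> (conjg ?x (k \<otimes> c)) ?x k"
    using 1 by (simp add: field_simps)
  have b: "\<omega> (?x \<otimes> k) c k = \<omega> k c k * \<omega> ?x (k \<otimes> c) k * \<omega> ?x k c / \<omega> ?x k (k \<otimes> c)"
    using 2 by (simp add: field_simps)
  have "tau ?x (?x \<otimes> k) c k =
     psi ?x ?x ?x c k (conjg ?x c) (conjg ?x k) /
     (\<omega> (?x \<otimes> k) c k * \<omega> (conjg ?x c) (conjg ?x k) (?x \<otimes> k) / \<omega> (conjg ?x c) (?x \<otimes> k) k)"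
    by (simp add: tau_def psi_def shift_def word_simps cw)
  then have *: "\<omega> ?x k k * \<omega> (conjg ?x k) ?x k / \<omega> ?x k k *
        (\<omega> ?x k c * \<omega> (conjg ?x c) ?x k / \<omega> ?x c k) * tau ?x (?x \<otimes> k) c k =
      1 / \<omega> k c k * (\<omega> ?x k (k \<otimes> c) * \<omega> (conjg ?x (k \<otimes> c)) ?x k / \<omega> ?x (k \<otimes> c) k)"
    unfolding a b by (simp add: psi_def field_simps)
  have kc: "k \<otimes> (k \<otimes> c) = (k \<otimes> c) \<otimes> k" by (simp add: word_simps cw)
  have "T k (T c v) = sc (tau ?x (?x \<otimes> k) c k) (T (k \<otimes> c) v)"
    by (simp add: T_T h cw)
  with * show ?thesis
    using right_action[of v "k \<otimes> c" k] right_action[of v c k] right_action[of "right_action c v" k k] h c kc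
    by (simp add: mult.assoc)
qed

text \<open>
  The twist is the action of the degree \<open>(x, k)\<close>. The scalar of \<open>right_action\<close> is absorbed by the
  cocycle identity for \<open>(x, x k x ^-1, x, k)\<close>.
\<close>

lemma twist_eq_actions:
  assumes [simp]: "v \<in> V"
  shows "twist v = right_action (inv (xd v) \<otimes> hd v) (left_action (xd v) v)"
proof -
  define x k where "x = xd v" and "k = inv x \<otimes> hd v"
  have [simp]: "x \<in> carrier G" "k \<in> carrier G" and h: "hd v = x \<otimes> k"
    by (simp_all add: x_def k_def word_simps)
  have L: "left_action x v \<in> V" "hd (left_action x v) = x \<otimes> k" "xd (left_action x v) = x"
    using left_action[of v x] by (simp_all add: x_def[symmetric] h)
  have c: "\<omega> (conjg x k) x k * \<omega> x (x \<otimes> k) k * \<omega> x (conjg x k) x =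
      \<omega> (x \<otimes> conjg x k) x k * \<omega> x (conjg x k) (x \<otimes> k)"
    using cocycle[of x "conjg x k" x k] by (simp add: word_simps)
  have "tau x (conjg x (x \<otimes> k)) x k = \<omega> x (conjg x k) x * \<omega> x (x \<otimes> k) k /
      (\<omega> (x \<otimes> conjg x k) x k * \<omega> x (conjg x k) (x \<otimes> k))"
    by (simp add: tau_def psi_def shift_def word_simps)
  then have "\<omega> (conjg x k) x k * tau x (conjg x (x \<otimes> k)) x k = 1"
    using c by (simp add: mult_ac)
  moreover have "left_action x v = T x (Y x v)" by (simp add: left_action_def)
  ultimately show ?thesis
    using L right_action[of "left_action x v" k k]
    by (simp add: twist_def T_T h x_def[symmetric] cancel_words)
qed

lemma left_action_one: "v \<in> V \<Longrightarrow> left_action \<one> v = v"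
  by (simp add: left_action_def)

lemma right_action_one: "v \<in> V \<Longrightarrow> right_action \<one> v = v"
  by (simp add: right_action_def Let_def)

lemma left_action_funpow:
  assumes v: "v \<in> V"
  shows "((\<lambda>v. left_action (xd v) v) ^^ i) v =
    sc (\<Prod>j<i. \<omega> (xd v) (xd v [^] j) (xd v)) (left_action (xd v [^] i) v)"
proof (induction i)
  case 0 show ?case using v by (simp add: left_action_one)
next
  case (Suc i)
  let ?x = "xd v"
  have cm: "?x \<otimes> ?x [^] i = ?x [^] i \<otimes> ?x"
    using v nat_pow_comm[of ?x 1 i] by simp
  have "xd v \<otimes> xd v [^] Suc i = xd v [^] Suc i \<otimes> xd v"
    using v nat_pow_comm[of ?x 1 "Suc i"] by simp
  note L = left_action[OF v _ cm] and L' = left_action[OF v _ this]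
  have "left_action ?x (sc a (left_action (?x [^] i) v)) = sc a (left_action ?x (left_action (?x [^] i) v))" for a
    using v L(1) by (simp add: left_action_def)
  moreover have "left_action ?x (left_action (?x [^] i) v) = sc (\<omega> ?x (?x [^] i) ?x) (left_action (?x [^] Suc i) v)"
    using left_action_mult[OF v _ cm] v cm by simp
  ultimately show ?case
    using v L L' by (simp add: Suc mult.commute del: nat_pow_Suc)
qed

lemma right_action_funpow:
  fixes v i
  defines "k \<equiv> inv (xd v) \<otimes> hd v"
  assumes v: "v \<in> V"
  shows "((\<lambda>v. right_action (inv (xd v) \<otimes> hd v) v) ^^ i) v =
    sc (1 / (\<Prod>j<i. \<omega> k (k [^] j) k)) (right_action (k [^] i) v)"
proof (induction i)
  case 0 show ?case using v by (simp add: right_action_one)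
next
  case (Suc i)
  have k: "k \<in> carrier G" and h: "hd v = xd v \<otimes> k" using v by (simp_all add: k_def word_simps)
  have cm: "k \<otimes> k [^] i = k [^] i \<otimes> k"
    using k nat_pow_comm[of k 1 i] by simp
  note R = right_action[OF v nat_pow_closed[OF k] h k cm]
  have "right_action k (sc a (right_action (k [^] i) v)) = sc a (right_action k (right_action (k [^] i) v))" for a
    using R(2) k by (simp add: right_action_def Let_def mult.commute)
  moreover have "right_action k (right_action (k [^] i) v) = sc (1 / \<omega> k (k [^] i) k) (right_action (k [^] Suc i) v)"
    using right_action_mult[OF v _ h k cm] k cm by simp
  moreover have "right_action (k [^] Suc i) v \<in> V"
    using right_action(2)[OF v _ h k, of "k [^] Suc i"] k nat_pow_comm[of k 1 "Suc i"] by simp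
  ultimately show ?case
    using R(2-4) v k by (simp add: Suc k_def[symmetric] mult.commute del: nat_pow_Suc)
qed

lemma funpow_scalar:
  assumes f: "\<And>v. v \<in> V \<Longrightarrow> f v \<in> V \<and> hd (f v) = hd v \<and> xd (f v) = xd v"
    and p: "\<And>v. v \<in> V \<Longrightarrow> (f ^^ e) v = sc (p (xd v) (hd v)) v"
    and v: "v \<in> V" and root: "p (xd v) (hd v) ^ e = 1"
  shows "(f ^^ (e * e)) v = v"
proof -
  have "((f ^^ e) ^^ i) v = sc (p (xd v) (hd v) ^ i) v" for i
    by (induction i) (simp_all add: p v)
  from this[of e] show ?thesis
    using v root by (simp add: funpow_mult)
qed

text \<open>
  The twist \<open>R \<circ> L\<close> commutes with \<open>R\<close>, which is a scalar multiple of some \<open>T\<close>. So its powers are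
  \<open>R ^ i \<circ> L ^ i\<close>. As \<open>x ^ e = 1\<close> and \<open>k ^ e = 1\<close>, both \<open>L ^ e\<close> and \<open>R ^ e\<close> are scalars, given by
  \<open>slant_root_of_unity\<close> and hence killed by another power \<open>e\<close>.
\<close>

theorem twist_order:
  assumes e: "\<And>x. x \<in> carrier G \<Longrightarrow> x [^] (e::nat) = \<one>" and v: "v \<in> V"
  shows "(twist ^^ (e * e)) v = v"
proof -
  define L R where "L v = left_action (xd v) v" and "R v = right_action (inv (xd v) \<otimes> hd v) v" for v
  have L: "L v \<in> V \<and> hd (L v) = hd v \<and> xd (L v) = xd v" if "v \<in> V" for v
    using left_action[OF that, of "xd v"] that by (simp add: L_def)
  have R: "R v \<in> V \<and> hd (R v) = hd v \<and> xd (R v) = xd v" if "v \<in> V" for v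
    using right_action[OF that, of "inv (xd v) \<otimes> hd v" "inv (xd v) \<otimes> hd v"] that
    by (simp add: R_def word_simps)
  have tw: "twist v = R (L v)" if "v \<in> V" for v
    using twist_eq_actions[OF that] L[OF that] by (simp add: R_def L_def)
  have comm: "twist (R v) = R (twist v)" if "v \<in> V" for v
    using that by (simp add: R_def right_action_def Let_def twist_T)
  have Li: "(L ^^ i) v \<in> V \<and> hd ((L ^^ i) v) = hd v \<and> xd ((L ^^ i) v) = xd v" if "v \<in> V" for i v
    by (induction i) (use L that in auto)
  have Ri: "(R ^^ i) v \<in> V" if "v \<in> V" for i v
    by (induction i) (use R that in auto)
  have commi: "twist ((R ^^ i) v) = (R ^^ i) (twist v)" if "v \<in> V" for i v
    by (induction i) (use comm Ri that in auto)
  have "(twist ^^ i) v = (R ^^ i) ((L ^^ i) v)" for i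
    by (induction i) (simp_all add: commi Li v tw funpow_swap1)
  moreover have "(L ^^ (e * e)) v = v"
  proof (rule funpow_scalar[OF L _ v])
    show "(L ^^ e) v = sc (\<Prod>j<e. \<omega> (xd v) (xd v [^] j) (xd v)) v" if "v \<in> V" for v
      using left_action_funpow[OF that, of e] that by (simp add: L_def[abs_def] e left_action_one)
    show "(\<Prod>j<e. \<omega> (xd v) (xd v [^] j) (xd v)) ^ e = 1"
      using slant_root_of_unity e v by simp
  qed
  moreover have "(R ^^ (e * e)) v = v"
  proof (rule funpow_scalar[OF R _ v])
    let ?k = "\<lambda>x h. inv x \<otimes> h"
    let ?p = "\<lambda>x h. 1 / (\<Prod>j<e. \<omega> (?k x h) (?k x h [^] j) (?k x h))"
    show "(R ^^ e) v = sc (?p (xd v) (hd v)) v" if "v \<in> V" for v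
      using right_action_funpow[OF that, of e] that by (simp add: R_def[abs_def] e right_action_one)
    show "?p (xd v) (hd v) ^ e = 1"
      using slant_root_of_unity[of "?k (xd v) (hd v)" e] e v by (simp add: power_one_over)
  qed
  ultimately show ?thesis by simp
qed

end

section \<open>Tensor products and the balancing equation\<close>

context three_cocycle begin

text \<open>
  For a tensor product of two objects of the center, an object of degree \<open>f\<close> is moved past the second
  factor, acted upon by \<open>x'\<close>, then moved past the first one and acted upon by \<open>x\<close>. The three associators
  involved contribute \<open>1 / psi\<close>, and \<open>\<theta>\<close> combines the two actions into that of \<open>x x'\<close>.
\<close>

definition tensor_factor :: "'g \<Rightarrow> 'g \<Rightarrow> 'g \<Rightarrow> 'g \<Rightarrow> 'g \<Rightarrow> 'k" where
  "tensor_factor x h x' l f = theta (conjg (x \<otimes> x') f) x x' /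
     psi (conjg (x \<otimes> x') f) (conjg x' f) f (shift x (conjg x' f) h) (shift x' f l) h l"

text \<open>
  The composition law for the tensor product follows from two blocks of crossings: \<open>psi_block\<close> for
  the degrees \<open>h, l\<close> and \<open>gamma_theta\<close> for the acting elements \<open>x, x'\<close>.
\<close>

lemma tau_tensor:
  assumes [simp]: "x \<in> carrier G" "h \<in> carrier G" "x' \<in> carrier G" "l \<in> carrier G"
    "g \<in> carrier G" "f \<in> carrier G"
  shows "tensor_factor x h x' l g * tensor_factor x (shift x (conjg x' g) h) x' (shift x' g l) f *
      tau x h (conjg x' g) (conjg x' f) * tau x' l g f =
    tau (x \<otimes> x') (h \<otimes> l) g f * tensor_factor x h x' l (g \<otimes> f)"
proof -
  define g1 f1 g2 f2 where "g1 = conjg x' g" and "f1 = conjg x' f"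
    and "g2 = conjg (x \<otimes> x') g" and "f2 = conjg (x \<otimes> x') f"
  define h1 l1 where "h1 = shift x g1 h" and "l1 = shift x' g l"
  define h2 l2 where "h2 = shift x f1 h1" and "l2 = shift x' f l1"
  note defs = g1_def f1_def g2_def f2_def h1_def l1_def h2_def l2_def shift_def
  have [simp]: "g1 \<in> carrier G" "f1 \<in> carrier G" "g2 \<in> carrier G" "f2 \<in> carrier G"
    "h1 \<in> carrier G" "l1 \<in> carrier G" "h2 \<in> carrier G" "l2 \<in> carrier G"
    by (simp_all add: g1_def f1_def g2_def f2_def h1_def l1_def h2_def l2_def)
  have blk: "psi h h1 h2 g1 f1 g2 f2 * psi l l1 l2 g f g1 f1 *
           psi g2 g1 g h1 l1 h l * psi f2 f1 f h2 l2 h1 l1 =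
         psi (h \<otimes> l) (h1 \<otimes> l1) (h2 \<otimes> l2) g f g2 f2 *
           psi (g2 \<otimes> f2) (g1 \<otimes> f1) (g \<otimes> f) h2 l2 h l"
    by (rule psi_block) (simp_all add: defs word_simps)
  have gt: "theta g2 x x' * theta f2 x x' * psi x x x g1 f1 g2 f2 * psi x' x' x' g f g1 f1 =
      theta (g2 \<otimes> f2) x x' * psi (x \<otimes> x') (x \<otimes> x') (x \<otimes> x') g f g2 f2"
    using gamma_theta[of x x' g2 f2] by (simp add: gamma_psi conj_by_def defs word_simps)
  have 1: "tensor_factor x h x' l g = theta g2 x x' / psi g2 g1 g h1 l1 h l"
    by (simp add: tensor_factor_def defs)
  have 2: "tensor_factor x (shift x (conjg x' g) h) x' (shift x' g l) f = theta f2 x x' / psi f2 f1 f h2 l2 h1 l1"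
    by (simp add: tensor_factor_def defs)
  have 3: "tau x h (conjg x' g) (conjg x' f) = psi x x x g1 f1 g2 f2 / psi h h1 h2 g1 f1 g2 f2"
    by (simp add: tau_def defs word_simps)
  have 4: "tau x' l g f = psi x' x' x' g f g1 f1 / psi l l1 l2 g f g1 f1"
    by (simp add: tau_def defs word_simps)
  have 5: "tau (x \<otimes> x') (h \<otimes> l) g f = psi (x \<otimes> x') (x \<otimes> x') (x \<otimes> x') g f g2 f2 /
      psi (h \<otimes> l) (h1 \<otimes> l1) (h2 \<otimes> l2) g f g2 f2"
    by (simp add: tau_def defs word_simps)
  have 6: "tensor_factor x h x' l (g \<otimes> f) = theta (g2 \<otimes> f2) x x' / psi (g2 \<otimes> f2) (g1 \<otimes> f1) (g \<otimes> f) h2 l2 h l"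
    by (simp add: tensor_factor_def defs word_simps)
  have field: "a / q1 * (b / q2) * (c / p1) * (d / p2) = c' / p3 * (a' / q3)"
    if "p1 * p2 * q1 * q2 = p3 * q3" "a * b * c * d = a' * c'" for a b c d p1 p2 p3 q1 q2 q3 a' c' :: 'k
  proof -
    have "a / q1 * (b / q2) * (c / p1) * (d / p2) = (a * b * c * d) / (p1 * p2 * q1 * q2)"
      by (simp add: mult_ac)
    then show ?thesis unfolding that by simp
  qed
  show ?thesis
    unfolding 1 2 3 4 5 6 by (rule field[OF blk gt])
qed

text \<open>
  For a group element \<open>y\<close>: \<open>gamma_coassoc\<close> moves \<open>y\<close> through each of the three associators in
  \<open>tensor_factor\<close>, and three instances of \<open>theta_cocycle\<close> move it from the left to the right of \<open>x x'\<close>.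
\<close>

lemma kappa_tensor:
  assumes [simp]: "x \<in> carrier G" "h \<in> carrier G" "x' \<in> carrier G" "l \<in> carrier G"
    "g \<in> carrier G" "y \<in> carrier G"
  shows "tensor_factor x h x' l g * gamma y (conjg y (shift x (conjg x' g) h)) (conjg y (shift x' g l)) *
      kappa y x h (conjg x' g) * kappa y x' l g =
    kappa y (x \<otimes> x') (h \<otimes> l) g * gamma y (conjg y h) (conjg y l) *
      tensor_factor (conjg y x) (conjg y h) (conjg y x') (conjg y l) (conjg y g)"
proof -
  define g1 g2 where "g1 = conjg x' g" and "g2 = conjg (x \<otimes> x') g"
  define h1 l1 where "h1 = shift x g1 h" and "l1 = shift x' g l"
  define H L H1 L1 where "H = conjg y h" and "L = conjg y l" and "H1 = conjg y h1" and "L1 = conjg y l1"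
  define E E1 E2 where "E = conjg y g" and "E1 = conjg y g1" and "E2 = conjg y g2"
  define z z' where "z = conjg y x" and "z' = conjg y x'"
  note defs = g1_def g2_def h1_def l1_def H_def L_def H1_def L1_def E_def E1_def E2_def
    z_def z'_def shift_def
  have [simp]: "g1 \<in> carrier G" "g2 \<in> carrier G" "h1 \<in> carrier G" "l1 \<in> carrier G"
    "H \<in> carrier G" "L \<in> carrier G" "H1 \<in> carrier G" "L1 \<in> carrier G"
    "E \<in> carrier G" "E1 \<in> carrier G" "E2 \<in> carrier G" "z \<in> carrier G" "z' \<in> carrier G"
    by (simp_all add: g1_def g2_def h1_def l1_def H_def L_def H1_def L1_def E_def E1_def E2_def
      z_def z'_def)
  have c1: "gamma y H L * gamma y (H \<otimes> L) E * \<omega> h l g = gamma y L E * gamma y H (L \<otimes> E) * \<omega> H L E"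
    using gamma_coassoc[of y H L E] by (simp add: conj_by_def defs word_simps)
  have c2: "gamma y H E1 * gamma y (H \<otimes> E1) L1 * \<omega> h g1 l1 =
      gamma y E1 L1 * gamma y H (L \<otimes> E) * \<omega> H E1 L1"
    using gamma_coassoc[of y H E1 L1] by (simp add: conj_by_def defs word_simps)
  have c3: "gamma y E2 H1 * gamma y (H \<otimes> E1) L1 * \<omega> g2 h1 l1 =
      gamma y H1 L1 * gamma y E2 (H1 \<otimes> L1) * \<omega> E2 H1 L1"
    using gamma_coassoc[of y E2 H1 L1] by (simp add: conj_by_def defs word_simps)
  have t1: "theta E2 y x * theta E2 (y \<otimes> x) x' = theta g2 x x' * theta E2 y (x \<otimes> x')"
    using theta_cocycle[of E2 y x x'] by (simp add: conj_by_def defs word_simps)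
  have t2: "theta E2 z y * theta E2 (y \<otimes> x) x' = theta E1 y x' * theta E2 z (y \<otimes> x')"
    using theta_cocycle[of E2 z y x'] by (simp add: conj_by_def defs word_simps)
  have t3: "theta E2 z z' * theta E2 (z \<otimes> z') y = theta E1 z' y * theta E2 z (y \<otimes> x')"
    using theta_cocycle[of E2 z z' y] by (simp add: conj_by_def defs word_simps)
  have 1: "tensor_factor x h x' l g = theta g2 x x' / (\<omega> g2 h1 l1 * \<omega> h l g / \<omega> h g1 l1)"
    by (simp add: tensor_factor_def psi_def defs)
  have 2: "tensor_factor (conjg y x) (conjg y h) (conjg y x') (conjg y l) (conjg y g) =
      theta E2 z z' / (\<omega> E2 H1 L1 * \<omega> H L E / \<omega> H E1 L1)"
    by (simp add: tensor_factor_def psi_def defs word_simps)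
  have 3: "kappa y x h (conjg x' g) = gamma y H E1 * theta E2 z y / (gamma y E2 H1 * theta E2 y x)"
    by (simp add: kappa_def defs word_simps)
  have 4: "kappa y x' l g = gamma y L E * theta E1 z' y / (gamma y E1 L1 * theta E1 y x')"
    by (simp add: kappa_def defs word_simps)
  have 5: "kappa y (x \<otimes> x') (h \<otimes> l) g = gamma y (H \<otimes> L) E * theta E2 (z \<otimes> z') y /
      (gamma y E2 (H1 \<otimes> L1) * theta E2 y (x \<otimes> x'))"
    by (simp add: kappa_def defs word_simps)
  have 6: "gamma y (conjg y (shift x (conjg x' g) h)) (conjg y (shift x' g l)) = gamma y H1 L1"
    by (simp add: defs word_simps)
  have field: "s1 / (w3 * w1 / w2) * i * (a * s2 / (b * s3)) * (c * s4 / (d * s5)) =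
      e * s6 / (k * s7) * j * (s8 / (v3 * v1 / v2))"
    if "j * e * w1 = c * m * v1" "a * n * w2 = d * m * v2" "b * n * w3 = i * k * v3"
      "s3 * r = s1 * s7" "s2 * r = s5 * q" "s8 * s6 = s4 * q"
      and nz: "w1 \<noteq> 0" "w2 \<noteq> 0" "w3 \<noteq> 0" "v1 \<noteq> 0" "v2 \<noteq> 0" "v3 \<noteq> 0" "a \<noteq> 0" "b \<noteq> 0" "c \<noteq> 0"
        "d \<noteq> 0" "k \<noteq> 0" "m \<noteq> 0" "n \<noteq> 0" "q \<noteq> 0" "r \<noteq> 0" "s3 \<noteq> 0" "s5 \<noteq> 0" "s7 \<noteq> 0"
    for a b c d e i j k m n q r v1 v2 v3 w1 w2 w3 s1 s2 s3 s4 s5 s6 s7 s8 :: 'k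
  proof -
    have "(s1 * w2 * i * a * s2 * c * s4 * (k * s7 * v3 * v1)) * (m * n * q * r) =
        (a * n * w2) * (i * k * v3) * (c * m * v1) * (s1 * s7) * (s2 * r) * (s4 * q)"
      by (simp only: mult_ac)
    also have "\<dots> = (d * m * v2) * (b * n * w3) * (j * e * w1) * (s3 * r) * (s5 * q) * (s8 * s6)"
      unfolding that by (simp only: mult_ac)
    also have "\<dots> = (e * s6 * j * s8 * v2 * (w3 * w1 * b * s3 * d * s5)) * (m * n * q * r)"
      by (simp only: mult_ac)
    finally have "s1 * w2 * i * a * s2 * c * s4 * (k * s7 * v3 * v1) =
        e * s6 * j * s8 * v2 * (w3 * w1 * b * s3 * d * s5)"
      using nz by simp
    then have "(s1 * w2 * i * a * s2 * c * s4) / (w3 * w1 * b * s3 * d * s5) =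
        (e * s6 * j * s8 * v2) / (k * s7 * v3 * v1)"
      using nz by (simp add: frac_eq_eq)
    then show ?thesis by (simp add: mult_ac)
  qed
  show ?thesis
    unfolding 1 2 3 4 5 6 unfolding H_def[symmetric] L_def[symmetric]
    by (rule field[OF c1 c2 c3 t1 t2 t3]) simp_all
qed

text \<open>
  Both sides of the balancing equation apply \<open>X = x x'\<close> and a half-braiding of degree \<open>h l\<close> to a pure
  tensor. The scalars are compared in three moves: \<open>gamma_theta\<close> splits the action of \<open>X = q x\<close>,
  \<open>gamma_coassoc\<close> moves \<open>q\<close> through the degrees, and one cocycle identity remains.
\<close>

lemma balancing_scalars:
  assumes [simp]: "x \<in> carrier G" "h \<in> carrier G" "x' \<in> carrier G" "l \<in> carrier G"
  defines "q \<equiv> conjg x x'" and "X \<equiv> x \<otimes> x'"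
  shows "tau x (conjg x h) h l * kappa q x (conjg x h) (h \<otimes> l) * theta (conjg X h) q x *
      (kappa x x' (conjg x' l) l * theta (conjg X l) x x' *
        tau q (conjg X l) (conjg x l) (shift x l h)) =
    gamma X (conjg X h) (conjg X l) *
      tensor_factor (conjg X x) (conjg X h) (conjg X x') (conjg X l) (h \<otimes> l)"
proof -
  define H L where "H = conjg X h" and "L = conjg X l"
  define m c where "m = shift x l h" and "c = conjg q m"
  define n where "n = inv c \<otimes> (h \<otimes> l)"
  define A1 B1 where "A1 = conjg x h" and "B1 = conjg x l"
  note defs = H_def L_def c_def n_def m_def A1_def B1_def q_def X_def shift_def
  have [simp]: "q \<in> carrier G" "X \<in> carrier G" "H \<in> carrier G" "L \<in> carrier G" "m \<in> carrier G"
    "c \<in> carrier G" "n \<in> carrier G" "A1 \<in> carrier G" "B1 \<in> carrier G"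
    by (simp_all add: H_def L_def c_def n_def m_def A1_def B1_def q_def X_def)
  have 1: "tau x (conjg x h) h l = gamma x A1 B1 / \<omega> A1 B1 m"
    by (simp add: scalar_defs defs word_simps)
  have 2: "kappa q x (conjg x h) (h \<otimes> l) = gamma q H (L \<otimes> c) * theta (H \<otimes> L) (conjg X x) q /
      (gamma q (H \<otimes> L) c * theta (H \<otimes> L) q x)"
    by (simp add: kappa_def defs word_simps)
  have 3: "kappa x x' (conjg x' l) l * theta (conjg X l) x x' = theta L q x"
    by (simp add: kappa_def defs word_simps)
  have 4: "tau q (conjg X l) (conjg x l) (shift x l h) = gamma q L c / \<omega> L c n"
    by (simp add: scalar_defs defs word_simps)
  have 5: "tensor_factor (conjg X x) (conjg X h) (conjg X x') (conjg X l) (h \<otimes> l) =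
      theta (H \<otimes> L) (conjg X x) q / (\<omega> (H \<otimes> L) c n * \<omega> H L (c \<otimes> n) / \<omega> H (L \<otimes> c) n)"
    by (simp add: tensor_factor_def psi_def defs word_simps)
  have a: "theta H q x * theta L q x * gamma q H L * gamma x A1 B1 = theta (H \<otimes> L) q x * gamma X H L"
    using gamma_theta[of q x H L] by (simp add: conj_by_def defs word_simps)
  have b: "gamma q H L * gamma q (H \<otimes> L) c * \<omega> A1 B1 m = gamma q L c * gamma q H (L \<otimes> c) * \<omega> H L c"
    using gamma_coassoc[of q H L c] by (simp add: conj_by_def defs word_simps)
  have c: "\<omega> L c n * \<omega> H (L \<otimes> c) n * \<omega> H L c = \<omega> (H \<otimes> L) c n * \<omega> H L (c \<otimes> n)"
    by (rule cocycle) simp_all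
  have field: "g1 / w1 * (g2 * t1 / (g3 * t2)) * t3 * (t4 * (g4 / w2)) =
      g5 * (t1 / (w3 * w4 / w5))"
    if "t3 * t4 * g6 * g1 = t2 * g5" "g6 * g3 * w1 = g4 * g2 * w6" "w2 * w5 * w6 = w3 * w4"
      and nz: "w1 \<noteq> 0" "w2 \<noteq> 0" "w3 \<noteq> 0" "w4 \<noteq> 0" "w5 \<noteq> 0" "w6 \<noteq> 0" "g6 \<noteq> 0" "g3 \<noteq> 0" "t2 \<noteq> 0"
    for g1 g2 g3 g4 g5 g6 t1 t2 t3 t4 w1 w2 w3 w4 w5 w6 :: 'k
  proof -
    have "(g1 * g2 * t1 * t3 * t4 * g4 * (w3 * w4)) * (g6 * w6) =
        (t3 * t4 * g6 * g1) * (g4 * g2 * w6) * (t1 * (w3 * w4))"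
      by (simp only: mult_ac)
    also have "\<dots> = (t2 * g5) * (g6 * g3 * w1) * (t1 * (w2 * w5 * w6))"
      unfolding that ..
    also have "\<dots> = (g5 * t1 * w5 * (w1 * g3 * t2 * w2)) * (g6 * w6)"
      by (simp only: mult_ac)
    finally have "g1 * g2 * t1 * t3 * t4 * g4 * (w3 * w4) = g5 * t1 * w5 * (w1 * g3 * t2 * w2)"
      using nz by simp
    then have "(g1 * g2 * t1 * t3 * t4 * g4) / (w1 * g3 * t2 * w2) = (g5 * t1 * w5) / (w3 * w4)"
      using nz by (simp add: frac_eq_eq)
    then show ?thesis by (simp add: mult_ac)
  qed
  show ?thesis
    unfolding 1 2 3 4 5 unfolding H_def[symmetric] L_def[symmetric]
    by (rule field[OF a b c]) simp_all
qed

end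

text \<open>
  Pure tensors \<open>j a b\<close> of homogeneous vectors, with the operators prescribed by the comultiplication
  of the double and by the half-braiding on a tensor product.
\<close>

locale tensor_modules =
  three_cocycle G \<omega> + A: twisted_module G \<omega> V1 hd1 xd1 sc1 Y1 T1 + B: twisted_module G \<omega> V2 hd2 xd2 sc2 Y2 T2
  for G :: "('g, 'm) monoid_scheme" (structure) and \<omega> :: "'g \<Rightarrow> 'g \<Rightarrow> 'g \<Rightarrow> 'k :: field"
    and V1 :: "'a set" and hd1 xd1 sc1 Y1 T1 and V2 :: "'b set" and hd2 xd2 sc2 Y2 T2 +
  fixes j :: "'a \<Rightarrow> 'b \<Rightarrow> 't" and hd xd :: "'t \<Rightarrow> 'g" and sc :: "'k \<Rightarrow> 't \<Rightarrow> 't"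
    and Y T :: "'g \<Rightarrow> 't \<Rightarrow> 't"
  assumes j_degree [simp]:
      "\<lbrakk>a \<in> V1; b \<in> V2\<rbrakk> \<Longrightarrow> hd (j a b) = hd1 a \<otimes> hd2 b"
      "\<lbrakk>a \<in> V1; b \<in> V2\<rbrakk> \<Longrightarrow> xd (j a b) = xd1 a \<otimes> xd2 b"
    and sc_j: "\<lbrakk>a \<in> V1; b \<in> V2\<rbrakk> \<Longrightarrow> sc s (j a b) = j (sc1 s a) b"
    and j_sc: "\<lbrakk>a \<in> V1; b \<in> V2\<rbrakk> \<Longrightarrow> j a (sc2 s b) = j (sc1 s a) b"
    and Y_j: "\<lbrakk>y \<in> carrier G; a \<in> V1; b \<in> V2\<rbrakk> \<Longrightarrow>
      Y y (j a b) = sc (gamma y (conjg y (hd1 a)) (conjg y (hd2 b))) (j (Y1 y a) (Y2 y b))"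
    and T_j: "\<lbrakk>g \<in> carrier G; a \<in> V1; b \<in> V2\<rbrakk> \<Longrightarrow>
      T g (j a b) = sc (tensor_factor (xd1 a) (hd1 a) (xd2 b) (hd2 b) g)
        (j (T1 (conjg (xd2 b) g) a) (T2 g b))"
begin

definition V :: "'t set" where "V = {j a b | a b. a \<in> V1 \<and> b \<in> V2}"

lemma V_I [simp]: "\<lbrakk>a \<in> V1; b \<in> V2\<rbrakk> \<Longrightarrow> j a b \<in> V"
  by (auto simp: V_def)

sublocale tensor: twisted_module G \<omega> V hd xd sc Y T
proof unfold_locales
  note [simp] = sc_j j_sc Y_j T_j
  fix v s t y z g f
  assume "v \<in> V"
  then obtain a b where v: "v = j a b" and [simp]: "a \<in> V1" "b \<in> V2"
    by (auto simp: V_def)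
  show "hd v \<in> carrier G" "xd v \<in> carrier G" "sc s v \<in> V" "hd (sc s v) = hd v"
    "xd (sc s v) = xd v" "sc s (sc t v) = sc (s * t) v" "sc 1 v = v"
    by (simp_all add: v)
  show "Y \<one> v = v"
    by (simp add: v tqd_gamma_def conj_by_def)
  show "T \<one> v = v"
    by (simp add: v tensor_factor_def psi_def shift_def tqd_theta_def conj_by_def word_simps)
  show "Y y v \<in> V" "hd (Y y v) = conjg y (hd v)" "xd (Y y v) = conjg y (xd v)"
    "Y y (sc s v) = sc s (Y y v)" if "y \<in> carrier G"
    using that by (simp_all add: v word_simps mult.commute)
  show "T g v \<in> V" "hd (T g v) = shift (xd v) g (hd v)" "xd (T g v) = xd v"
    "T g (sc s v) = sc s (T g v)" if "g \<in> carrier G"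
    using that by (simp_all add: v word_simps shift_def mult.commute)
  show "Y y (Y z v) = sc (theta (conjg (y \<otimes> z) (hd v)) y z) (Y (y \<otimes> z) v)"
    if [simp]: "y \<in> carrier G" "z \<in> carrier G"
  proof -
    define H L where "H = conjg (y \<otimes> z) (hd1 a)" and "L = conjg (y \<otimes> z) (hd2 b)"
    have "theta H y z * theta L y z * gamma y H L * gamma z (conjg z (hd1 a)) (conjg z (hd2 b)) =
        theta (H \<otimes> L) y z * gamma (y \<otimes> z) H L"
      using gamma_theta[of y z H L] by (simp add: H_def L_def conj_by_def word_simps)
    then have "gamma z (conjg z (hd1 a)) (conjg z (hd2 b)) * gamma y H L * theta L y z * theta H y z =
        theta (H \<otimes> L) y z * gamma (y \<otimes> z) H L"
      by (simp add: mult_ac)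
    then show ?thesis
      by (simp add: v A.Y_Y B.Y_Y H_def L_def word_simps mult_ac)
  qed
  show "T f (T g v) = sc (tau (xd v) (hd v) g f) (T (g \<otimes> f) v)"
    if [simp]: "g \<in> carrier G" "f \<in> carrier G"
    using tau_tensor[of "xd1 a" "hd1 a" "xd2 b" "hd2 b" g f]
    by (simp add: v A.T_T B.T_T word_simps mult_ac)
  show "Y y (T g v) = sc (kappa y (xd v) (hd v) g) (T (conjg y g) (Y y v))"
    if [simp]: "y \<in> carrier G" "g \<in> carrier G"
    using kappa_tensor[of "xd1 a" "hd1 a" "xd2 b" "hd2 b" g y]
    by (simp add: v A.Y_T B.Y_T word_simps mult_ac)
qed

text \<open>
  The double braiding on a pair of homogeneous vectors. A half-braiding lets one group element act on
  one vector and one \<open>T\<close> on the other, so that no scalars occur.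
\<close>

definition monodromy :: "'a \<times> 'b \<Rightarrow> 'a \<times> 'b" where
  "monodromy = (\<lambda>(a, b). (Y1 (conjg (xd1 a) (xd2 b)) (T1 (hd2 b) a),
     T2 (shift (xd1 a) (hd2 b) (hd1 a)) (Y2 (xd1 a) b)))"

lemma monodromy_closed: "p \<in> V1 \<times> V2 \<Longrightarrow> monodromy p \<in> V1 \<times> V2"
  by (auto simp: monodromy_def)

text \<open>
  Both sides are multiples of the pure tensor obtained by letting \<open>x x'\<close> act on both factors and then
  applying half-braidings of degrees \<open>q h l q ^-1\<close> and \<open>h l\<close>; \<open>balancing_scalars\<close> compares the multiples.
\<close>

theorem balancing:
  assumes [simp]: "a \<in> V1" "b \<in> V2"
  shows "case_prod j (monodromy (A.twist a, B.twist b)) = tensor.twist (j a b)"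
proof -
  let ?x = "xd1 a" and ?h = "hd1 a" and ?x' = "xd2 b" and ?l = "hd2 b"
  let ?q = "conjg ?x ?x'" and ?X = "?x \<otimes> ?x'"
  have "Y1 ?q (T1 ?l (A.twist a)) =
      sc1 (tau ?x (conjg ?x ?h) ?h ?l * kappa ?q ?x (conjg ?x ?h) (?h \<otimes> ?l) *
        theta (conjg ?X ?h) ?q ?x) (T1 (conjg ?q (?h \<otimes> ?l)) (Y1 ?X a))"
    by (simp add: A.twist_def A.T_T A.Y_T A.Y_Y word_simps mult_ac)
  moreover have "T2 (shift ?x ?l ?h) (Y2 ?x (B.twist b)) =
      sc2 (kappa ?x ?x' (conjg ?x' ?l) ?l * theta (conjg ?X ?l) ?x ?x' *
        tau ?q (conjg ?X ?l) (conjg ?x ?l) (shift ?x ?l ?h)) (T2 (?h \<otimes> ?l) (Y2 ?X b))"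
    by (simp add: B.twist_def B.T_T B.Y_T B.Y_Y shift_def word_simps mult_ac)
  moreover have "tensor.twist (j a b) = sc (gamma ?X (conjg ?X ?h) (conjg ?X ?l) *
      tensor_factor (conjg ?X ?x) (conjg ?X ?h) (conjg ?X ?x') (conjg ?X ?l) (?h \<otimes> ?l))
      (j (T1 (conjg ?q (?h \<otimes> ?l)) (Y1 ?X a)) (T2 (?h \<otimes> ?l) (Y2 ?X b)))"
    by (simp add: tensor.twist_def Y_j T_j sc_j word_simps mult_ac)
  ultimately show ?thesis
    using balancing_scalars[of ?x ?h ?x' ?l]
    by (simp add: monodromy_def sc_j j_sc mult_ac)
qed

text \<open>
  By \<open>balancing\<close> the double braiding is the twist of the tensor product, corrected by the twists of
  the factors. All of these have order dividing \<open>e * e\<close>, and the twists of the factors commute with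
  the double braiding.
\<close>

theorem monodromy_order:
  assumes e: "\<And>x. x \<in> carrier G \<Longrightarrow> x [^] (e::nat) = \<one>" and p: "p \<in> V1 \<times> V2"
  shows "case_prod j ((monodromy ^^ (e * e)) p) = case_prod j p"
proof -
  let ?n = "e * e"
  define Q where "Q = map_prod A.twist B.twist"
  have Q: "Q p \<in> V1 \<times> V2" if "p \<in> V1 \<times> V2" for p
    using that by (auto simp: Q_def)
  have QM: "Q (monodromy p) = monodromy (Q p)" if "p \<in> V1 \<times> V2" for p
    using that by (auto simp: Q_def monodromy_def A.twist_Y A.twist_T B.twist_Y B.twist_T)
  have Mi: "(monodromy ^^ i) p \<in> V1 \<times> V2" if "p \<in> V1 \<times> V2" for p i
    by (induction i) (use monodromy_closed that in auto)
  have Qi: "(Q ^^ i) p \<in> V1 \<times> V2" for i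
    by (induction i) (use Q p in auto)
  have QMi: "Q ((monodromy ^^ i) p) = (monodromy ^^ i) (Q p)" if "p \<in> V1 \<times> V2" for p i
    by (induction i) (use QM Mi that in auto)
  have j_twist: "case_prod j (monodromy (Q p)) = tensor.twist (case_prod j p)" if "p \<in> V1 \<times> V2" for p
    using that balancing by (auto simp: Q_def)
  have "case_prod j ((monodromy ^^ i) ((Q ^^ i) p)) = (tensor.twist ^^ i) (case_prod j p)" for i
  proof (induction i)
    case (Suc i)
    have "(monodromy ^^ Suc i) ((Q ^^ Suc i) p) = monodromy (Q ((monodromy ^^ i) ((Q ^^ i) p)))"
      using QMi[OF Qi] by simp
    with j_twist[OF Mi[OF Qi]] Suc show ?case by simp
  qed simp
  moreover have "(Q ^^ i) p = ((A.twist ^^ i) (fst p), (B.twist ^^ i) (snd p))" for i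
    by (induction i) (simp_all add: Q_def)
  then have "(Q ^^ ?n) p = p"
    using p A.twist_order[OF e] B.twist_order[OF e] by auto
  moreover have "(tensor.twist ^^ ?n) (case_prod j p) = case_prod j p"
    using p by (intro tensor.twist_order e) auto
  ultimately show ?thesis by metis
qed

end

section \<open>Kronecker products and separating families of vectors\<close>

(* Columns are n by 1 matrices; the simplifier must not rewrite this 1 to a successor. *)
declare One_nat_def [simp del]

lemma kron_carrier [simp]:
  "A \<in> carrier_mat a b \<Longrightarrow> B \<in> carrier_mat c d \<Longrightarrow> kron A B \<in> carrier_mat (a * c) (b * d)"
  by (auto simp: kron_def)

lemma div_mod_less:
  assumes "i < a * (c :: nat)"
  shows "i div c < a" "i mod c < c"
proof -
  have "c > 0" using assms by (cases c) auto
  then show "i mod c < c" by simp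
  show "i div c < a" using assms by (simp add: less_mult_imp_div_less)
qed

lemma kron_index:
  assumes "A \<in> carrier_mat a b" "B \<in> carrier_mat c d" "i < a * c" "j < b * d"
  shows "kron A B $$ (i, j) = A $$ (i div c, j div d) * B $$ (i mod c, j mod d)"
  using assms by (auto simp: kron_def)

lemma sum_div_mod:
  "(\<Sum>k<b * d. f (k div d) (k mod d)) = (\<Sum>p<b. \<Sum>q<d. f p q)" for d :: nat
proof -
  have "(\<Sum>k<b * d. f (k div d) (k mod d)) =
      (\<Sum>p<b. \<Sum>k\<in>{p * d..<p * d + d}. f (k div d) (k mod d))"
    by (simp add: sum.nat_group)
  also have "\<dots> = (\<Sum>p<b. \<Sum>q<d. f p q)"
  proof (rule sum.cong[OF refl])
    fix p
    have "(\<Sum>k\<in>{p * d..<p * d + d}. f (k div d) (k mod d)) =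
        (\<Sum>q\<in>{0..<d}. f ((q + p * d) div d) ((q + p * d) mod d))"
      using sum.shift_bounds_nat_ivl[of "\<lambda>k. f (k div d) (k mod d)" 0 "p * d" d]
      by (simp add: add.commute)
    also have "\<dots> = (\<Sum>q\<in>{0..<d}. f p q)"
      by (rule sum.cong) auto
    finally show "(\<Sum>k\<in>{p * d..<p * d + d}. f (k div d) (k mod d)) = (\<Sum>q<d. f p q)"
      by (simp add: lessThan_atLeast0)
  qed
  finally show ?thesis .
qed

text \<open>
  The mixed product rule. Together with the neutrality of the \<open>1 \<times> 1\<close> identity matrix it
  replaces all index computations with tensor products of maps and vectors below.
\<close>

lemma kron_mult:
  fixes A :: "'k :: comm_ring_1 mat"
  assumes A: "A \<in> carrier_mat a b" and B: "B \<in> carrier_mat c d"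
    and C: "C \<in> carrier_mat b p" and D: "D \<in> carrier_mat d q"
  shows "kron A B * kron C D = kron (A * C) (B * D)"
proof (rule eq_matI)
  note kc = kron_carrier[OF A B] kron_carrier[OF C D]
    kron_carrier[OF mult_carrier_mat[OF A C] mult_carrier_mat[OF B D]]
  fix i j assume "i < dim_row (kron (A * C) (B * D))" "j < dim_col (kron (A * C) (B * D))"
  then have i: "i < a * c" and j: "j < p * q" using kc(3) by auto
  note dm = div_mod_less[OF i] div_mod_less[OF j]
  have "(kron A B * kron C D) $$ (i, j) = (\<Sum>k<b * d. kron A B $$ (i, k) * kron C D $$ (k, j))"
    using kc i j by (auto simp: times_mat_def scalar_prod_def lessThan_atLeast0)
  also have "\<dots> = (\<Sum>k<b * d. (A $$ (i div c, k div d) * C $$ (k div d, j div q)) *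
      (B $$ (i mod c, k mod d) * D $$ (k mod d, j mod q)))"
    by (rule sum.cong) (simp_all add: kron_index[OF A B i] kron_index[OF C D _ j])
  also have "\<dots> = (\<Sum>r<b. \<Sum>s<d. (A $$ (i div c, r) * C $$ (r, j div q)) *
      (B $$ (i mod c, s) * D $$ (s, j mod q)))"
    by (rule sum_div_mod)
  also have "\<dots> = (A * C) $$ (i div c, j div q) * (B * D) $$ (i mod c, j mod q)"
    using A B C D dm by (auto simp: times_mat_def scalar_prod_def lessThan_atLeast0 sum_product)
  finally show "(kron A B * kron C D) $$ (i, j) = kron (A * C) (B * D) $$ (i, j)"
    by (simp add: kron_index[OF mult_carrier_mat[OF A C] mult_carrier_mat[OF B D] i j])
qed (use assms in \<open>auto simp: kron_def\<close>)

lemma kron_assoc: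
  fixes A :: "'k :: comm_ring_1 mat"
  assumes A: "A \<in> carrier_mat a a'" and B: "B \<in> carrier_mat b b'" and C: "C \<in> carrier_mat c c'"
  shows "kron (kron A B) C = kron A (kron B C)"
proof (rule eq_matI)
  note AB = kron_carrier[OF A B] and BC = kron_carrier[OF B C]
  note kc = kron_carrier[OF AB C] kron_carrier[OF A BC]
  fix i j assume "i < dim_row (kron A (kron B C))" "j < dim_col (kron A (kron B C))"
  then have i: "i < a * (b * c)" and j: "j < a' * (b' * c')" using kc by auto
  then have i': "i < (a * b) * c" and j': "j < (a' * b') * c'" by (simp_all add: mult.assoc)
  have dm: "n div r mod s = n mod (s * r) div r" "n mod (s * r) mod r = n mod r"
     "n div (s * r) = n div r div s" for n r s :: nat
    by (cases "r = 0"; simp add: mult.commute[of s r] mod_mult2_eq div_mult2_eq)+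
  show "kron (kron A B) C $$ (i, j) = kron A (kron B C) $$ (i, j)"
    using div_mod_less[OF i] div_mod_less[OF j] div_mod_less[OF i'] div_mod_less[OF j']
    by (simp add: kron_index[OF AB C i' j'] kron_index[OF A BC i j] kron_index[OF A B]
        kron_index[OF B C] dm mult.assoc)
qed (use assms in \<open>auto simp: kron_def mult.assoc\<close>)

lemma kron_one:
  "kron (1\<^sub>m a) (1\<^sub>m b) = (1\<^sub>m (a * b) :: 'k :: comm_ring_1 mat)"
proof (rule eq_matI)
  fix i j assume ij: "i < dim_row (1\<^sub>m (a * b) :: 'k mat)" "j < dim_col (1\<^sub>m (a * b) :: 'k mat)"
  then have ij: "i < a * b" "j < a * b" by auto
  have "i = j \<longleftrightarrow> i div b = j div b \<and> i mod b = j mod b"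
    by (metis div_mult_mod_eq)
  then show "kron (1\<^sub>m a) (1\<^sub>m b) $$ (i, j) = (1\<^sub>m (a * b) :: 'k mat) $$ (i, j)"
    using ij div_mod_less[OF ij(1)] div_mod_less[OF ij(2)]
    by (auto simp: kron_index[OF one_carrier_mat one_carrier_mat ij])
qed (auto simp: kron_def)

lemma kron_one1:
  fixes A :: "'k :: comm_ring_1 mat"
  assumes A: "A \<in> carrier_mat a b"
  shows "kron A (1\<^sub>m 1) = A" "kron (1\<^sub>m 1) A = A"
  using A by (auto intro!: eq_matI simp: kron_def)

lemma kron_smult:
  fixes A :: "'k :: comm_ring_1 mat"
  shows "kron (s \<cdot>\<^sub>m A) B = s \<cdot>\<^sub>m kron A B" "kron A (s \<cdot>\<^sub>m B) = s \<cdot>\<^sub>m kron A B"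
  by (auto intro!: eq_matI simp: kron_def div_mod_less mult_ac)

lemma kron_zero:
  fixes A :: "'k :: comm_ring_1 mat"
  assumes "A \<in> carrier_mat a b"
  shows "kron A (0\<^sub>m c d) = 0\<^sub>m (a * c) (b * d)" "kron (0\<^sub>m c d) A = 0\<^sub>m (c * a) (d * b)"
  using assms by (auto intro!: eq_matI simp: kron_def div_mod_less)

text \<open>
  The matrices of all sizes form one type, which has no additive monoid structure; finite sums of
  matrices of a fixed size are therefore formed entrywise.
\<close>

definition matsum :: "nat \<Rightarrow> nat \<Rightarrow> 'a set \<Rightarrow> ('a \<Rightarrow> 'k::semiring_1 mat) \<Rightarrow> 'k mat" where
  "matsum r c A F = mat r c (\<lambda>(i, j). \<Sum>a\<in>A. F a $$ (i, j))"

lemma matsum_carrier [simp]: "matsum r c A F \<in> carrier_mat r c"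
  by (simp add: matsum_def)

lemma matsum_cong: "(\<And>a. a \<in> A \<Longrightarrow> F a = F' a) \<Longrightarrow> matsum r c A F = matsum r c A F'"
  by (simp add: matsum_def)

lemma mult_matsum:
  fixes B :: "'k :: comm_ring_1 mat"
  assumes "\<And>a. a \<in> A \<Longrightarrow> F a \<in> carrier_mat r c" "B \<in> carrier_mat p r"
  shows "B * matsum r c A F = matsum p c A (\<lambda>a. B * F a)"
proof (rule eq_matI)
  fix i j assume "i < dim_row (matsum p c A (\<lambda>a. B * F a))" "j < dim_col (matsum p c A (\<lambda>a. B * F a))"
  then have ij: "i < p" "j < c" by (auto simp: matsum_def)
  have "(B * matsum r c A F) $$ (i, j) = (\<Sum>k<r. \<Sum>a\<in>A. B $$ (i, k) * F a $$ (k, j))"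
    using ij assms by (auto simp: matsum_def times_mat_def scalar_prod_def lessThan_atLeast0 sum_distrib_left)
  also have "\<dots> = (\<Sum>a\<in>A. \<Sum>k<r. B $$ (i, k) * F a $$ (k, j))" by (rule sum.swap)
  also have "\<dots> = (\<Sum>a\<in>A. (B * F a) $$ (i, j))"
  proof (rule sum.cong[OF refl])
    fix a assume "a \<in> A"
    from assms(1)[OF this] assms(2) ij
    show "(\<Sum>k<r. B $$ (i, k) * F a $$ (k, j)) = (B * F a) $$ (i, j)"
      by (auto simp: times_mat_def scalar_prod_def lessThan_atLeast0)
  qed
  finally show "(B * matsum r c A F) $$ (i, j) = matsum p c A (\<lambda>a. B * F a) $$ (i, j)"
    using ij by (simp add: matsum_def)
qed (use assms in \<open>auto simp: matsum_def\<close>)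

lemma matsum_mult:
  fixes B :: "'k :: comm_ring_1 mat"
  assumes "\<And>a. a \<in> A \<Longrightarrow> F a \<in> carrier_mat r c" "B \<in> carrier_mat c p"
  shows "matsum r c A F * B = matsum r p A (\<lambda>a. F a * B)"
proof (rule eq_matI)
  fix i j assume "i < dim_row (matsum r p A (\<lambda>a. F a * B))" "j < dim_col (matsum r p A (\<lambda>a. F a * B))"
  then have ij: "i < r" "j < p" by (auto simp: matsum_def)
  have "(matsum r c A F * B) $$ (i, j) = (\<Sum>k<c. \<Sum>a\<in>A. F a $$ (i, k) * B $$ (k, j))"
    using ij assms by (auto simp: matsum_def times_mat_def scalar_prod_def lessThan_atLeast0 sum_distrib_right)
  also have "\<dots> = (\<Sum>a\<in>A. \<Sum>k<c. F a $$ (i, k) * B $$ (k, j))" by (rule sum.swap)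
  also have "\<dots> = (\<Sum>a\<in>A. (F a * B) $$ (i, j))"
  proof (rule sum.cong[OF refl])
    fix a assume "a \<in> A"
    from assms(1)[OF this] assms(2) ij
    show "(\<Sum>k<c. F a $$ (i, k) * B $$ (k, j)) = (F a * B) $$ (i, j)"
      by (auto simp: times_mat_def scalar_prod_def lessThan_atLeast0)
  qed
  finally show "(matsum r c A F * B) $$ (i, j) = matsum r p A (\<lambda>a. F a * B) $$ (i, j)"
    using ij by (simp add: matsum_def)
qed (use assms in \<open>auto simp: matsum_def\<close>)

lemma kron_matsum:
  fixes B :: "'k :: comm_ring_1 mat"
  assumes "\<And>a. a \<in> A \<Longrightarrow> F a \<in> carrier_mat r c" "B \<in> carrier_mat p q"
  shows "kron (matsum r c A F) B = matsum (r * p) (c * q) A (\<lambda>a. kron (F a) B)"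
proof (rule eq_matI)
  fix i j assume "i < dim_row (matsum (r * p) (c * q) A (\<lambda>a. kron (F a) B))"
    "j < dim_col (matsum (r * p) (c * q) A (\<lambda>a. kron (F a) B))"
  then have ij: "i < r * p" "j < c * q" by (auto simp: matsum_def)
  have "kron (matsum r c A F) B $$ (i, j) = (\<Sum>a\<in>A. F a $$ (i div p, j div q) * B $$ (i mod p, j mod q))"
    unfolding kron_index[OF matsum_carrier assms(2) ij]
    using div_mod_less[OF ij(1)] div_mod_less[OF ij(2)] by (simp add: matsum_def sum_distrib_right)
  also have "\<dots> = (\<Sum>a\<in>A. kron (F a) B $$ (i, j))"
    by (rule sum.cong[OF refl]) (simp add: kron_index[OF assms(1) assms(2) ij])
  finally show "kron (matsum r c A F) B $$ (i, j) =
      matsum (r * p) (c * q) A (\<lambda>a. kron (F a) B) $$ (i, j)"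
    using ij by (simp add: matsum_def)
qed (use assms in \<open>auto simp: matsum_def kron_def\<close>)

lemma matsum_single:
  assumes "finite A" "a0 \<in> A" "F a0 \<in> carrier_mat r c"
    and "\<And>a. \<lbrakk>a \<in> A; a \<noteq> a0\<rbrakk> \<Longrightarrow> F a = 0\<^sub>m r c"
  shows "matsum r c A F = F a0"
proof (rule eq_matI)
  fix i j assume "i < dim_row (F a0)" "j < dim_col (F a0)"
  with assms(3) have ij: "i < r" "j < c" by auto
  have "(\<Sum>a\<in>A. F a $$ (i, j)) = (\<Sum>a\<in>{a0}. F a $$ (i, j))"
    by (rule sum.mono_neutral_right) (use assms ij in auto)
  then show "matsum r c A F $$ (i, j) = F a0 $$ (i, j)"
    using ij by (simp add: matsum_def)
qed (use assms in \<open>auto simp: matsum_def\<close>)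

lemma matsum_zero:
  assumes "\<And>a. a \<in> A \<Longrightarrow> F a = 0\<^sub>m r c"
  shows "matsum r c A F = 0\<^sub>m r c"
  using assms by (auto intro!: eq_matI simp: matsum_def)

lemma mat_lincomb_matsum:
  assumes "\<And>a. a \<in> A \<Longrightarrow> F a \<in> carrier_mat n n"
  shows "mat_lincomb n A x F = matsum n n A (\<lambda>a. x a \<cdot>\<^sub>m F a)"
  unfolding mat_lincomb_def matsum_def
proof (intro cong_mat refl, clarify)
  fix i j assume ij: "i < n" "j < n"
  show "(\<Sum>a\<in>A. x a * F a $$ (i, j)) = (\<Sum>a\<in>A. (x a \<cdot>\<^sub>m F a) $$ (i, j))"
    by (rule sum.cong[OF refl]) (use assms ij in \<open>auto dest!: assms\<close>)
qed

lemma smult_one [simp]: "(1 :: 'k :: comm_ring_1) \<cdot>\<^sub>m A = A"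
  by (auto intro!: eq_matI)

lemma smult_smult [simp]: "(a :: 'k :: comm_ring_1) \<cdot>\<^sub>m (b \<cdot>\<^sub>m A) = (a * b) \<cdot>\<^sub>m A"
  by (auto intro!: eq_matI simp: mult.assoc)

lemma smult_zero_left: "A \<in> carrier_mat r c \<Longrightarrow> (0 :: 'k :: comm_ring_1) \<cdot>\<^sub>m A = 0\<^sub>m r c"
  by (auto intro!: eq_matI)

lemma smult_cancel:
  fixes a :: "'k :: field"
  assumes "a \<cdot>\<^sub>m A = b \<cdot>\<^sub>m B" "a \<noteq> 0"
  shows "A = (b / a) \<cdot>\<^sub>m B"
proof -
  have "(1 / a) \<cdot>\<^sub>m (a \<cdot>\<^sub>m A) = (1 / a) \<cdot>\<^sub>m (b \<cdot>\<^sub>m B)" using assms by simp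
  then show ?thesis using assms(2) by simp
qed

lemma pow_mat_add:
  fixes A :: "'k :: semiring_1 mat"
  assumes A: "A \<in> carrier_mat n n"
  shows "A ^\<^sub>m (i + j) = A ^\<^sub>m i * A ^\<^sub>m j"
proof (induction j)
  case 0 show ?case using pow_carrier_mat[OF A, of i] A by simp
next
  case (Suc j)
  then show ?case
    using assoc_mult_mat[OF pow_carrier_mat[OF A] pow_carrier_mat[OF A] A] by simp
qed

lemma pow_mat_Suc_left:
  fixes A :: "'k :: semiring_1 mat"
  assumes A: "A \<in> carrier_mat n n"
  shows "A ^\<^sub>m Suc i = A * A ^\<^sub>m i"
  using pow_mat_add[OF A, of "Suc 0" i] A by (simp del: pow_mat.simps(2)) simp

text \<open>
  A family of column vectors on which a linear map is determined by its values. Homogeneous vectors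
  of a graded space have this property without being a basis, and it passes to tensor products.
\<close>

definition separating :: "nat \<Rightarrow> 'k :: comm_ring_1 mat set \<Rightarrow> bool" where
  "separating n S \<longleftrightarrow> S \<subseteq> carrier_mat n 1 \<and>
     (\<forall>r. \<forall>F\<in>carrier_mat r n. \<forall>F'\<in>carrier_mat r n. (\<forall>v\<in>S. F * v = F' * v) \<longrightarrow> F = F')"

lemma separatingD:
  assumes "separating n S" "F \<in> carrier_mat r n" "F' \<in> carrier_mat r n"
    "\<And>v. v \<in> S \<Longrightarrow> F * v = F' * v"
  shows "F = F'"
  using assms unfolding separating_def by blast

lemma separating_carrier: "separating n S \<Longrightarrow> v \<in> S \<Longrightarrow> v \<in> carrier_mat n 1"
  by (auto simp: separating_def)

definition ucol :: "nat \<Rightarrow> nat \<Rightarrow> 'k :: comm_ring_1 mat" where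
  "ucol n j = mat n 1 (\<lambda>(i, _). if i = j then 1 else 0)"

definition urow :: "nat \<Rightarrow> nat \<Rightarrow> 'k :: comm_ring_1 mat" where
  "urow n j = mat 1 n (\<lambda>(_, i). if i = j then 1 else 0)"

lemma ucol_carrier [simp]: "ucol n j \<in> carrier_mat n 1"
  and urow_carrier [simp]: "urow n j \<in> carrier_mat 1 n"
  by (simp_all add: ucol_def urow_def)

lemma mult_ucol_index:
  assumes "F \<in> carrier_mat r n" "i < r" "j < n"
  shows "(F * ucol n j) $$ (i, 0) = F $$ (i, j)"
proof -
  have "(F * ucol n j) $$ (i, 0) = (\<Sum>k<n. F $$ (i, k) * (if k = j then 1 else 0))"
    using assms by (auto simp: ucol_def times_mat_def scalar_prod_def lessThan_atLeast0)
  also have "\<dots> = F $$ (i, j)"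
    using assms by (simp add: if_distrib[of "(*) _"] sum.delta cong: if_cong)
  finally show ?thesis .
qed

lemma urow_ucol:
  assumes "i < n" "j < n"
  shows "urow n i * ucol n j = (if i = j then 1\<^sub>m 1 else 0\<^sub>m 1 1)"
  using assms mult_ucol_index[of "urow n i" 1 n 0 j] by (auto intro!: eq_matI simp: urow_def ucol_def)

lemma separating_ucol: "separating n {ucol n j | j. j < n}"
  unfolding separating_def
proof (intro conjI allI ballI impI)
  fix r and F F' :: "'a mat"
  assume F: "F \<in> carrier_mat r n" "F' \<in> carrier_mat r n"
    and eq: "\<forall>v\<in>{ucol n j | j. j < n}. F * v = F' * v"
  show "F = F'"
  proof (rule eq_matI)
    fix i j assume "i < dim_row F'" "j < dim_col F'"
    then have ij: "i < r" "j < n" using F by auto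
    then have "F * ucol n j = F' * ucol n j" using eq by blast
    then show "F $$ (i, j) = F' $$ (i, j)"
      using mult_ucol_index[OF F(1) ij] mult_ucol_index[OF F(2) ij] by simp
  qed (use F in auto)
qed auto

text \<open>
  With one tensor factor fixed, a map on the tensor product becomes a map on the other factor. Two
  such reductions, first to arbitrary right factors and then to arbitrary left factors, leave the
  standard basis.
\<close>

lemma separating_kron:
  assumes S: "separating n S" and S': "separating m S'"
  shows "separating (n * m) {kron z w | z w. z \<in> S \<and> w \<in> S'}"
  unfolding separating_def
proof (intro conjI allI ballI impI)
  note c = separating_carrier[OF S] separating_carrier[OF S']
  show "{kron z w |z w. z \<in> S \<and> w \<in> S'} \<subseteq> carrier_mat (n * m) 1"
  proof clarify
    fix z w assume "z \<in> S" "w \<in> S'"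
    from kron_carrier[OF c(1)[OF this(1)] c(2)[OF this(2)]]
    show "kron z w \<in> carrier_mat (n * m) 1" by simp
  qed
  fix r and F F' :: "'a mat"
  assume F: "F \<in> carrier_mat r (n * m)" "F' \<in> carrier_mat r (n * m)"
    and eq: "\<forall>v\<in>{kron z w |z w. z \<in> S \<and> w \<in> S'}. F * v = F' * v"
  have left: "E * kron z w = (E * kron z (1\<^sub>m m)) * w"
    if "E \<in> carrier_mat r (n * m)" "z \<in> carrier_mat n 1" "w \<in> carrier_mat m 1" for E z w :: "'a mat"
  proof -
    have "kron z w = kron z (1\<^sub>m m) * w"
      using kron_mult[OF that(2) one_carrier_mat one_carrier_mat that(3)] that
      by (simp add: kron_one1)
    then show ?thesis using that
      by (simp add: assoc_mult_mat[OF that(1) kron_carrier[OF that(2) one_carrier_mat]])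
  qed
  have right: "E * kron z w = (E * kron (1\<^sub>m n) w) * z"
    if "E \<in> carrier_mat r (n * m)" "z \<in> carrier_mat n 1" "w \<in> carrier_mat m 1" for E z w :: "'a mat"
  proof -
    have "kron z w = kron (1\<^sub>m n) w * z"
      using kron_mult[OF one_carrier_mat that(3) that(2) one_carrier_mat] that
      by (simp add: kron_one1)
    then show ?thesis using that
      by (simp add: assoc_mult_mat[OF that(1) kron_carrier[OF one_carrier_mat that(3)]])
  qed
  have 1: "F * kron z w = F' * kron z w" if z: "z \<in> S" and w: "w \<in> carrier_mat m 1" for z w
  proof -
    have cz: "kron z (1\<^sub>m m) \<in> carrier_mat (n * m) m"
      using kron_carrier[OF c(1)[OF z] one_carrier_mat[of m]] by simp
    have "F * kron z (1\<^sub>m m) = F' * kron z (1\<^sub>m m)"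
    proof (rule separatingD[OF S'])
      show "F * kron z (1\<^sub>m m) * w' = F' * kron z (1\<^sub>m m) * w'" if "w' \<in> S'" for w'
      proof -
        have "F * kron z w' = F' * kron z w'" using eq z that by blast
        then show ?thesis
          by (simp only: left[OF F(1) c(1)[OF z] c(2)[OF that]] left[OF F(2) c(1)[OF z] c(2)[OF that]])
      qed
    qed (use F cz in auto)
    then show ?thesis using left[OF F(1) c(1)[OF z] w] left[OF F(2) c(1)[OF z] w] by simp
  qed
  have 2: "F * kron z w = F' * kron z w" if z: "z \<in> carrier_mat n 1" and w: "w \<in> carrier_mat m 1" for z w
  proof -
    have cw: "kron (1\<^sub>m n) w \<in> carrier_mat (n * m) n"
      using kron_carrier[OF one_carrier_mat[of n] w] by simp
    have "F * kron (1\<^sub>m n) w = F' * kron (1\<^sub>m n) w"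
    proof (rule separatingD[OF S])
      show "F * kron (1\<^sub>m n) w * z' = F' * kron (1\<^sub>m n) w * z'" if "z' \<in> S" for z'
        using 1[OF that w] right[OF F(1) c(1)[OF that] w] right[OF F(2) c(1)[OF that] w] by simp
    qed (use F cw in auto)
    then show ?thesis using right[OF F(1) z w] right[OF F(2) z w] by simp
  qed
  show "F = F'"
  proof (rule separatingD[OF separating_ucol F])
    fix v :: "'a mat" assume "v \<in> {ucol (n * m) j |j. j < n * m}"
    then obtain k where v: "v = ucol (n * m) k" and k: "k < n * m" by blast
    have "ucol (n * m) k = (kron (ucol n (k div m)) (ucol m (k mod m)) :: 'a mat)"
    proof (rule eq_matI)
      fix i j assume "i < dim_row (kron (ucol n (k div m)) (ucol m (k mod m)) :: 'a mat)"
        "j < dim_col (kron (ucol n (k div m)) (ucol m (k mod m)) :: 'a mat)"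
      then have ij: "i < n * m" "j < 1 * 1" by (auto simp: kron_def ucol_def)
      have "i = k \<longleftrightarrow> i div m = k div m \<and> i mod m = k mod m" by (metis div_mult_mod_eq)
      then show "ucol (n * m) k $$ (i, j) = (kron (ucol n (k div m)) (ucol m (k mod m)) :: 'a mat) $$ (i, j)"
        unfolding kron_index[OF ucol_carrier ucol_carrier ij]
        using ij div_mod_less[OF ij(1)] by (auto simp: ucol_def)
    qed (auto simp: kron_def ucol_def)
    then show "F * v = F' * v" using 2[OF ucol_carrier ucol_carrier] v by simp
  qed
qed

section \<open>Modules of the twisted quantum double\<close>

locale finite_cocycle = three_cocycle G \<omega>
  for G :: "('g, 'm) monoid_scheme" (structure) and \<omega> :: "'g \<Rightarrow> 'g \<Rightarrow> 'g \<Rightarrow> 'k :: field" +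
  assumes finite_carrier [simp]: "finite (carrier G)"
begin

abbreviation DG where "DG \<equiv> twisted_quantum_double G \<omega>"

lemma DG_simps [simp]:
  "qbasis DG = carrier G \<times> carrier G"
  "qmult DG (g, x) (h, y) (f, z) =
     (if g = conjg x h \<and> f = g \<and> z = x \<otimes> y then theta g x y else 0)"
  "qunit DG (g, x) = (if x = \<one> then 1 else 0)"
  "comult DG (g, x) ((s, y), (t, z)) = (if s \<otimes> t = g \<and> y = x \<and> z = x then gamma x s t else 0)"
  "associator DG ((a, x), (b, y), (c, z)) =
     (if x = \<one> \<and> y = \<one> \<and> z = \<one> then inverse (\<omega> a b c) else 0)"
  by (simp_all add: twisted_quantum_double_def)

lemma theta_one [simp]:
  assumes "g \<in> carrier G" "x \<in> carrier G"
  shows "theta g \<one> x = 1" "theta g x \<one> = 1" "theta \<one> g x = 1"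
  using assms by (simp_all add: tqd_theta_def conj_by_def word_simps)

lemma gamma_one [simp]:
  assumes "g \<in> carrier G" "x \<in> carrier G"
  shows "gamma \<one> g x = 1" "gamma x g \<one> = 1" "gamma x \<one> g = 1"
  using assms by (simp_all add: tqd_gamma_def conj_by_def word_simps)

lemma lincomb_mult:
  assumes F: "\<And>h. h \<in> carrier G \<times> carrier G \<Longrightarrow> F h \<in> carrier_mat n n"
    and a: "g \<in> carrier G" "x \<in> carrier G" "h \<in> carrier G" "y \<in> carrier G"
  shows "mat_lincomb n (qbasis DG) (qmult DG (g, x) (h, y)) F =
    (if g = conjg x h then theta g x y \<cdot>\<^sub>m F (g, x \<otimes> y) else 0\<^sub>m n n)"
proof -
  have "mat_lincomb n (qbasis DG) (qmult DG (g, x) (h, y)) F =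
      matsum n n (carrier G \<times> carrier G) (\<lambda>p. qmult DG (g, x) (h, y) p \<cdot>\<^sub>m F p)"
    using F by (simp add: mat_lincomb_matsum)
  also have "\<dots> = (if g = conjg x h then theta g x y \<cdot>\<^sub>m F (g, x \<otimes> y) else 0\<^sub>m n n)"
  proof (cases "g = conjg x h")
    case True
    have "matsum n n (carrier G \<times> carrier G) (\<lambda>p. qmult DG (g, x) (h, y) p \<cdot>\<^sub>m F p) =
        qmult DG (g, x) (h, y) (g, x \<otimes> y) \<cdot>\<^sub>m F (g, x \<otimes> y)"
    proof (rule matsum_single)
      fix p assume p: "p \<in> carrier G \<times> carrier G" "p \<noteq> (g, x \<otimes> y)"
      then have "qmult DG (g, x) (h, y) p = 0" by (cases p) auto
      then show "qmult DG (g, x) (h, y) p \<cdot>\<^sub>m F p = 0\<^sub>m n n" using smult_zero_left[OF F[OF p(1)]] by simp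
    qed (use a F in auto)
    then show ?thesis using True by simp
  next
    case False
    have "matsum n n (carrier G \<times> carrier G) (\<lambda>p. qmult DG (g, x) (h, y) p \<cdot>\<^sub>m F p) = 0\<^sub>m n n"
    proof (rule matsum_zero)
      fix p assume p: "p \<in> carrier G \<times> carrier G"
      have "qmult DG (g, x) (h, y) p = 0" using False by (cases p) auto
      then show "qmult DG (g, x) (h, y) p \<cdot>\<^sub>m F p = 0\<^sub>m n n" using smult_zero_left[OF F[OF p]] by simp
    qed
    then show ?thesis using False by simp
  qed
  finally show ?thesis .
qed

lemma lincomb_unit:
  assumes F: "\<And>h. h \<in> carrier G \<times> carrier G \<Longrightarrow> F h \<in> carrier_mat n n"
  shows "mat_lincomb n (qbasis DG) (qunit DG) F = matsum n n (carrier G) (\<lambda>g. F (g, \<one>))"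
proof -
  have "(\<Sum>p\<in>carrier G \<times> carrier G. qunit DG p * F p $$ (i, j)) =
      (\<Sum>g\<in>carrier G. F (g, \<one>) $$ (i, j))" for i j
  proof -
    have "(\<Sum>p\<in>carrier G \<times> carrier G. qunit DG p * F p $$ (i, j)) =
        (\<Sum>(g, x)\<in>carrier G \<times> carrier G. if x = \<one> then F (g, x) $$ (i, j) else 0)"
      by (rule sum.cong) auto
    also have "\<dots> = (\<Sum>g\<in>carrier G. \<Sum>x\<in>carrier G. if x = \<one> then F (g, x) $$ (i, j) else 0)"
      by (simp only: sum.cartesian_product)
    finally show ?thesis by simp
  qed
  then show ?thesis by (simp add: mat_lincomb_def matsum_def)
qed

lemma is_repI:
  assumes c: "\<And>g x. \<lbrakk>g \<in> carrier G; x \<in> carrier G\<rbrakk> \<Longrightarrow> raction X (g, x) \<in> carrier_mat (rdim X) (rdim X)"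
    and m: "\<And>g x h y. \<lbrakk>g \<in> carrier G; x \<in> carrier G; h \<in> carrier G; y \<in> carrier G\<rbrakk> \<Longrightarrow>
      raction X (g, x) * raction X (h, y) =
      (if g = conjg x h then theta g x y \<cdot>\<^sub>m raction X (g, x \<otimes> y) else 0\<^sub>m (rdim X) (rdim X))"
    and u: "matsum (rdim X) (rdim X) (carrier G) (\<lambda>g. raction X (g, \<one>)) = 1\<^sub>m (rdim X)"
  shows "is_rep DG X"
  using assms lincomb_mult[of "raction X" "rdim X"] lincomb_unit[of "raction X" "rdim X"]
  unfolding is_rep_def by (auto simp del: DG_simps(2))

context
  fixes X assumes X: "is_rep DG X"
begin

lemma rep_carrier [simp]:
  "\<lbrakk>g \<in> carrier G; x \<in> carrier G\<rbrakk> \<Longrightarrow> raction X (g, x) \<in> carrier_mat (rdim X) (rdim X)"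
  using X by (auto simp: is_rep_def)

lemma rep_mult:
  assumes "g \<in> carrier G" "x \<in> carrier G" "h \<in> carrier G" "y \<in> carrier G"
  shows "raction X (g, x) * raction X (h, y) =
    (if g = conjg x h then theta g x y \<cdot>\<^sub>m raction X (g, x \<otimes> y) else 0\<^sub>m (rdim X) (rdim X))"
proof -
  have "raction X (g, x) * raction X (h, y) =
      mat_lincomb (rdim X) (qbasis DG) (qmult DG (g, x) (h, y)) (raction X)"
    using X assms by (auto simp: is_rep_def simp del: DG_simps(2))
  then show ?thesis
    using lincomb_mult[of "raction X" "rdim X" g x h y] assms rep_carrier by auto
qed

lemma rep_unit: "matsum (rdim X) (rdim X) (carrier G) (\<lambda>g. raction X (g, \<one>)) = 1\<^sub>m (rdim X)"
  using X lincomb_unit[of "raction X" "rdim X"] rep_carrier by (auto simp: is_rep_def)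

end

text \<open>
  A module of the double is graded by \<open>G\<close>, with the idempotents \<open>e\<^sub>g # 1\<close> as projections.
\<close>

definition homog :: "('g \<times> 'g, 'k) hrep \<Rightarrow> 'g \<Rightarrow> 'k mat \<Rightarrow> bool" where
  "homog X g v \<longleftrightarrow> v \<in> carrier_mat (rdim X) 1 \<and> raction X (g, \<one>) * v = v"

text \<open>
  On vectors of degree \<open>g\<close> the sum \<open>\<Sum>h. e\<^sub>h # y\<close> has a single nonzero term; it is the only one
  kept here.
\<close>

definition act :: "('g \<times> 'g, 'k) hrep \<Rightarrow> 'g \<Rightarrow> 'g \<Rightarrow> 'k mat" where
  "act X y g = raction X (conjg y g, y)"

lemma homog_carrier: "homog X g v \<Longrightarrow> v \<in> carrier_mat (rdim X) 1"
  by (simp add: homog_def)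

lemma homog_smult: 
  "\<lbrakk>is_rep DG X; g \<in> carrier G; homog X g v\<rbrakk> \<Longrightarrow> homog X g (s \<cdot>\<^sub>m v)"
  using mult_smult_distrib[OF rep_carrier, of X g \<one> v 1] by (auto simp: homog_def)

lemma act_carrier [simp]:
  "\<lbrakk>is_rep DG X; y \<in> carrier G; g \<in> carrier G\<rbrakk> \<Longrightarrow> act X y g \<in> carrier_mat (rdim X) (rdim X)"
  by (simp add: act_def)

lemma rep_homog:
  assumes X: "is_rep DG X" and a: "h \<in> carrier G" "y \<in> carrier G" "g \<in> carrier G" and v: "homog X g v"
  shows "raction X (h, y) * v = (if h = conjg y g then act X y g * v else 0\<^sub>m (rdim X) 1)"
proof (cases "h = conjg y g")
  case False
  have c: "raction X (h, y) \<in> carrier_mat (rdim X) (rdim X)"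
    "raction X (g, \<one>) \<in> carrier_mat (rdim X) (rdim X)"
    using X a by simp_all
  have "raction X (h, y) * v = raction X (h, y) * (raction X (g, \<one>) * v)"
    using v by (simp add: homog_def)
  also have "\<dots> = (raction X (h, y) * raction X (g, \<one>)) * v"
    by (rule assoc_mult_mat[symmetric, OF c homog_carrier[OF v]])
  also have "\<dots> = 0\<^sub>m (rdim X) 1"
    using rep_mult[OF X a(1,2,3) one_closed] False homog_carrier[OF v] by simp
  finally show ?thesis using False by simp
qed (simp add: act_def)

lemma act_one: "\<lbrakk>g \<in> carrier G; homog X g v\<rbrakk> \<Longrightarrow> act X \<one> g * v = v"
  by (simp add: act_def homog_def)

lemma act_homog:
  assumes X: "is_rep DG X" and a: "y \<in> carrier G" "g \<in> carrier G" and v: "homog X g v"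
  shows "homog X (conjg y g) (act X y g * v)"
proof -
  have c: "raction X (conjg y g, \<one>) \<in> carrier_mat (rdim X) (rdim X)"
    "act X y g \<in> carrier_mat (rdim X) (rdim X)"
    using X a by simp_all
  have "raction X (conjg y g, \<one>) * act X y g = act X y g"
    using rep_mult[OF X _ one_closed, of "conjg y g" "conjg y g" y] a by (simp add: act_def)
  then show ?thesis
    using assoc_mult_mat[OF c homog_carrier[OF v]] mult_carrier_mat[OF c(2) homog_carrier[OF v]]
    by (simp add: homog_def)
qed

lemma act_act:
  assumes X: "is_rep DG X" and a: "y \<in> carrier G" "z \<in> carrier G" "g \<in> carrier G"
    and v: "v \<in> carrier_mat (rdim X) 1"
  shows "act X y (conjg z g) * (act X z g * v) =
    theta (conjg (y \<otimes> z) g) y z \<cdot>\<^sub>m (act X (y \<otimes> z) g * v)"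
proof -
  have e: "conjg y (conjg z g) = conjg (y \<otimes> z) g" using a by (simp add: word_simps)
  have c: "act X y (conjg z g) \<in> carrier_mat (rdim X) (rdim X)" "act X z g \<in> carrier_mat (rdim X) (rdim X)"
    "act X (y \<otimes> z) g \<in> carrier_mat (rdim X) (rdim X)"
    using X a by simp_all
  have "act X y (conjg z g) * act X z g = theta (conjg (y \<otimes> z) g) y z \<cdot>\<^sub>m act X (y \<otimes> z) g"
    using rep_mult[OF X _ a(1) _ a(2), of "conjg y (conjg z g)" "conjg z g"] a unfolding act_def e by simp
  then show ?thesis
    using assoc_mult_mat[OF c(1,2) v] mult_smult_assoc_mat[OF c(3) v] by simp
qed

lemma separating_homog:
  assumes X: "is_rep DG X"
  shows "separating (rdim X) {v. \<exists>g\<in>carrier G. homog X g v}"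
  unfolding separating_def
proof (intro conjI allI ballI impI)
  let ?n = "rdim X"
  fix r and F F' :: "'k mat"
  assume F: "F \<in> carrier_mat r ?n" "F' \<in> carrier_mat r ?n"
    and eq: "\<forall>v\<in>{v. \<exists>g\<in>carrier G. homog X g v}. F * v = F' * v"
  have P: "raction X (g, \<one>) \<in> carrier_mat ?n ?n" if "g \<in> carrier G" for g using X that by simp
  have "F * raction X (g, \<one>) = F' * raction X (g, \<one>)" if g: "g \<in> carrier G" for g
  proof (rule separatingD[OF separating_ucol])
    fix v :: "'k mat" assume "v \<in> {ucol ?n j |j. j < ?n}"
    then have v: "v \<in> carrier_mat ?n 1" by auto
    have "homog X g (raction X (g, \<one>) * v)"
      using rep_mult[OF X g one_closed g one_closed] g assoc_mult_mat[OF P[OF g] P[OF g] v]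
        mult_carrier_mat[OF P[OF g] v] by (simp add: homog_def)
    then have "F * (raction X (g, \<one>) * v) = F' * (raction X (g, \<one>) * v)" using eq g by blast
    then show "F * raction X (g, \<one>) * v = F' * raction X (g, \<one>) * v"
      by (simp only: assoc_mult_mat[OF F(1) P[OF g] v] assoc_mult_mat[OF F(2) P[OF g] v])
  qed (use F P[OF g] in auto)
  then have "matsum r ?n (carrier G) (\<lambda>g. F * raction X (g, \<one>)) =
      matsum r ?n (carrier G) (\<lambda>g. F' * raction X (g, \<one>))"
    by (intro matsum_cong) auto
  then have "F * matsum ?n ?n (carrier G) (\<lambda>g. raction X (g, \<one>)) =
      F' * matsum ?n ?n (carrier G) (\<lambda>g. raction X (g, \<one>))"
    using P by (simp add: mult_matsum[OF _ F(1)] mult_matsum[OF _ F(2)])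
  then show "F = F'"
    using F by (simp add: rep_unit[OF X])
qed (auto simp: homog_def)

lemma rdim_tensor [simp]: "rdim (rep_tensor DG X Y) = rdim X * rdim Y"
  by (simp add: rep_tensor_def)

lemma raction_tensor_carrier [simp]:
  "raction (rep_tensor DG X Y) a \<in> carrier_mat (rdim X * rdim Y) (rdim X * rdim Y)"
  by (simp add: rep_tensor_def mat_lincomb_def)

text \<open>
  Homogeneity of the first vector selects a single summand of the comultiplication.
\<close>

lemma tensor_action_general:
  assumes X: "is_rep DG X" and Y: "is_rep DG Y" and a: "c \<in> carrier G" "y \<in> carrier G" "s \<in> carrier G"
    and v: "homog X s v" and w: "w \<in> carrier_mat (rdim Y) 1"
  shows "raction (rep_tensor DG X Y) (c, y) * kron v w =
    gamma y (conjg y s) (inv (conjg y s) \<otimes> c) \<cdot>\<^sub>m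
      kron (act X y s * v) (raction Y (inv (conjg y s) \<otimes> c, y) * w)"
proof -
  let ?B = "carrier G \<times> carrier G" and ?n = "rdim X" and ?m = "rdim Y"
  let ?F = "\<lambda>(b, d). comult DG (c, y) (b, d) \<cdot>\<^sub>m kron (raction X b) (raction Y d)"
  have F: "?F p \<in> carrier_mat (?n * ?m) (?n * ?m)" if "p \<in> ?B \<times> ?B" for p
    using that X Y by auto
  have K: "kron (raction X b) (raction Y d) \<in> carrier_mat (?n * ?m) (?n * ?m)" if "b \<in> ?B" "d \<in> ?B" for b d
    using that X Y by auto
  have vw: "kron v w \<in> carrier_mat (?n * ?m) 1"
    using kron_carrier[OF homog_carrier[OF v] w] by simp
  let ?E = "\<lambda>(b, d). comult DG (c, y) (b, d) \<cdot>\<^sub>m kron (raction X b * v) (raction Y d * w)"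
  have "raction (rep_tensor DG X Y) (c, y) = matsum (?n * ?m) (?n * ?m) (?B \<times> ?B) ?F"
  proof -
    let ?K = "\<lambda>(b, d). kron (raction X b) (raction Y d)"
    have "mat_lincomb (?n * ?m) (?B \<times> ?B) (comult DG (c, y)) ?K =
        matsum (?n * ?m) (?n * ?m) (?B \<times> ?B) (\<lambda>p. comult DG (c, y) p \<cdot>\<^sub>m ?K p)"
      by (rule mat_lincomb_matsum) (use K in auto)
    moreover have "(\<lambda>p. comult DG (c, y) p \<cdot>\<^sub>m ?K p) = ?F" by auto
    ultimately show ?thesis by (simp add: rep_tensor_def del: DG_simps(4))
  qed
  also have "\<dots> * kron v w = matsum (?n * ?m) 1 (?B \<times> ?B) (\<lambda>p. ?F p * kron v w)"
    by (rule matsum_mult[OF F vw])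
  also have "\<dots> = matsum (?n * ?m) 1 (?B \<times> ?B) ?E"
  proof (rule matsum_cong, clarify)
    fix s1 y1 t1 z1 assume b: "s1 \<in> carrier G" "y1 \<in> carrier G" "t1 \<in> carrier G" "z1 \<in> carrier G"
    show "comult DG (c, y) ((s1, y1), (t1, z1)) \<cdot>\<^sub>m kron (raction X (s1, y1)) (raction Y (t1, z1)) * kron v w =
       comult DG (c, y) ((s1, y1), (t1, z1)) \<cdot>\<^sub>m kron (raction X (s1, y1) * v) (raction Y (t1, z1) * w)"
      using b X Y mult_smult_assoc_mat[OF K vw, of "(s1, y1)" "(t1, z1)"]
        kron_mult[OF rep_carrier[OF X b(1,2)] rep_carrier[OF Y b(3,4)] homog_carrier[OF v] w]
      by (simp del: DG_simps)
  qed
  also have "\<dots> = ?E ((conjg y s, y), (inv (conjg y s) \<otimes> c, y))"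
  proof (rule matsum_single)
    have "act X y s * v \<in> carrier_mat ?n 1" "raction Y (inv (conjg y s) \<otimes> c, y) * w \<in> carrier_mat ?m 1"
      using X Y a homog_carrier[OF v] w by (auto intro!: mult_carrier_mat)
    from kron_carrier[OF this]
    show "?E ((conjg y s, y), (inv (conjg y s) \<otimes> c, y)) \<in> carrier_mat (?n * ?m) 1"
      by (simp add: act_def)
  next
    fix p assume p: "p \<in> ?B \<times> ?B" and ne: "p \<noteq> ((conjg y s, y), (inv (conjg y s) \<otimes> c, y))"
    obtain s1 y1 t1 z1 where pe: "p = ((s1, y1), (t1, z1))" by (metis prod.exhaust)
    with p have b: "s1 \<in> carrier G" "y1 \<in> carrier G" "t1 \<in> carrier G" "z1 \<in> carrier G" by auto
    have rw: "raction Y (t1, z1) * w \<in> carrier_mat ?m 1" and rv: "raction X (s1, y1) * v \<in> carrier_mat ?n 1"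
      using X Y b homog_carrier[OF v] w by (auto intro!: mult_carrier_mat)
    note kc = kron_carrier[OF rv rw]
    show "?E p = 0\<^sub>m (?n * ?m) 1"
    proof (cases "s1 \<otimes> t1 = c \<and> y1 = y \<and> z1 = y")
      case False
      then show ?thesis using kc pe by (auto simp: smult_zero_left)
    next
      case True
      have "s1 \<noteq> conjg y s"
      proof
        assume s1: "s1 = conjg y s"
        then have "t1 = inv (conjg y s) \<otimes> c" using True b a by (auto simp: inv_solve_left)
        with s1 True ne pe show False by simp
      qed
      then have "raction X (s1, y1) * v = 0\<^sub>m ?n 1"
        using rep_homog[OF X b(1,2) a(3) v] True by simp
      then show ?thesis using pe kron_zero(2)[OF rw] by simp
    qed
  qed (use a in auto)
  also have "\<dots> = gamma y (conjg y s) (inv (conjg y s) \<otimes> c) \<cdot>\<^sub>m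
      kron (act X y s * v) (raction Y (inv (conjg y s) \<otimes> c, y) * w)"
    using a by (simp add: act_def cancel_words)
  finally show ?thesis .
qed

lemma tensor_action:
  assumes X: "is_rep DG X" and Y: "is_rep DG Y" and a: "c \<in> carrier G" "y \<in> carrier G" "s \<in> carrier G" "t \<in> carrier G"
    and v: "homog X s v" and w: "homog Y t w"
  shows "raction (rep_tensor DG X Y) (c, y) * kron v w =
    (if c = conjg y (s \<otimes> t) then gamma y (conjg y s) (conjg y t) \<cdot>\<^sub>m kron (act X y s * v) (act Y y t * w)
     else 0\<^sub>m (rdim X * rdim Y) 1)"
proof -
  have e: "inv (conjg y s) \<otimes> c = conjg y t \<longleftrightarrow> c = conjg y (s \<otimes> t)"
  proof
    assume "inv (conjg y s) \<otimes> c = conjg y t"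
    then have "c = conjg y s \<otimes> conjg y t" using a by (metis cancel_words(1) inv_closed m_closed)
    then show "c = conjg y (s \<otimes> t)" using a by (simp add: word_simps)
  qed (use a in \<open>simp add: word_simps\<close>)
  have av: "act X y s * v \<in> carrier_mat (rdim X) 1"
    using act_homog[OF X a(2,3) v] by (rule homog_carrier)
  show ?thesis
    using tensor_action_general[OF X Y a(1-3) v homog_carrier[OF w]]
      rep_homog[OF Y _ a(2,4) w, of "inv (conjg y s) \<otimes> c"] a e kron_zero(1)[OF av]
    by (auto simp: smult_zero_mat)
qed

lemma tensor_homog:
  assumes X: "is_rep DG X" and Y: "is_rep DG Y" and a: "s \<in> carrier G" "t \<in> carrier G"
    and v: "homog X s v" and w: "homog Y t w"
  shows "homog (rep_tensor DG X Y) (s \<otimes> t) (kron v w)"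
  using tensor_action[OF X Y _ one_closed a v w, of "s \<otimes> t"] a
    kron_carrier[OF homog_carrier[OF v] homog_carrier[OF w]]
  by (simp add: homog_def act_def) (use v w in \<open>simp add: homog_def\<close>)

lemma tensor_rep:
  assumes X: "is_rep DG X" and Y: "is_rep DG Y"
  shows "is_rep DG (rep_tensor DG X Y)"
proof (rule is_repI)
  let ?T = "rep_tensor DG X Y" and ?n = "rdim X * rdim Y"
  note sep = separating_kron[OF separating_homog[OF X] separating_homog[OF Y]]
  show "raction ?T (g, x) \<in> carrier_mat (rdim ?T) (rdim ?T)" for g x by simp
  fix g x h y assume a: "g \<in> carrier G" "x \<in> carrier G" "h \<in> carrier G" "y \<in> carrier G"
  show "raction ?T (g, x) * raction ?T (h, y) =
      (if g = conjg x h then theta g x y \<cdot>\<^sub>m raction ?T (g, x \<otimes> y) else 0\<^sub>m (rdim ?T) (rdim ?T))"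
  proof (rule separatingD[OF sep])
    fix k assume "k \<in> {kron z w |z w. z \<in> {v. \<exists>g\<in>carrier G. homog X g v} \<and> w \<in> {v. \<exists>g\<in>carrier G. homog Y g v}}"
    then obtain v w s t where k: "k = kron v w" and st: "s \<in> carrier G" "t \<in> carrier G"
      and v: "homog X s v" and w: "homog Y t w" by auto
    have kc: "k \<in> carrier_mat ?n 1"
      using kron_carrier[OF homog_carrier[OF v] homog_carrier[OF w]] k by simp
    have R: "raction ?T (g, x) \<in> carrier_mat ?n ?n" "raction ?T (h, y) \<in> carrier_mat ?n ?n"
      "raction ?T (g, x \<otimes> y) \<in> carrier_mat ?n ?n" by simp_all
    let ?v = "act X y s * v" and ?w = "act Y y t * w"
    let ?s = "conjg y s" and ?t = "conjg y t"
    let ?vv = "act X (x \<otimes> y) s * v" and ?ww = "act Y (x \<otimes> y) t * w"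
    have vw: "homog X ?s ?v" "homog Y ?t ?w" using act_homog X Y a st v w by auto
    have cc: "?s \<in> carrier G" "?t \<in> carrier G" using a st by auto
    have vvc: "?vv \<in> carrier_mat (rdim X) 1" "?ww \<in> carrier_mat (rdim Y) 1"
      using act_homog[OF X _ st(1) v, of "x \<otimes> y"] act_homog[OF Y _ st(2) w, of "x \<otimes> y"] a
      by (simp_all add: homog_def)
    have kvw: "kron ?v ?w \<in> carrier_mat ?n 1"
      using kron_carrier[OF vw(1)[THEN homog_carrier] vw(2)[THEN homog_carrier]] by simp
    have "raction ?T (g, x) * raction ?T (h, y) * k = raction ?T (g, x) * (raction ?T (h, y) * k)"
      by (rule assoc_mult_mat[OF R(1,2) kc])
    also have "\<dots> = (if h = conjg y (s \<otimes> t) \<and> g = conjg x (?s \<otimes> ?t) then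
        (gamma y ?s ?t * gamma x (conjg x ?s) (conjg x ?t) * theta (conjg (x \<otimes> y) s) x y *
          theta (conjg (x \<otimes> y) t) x y) \<cdot>\<^sub>m kron ?vv ?ww else 0\<^sub>m ?n 1)"
      unfolding k tensor_action[OF X Y a(3,4) st v w]
      using mult_smult_distrib[OF R(1) kvw] tensor_action[OF X Y a(1,2) cc vw]
        act_act[OF X a(2,4) st(1) homog_carrier[OF v]] act_act[OF Y a(2,4) st(2) homog_carrier[OF w]]
        right_mult_zero_mat[OF R(1)]
      by (auto simp: kron_smult mult_ac)
    also have "\<dots> = (if g = conjg x h \<and> g = conjg (x \<otimes> y) (s \<otimes> t) then
        (theta g x y * gamma (x \<otimes> y) (conjg (x \<otimes> y) s) (conjg (x \<otimes> y) t)) \<cdot>\<^sub>m kron ?vv ?ww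
        else 0\<^sub>m ?n 1)"
    proof -
      have 1: "h = conjg y (s \<otimes> t) \<and> g = conjg x (?s \<otimes> ?t) \<longleftrightarrow>
          g = conjg x h \<and> g = conjg (x \<otimes> y) (s \<otimes> t)"
      proof -
        have "conjg x (?s \<otimes> ?t) = conjg (x \<otimes> y) (s \<otimes> t)" "conjg x (conjg y (s \<otimes> t)) = conjg (x \<otimes> y) (s \<otimes> t)"
          using a st by (simp_all add: word_simps)
        moreover have "conjg x h = conjg x (conjg y (s \<otimes> t)) \<Longrightarrow> h = conjg y (s \<otimes> t)"
          using a st by (simp del: m_assoc add: right_cancel)
        ultimately show ?thesis by metis
      qed
      have "theta (conjg (x \<otimes> y) s) x y * theta (conjg (x \<otimes> y) t) x y *
          gamma x (conjg x ?s) (conjg x ?t) * gamma y ?s ?t =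
          theta (conjg (x \<otimes> y) (s \<otimes> t)) x y * gamma (x \<otimes> y) (conjg (x \<otimes> y) s) (conjg (x \<otimes> y) t)"
        using gamma_theta[of x y "conjg (x \<otimes> y) s" "conjg (x \<otimes> y) t"] a st
        by (simp add: conj_by_def word_simps)
      then show ?thesis unfolding 1 by (auto simp: mult_ac)
    qed
    also have "\<dots> = (if g = conjg x h then theta g x y \<cdot>\<^sub>m raction ?T (g, x \<otimes> y) else 0\<^sub>m (rdim ?T) (rdim ?T)) * k"
      using tensor_action[OF X Y a(1) _ st v w, of "x \<otimes> y"] a mult_smult_assoc_mat[OF R(3) kc] kc
      by (auto simp: k)
    finally show "raction ?T (g, x) * raction ?T (h, y) * k =
      (if g = conjg x h then theta g x y \<cdot>\<^sub>m raction ?T (g, x \<otimes> y) else 0\<^sub>m (rdim ?T) (rdim ?T)) * k" .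
  qed (auto intro!: mult_carrier_mat[OF raction_tensor_carrier raction_tensor_carrier])
next
  let ?T = "rep_tensor DG X Y" and ?n = "rdim X * rdim Y"
  note sep = separating_kron[OF separating_homog[OF X] separating_homog[OF Y]]
  show "matsum (rdim ?T) (rdim ?T) (carrier G) (\<lambda>g. raction ?T (g, \<one>)) = 1\<^sub>m (rdim ?T)"
  proof (rule separatingD[OF sep])
    fix k assume "k \<in> {kron z w |z w. z \<in> {v. \<exists>g\<in>carrier G. homog X g v} \<and> w \<in> {v. \<exists>g\<in>carrier G. homog Y g v}}"
    then obtain v w s t where k: "k = kron v w" and st: "s \<in> carrier G" "t \<in> carrier G"
      and v: "homog X s v" and w: "homog Y t w" by auto
    have kc: "k \<in> carrier_mat ?n 1"
      using kron_carrier[OF homog_carrier[OF v] homog_carrier[OF w]] k by simp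
    have "matsum ?n ?n (carrier G) (\<lambda>g. raction ?T (g, \<one>)) * k =
        matsum ?n 1 (carrier G) (\<lambda>g. raction ?T (g, \<one>) * k)"
      by (rule matsum_mult[OF _ kc]) simp
    also have "\<dots> = raction ?T (s \<otimes> t, \<one>) * k"
    proof (rule matsum_single)
      show "raction ?T (s \<otimes> t, \<one>) * k \<in> carrier_mat ?n 1"
        by (rule mult_carrier_mat[OF raction_tensor_carrier kc])
    qed (use tensor_action[OF X Y _ one_closed st v w] st k in auto)
    also have "\<dots> = k"
      using tensor_homog[OF X Y st v w] k by (simp add: homog_def)
    finally show "matsum (rdim ?T) (rdim ?T) (carrier G) (\<lambda>g. raction ?T (g, \<one>)) * k = 1\<^sub>m (rdim ?T) * k"
      using kc by simp
  qed auto
qed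

lemma rep_assoc_carrier [simp]:
  "rep_assoc DG X Y Z \<in> carrier_mat (rdim X * rdim Y * rdim Z) (rdim X * rdim Y * rdim Z)"
  by (simp add: rep_assoc_def mat_lincomb_def)

lemma rep_assoc_action:
  assumes X: "is_rep DG X" and Y: "is_rep DG Y" and Z: "is_rep DG Z"
    and a: "s \<in> carrier G" "t \<in> carrier G" "r \<in> carrier G"
    and u: "homog X s u" and v: "homog Y t v" and w: "homog Z r w"
  shows "rep_assoc DG X Y Z * kron u (kron v w) = inverse (\<omega> s t r) \<cdot>\<^sub>m kron u (kron v w)"
proof -
  let ?B = "carrier G \<times> carrier G" and ?n = "rdim X * rdim Y * rdim Z"
  let ?K = "\<lambda>(a, b, c). kron (raction X a) (kron (raction Y b) (raction Z c))"
  note uc = homog_carrier[OF u] and vc = homog_carrier[OF v] and wc = homog_carrier[OF w]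
  have K: "?K p \<in> carrier_mat ?n ?n" if pB: "p \<in> ?B \<times> ?B \<times> ?B" for p
  proof -
    obtain a b c where pe: "p = (a, b, c)" "a \<in> ?B" "b \<in> ?B" "c \<in> ?B" using pB by auto
    have "raction X a \<in> carrier_mat (rdim X) (rdim X)" "raction Y b \<in> carrier_mat (rdim Y) (rdim Y)"
      "raction Z c \<in> carrier_mat (rdim Z) (rdim Z)" using pe X Y Z by auto
    from kron_carrier[OF this(1) kron_carrier[OF this(2,3)]] pe show ?thesis by (simp add: mult.assoc)
  qed
  have k: "kron u (kron v w) \<in> carrier_mat ?n 1"
    using kron_carrier[OF uc kron_carrier[OF vc wc]] by (simp add: mult.assoc)
  have Kk: "?K (a, b, c) * kron u (kron v w) = kron (raction X a * u) (kron (raction Y b * v) (raction Z c * w))"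
    if "a \<in> ?B" "b \<in> ?B" "c \<in> ?B" for a b c
  proof -
    have 1: "raction X a \<in> carrier_mat (rdim X) (rdim X)" "raction Y b \<in> carrier_mat (rdim Y) (rdim Y)"
      "raction Z c \<in> carrier_mat (rdim Z) (rdim Z)" using that X Y Z by auto
    show ?thesis
      using kron_mult[OF 1(1) kron_carrier[OF 1(2,3)] uc kron_carrier[OF vc wc]]
        kron_mult[OF 1(2,3) vc wc] by simp
  qed
  have "rep_assoc DG X Y Z * kron u (kron v w) =
      matsum ?n ?n (?B \<times> ?B \<times> ?B) (\<lambda>p. associator DG p \<cdot>\<^sub>m ?K p) * kron u (kron v w)"
  proof -
    have "mat_lincomb ?n (?B \<times> ?B \<times> ?B) (associator DG) ?K =
        matsum ?n ?n (?B \<times> ?B \<times> ?B) (\<lambda>p. associator DG p \<cdot>\<^sub>m ?K p)"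
      by (rule mat_lincomb_matsum) (rule K)
    then show ?thesis by (simp add: rep_assoc_def del: DG_simps(5))
  qed
  also have "\<dots> = matsum ?n 1 (?B \<times> ?B \<times> ?B) (\<lambda>p. (associator DG p \<cdot>\<^sub>m ?K p) * kron u (kron v w))"
    by (rule matsum_mult[OF _ k], rule smult_carrier_mat, rule K)
  also have "\<dots> = (associator DG ((s, \<one>), (t, \<one>), (r, \<one>)) \<cdot>\<^sub>m ?K ((s, \<one>), (t, \<one>), (r, \<one>))) * kron u (kron v w)"
  proof (rule matsum_single)
    show "associator DG ((s, \<one>), (t, \<one>), (r, \<one>)) \<cdot>\<^sub>m ?K ((s, \<one>), (t, \<one>), (r, \<one>)) * kron u (kron v w)
        \<in> carrier_mat ?n 1"
      by (rule mult_carrier_mat[OF smult_carrier_mat[OF K] k]) (use a in auto)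
  next
    fix p assume p: "p \<in> ?B \<times> ?B \<times> ?B" and ne: "p \<noteq> ((s, \<one>), (t, \<one>), (r, \<one>))"
    obtain s1 x t1 y r1 z where pe: "p = ((s1, x), (t1, y), (r1, z))" by (metis prod.exhaust)
    with p have b: "s1 \<in> carrier G" "x \<in> carrier G" "t1 \<in> carrier G" "y \<in> carrier G" "r1 \<in> carrier G" "z \<in> carrier G"
      by auto
    have 1: "(associator DG p \<cdot>\<^sub>m ?K p) * kron u (kron v w) = associator DG p \<cdot>\<^sub>m (?K p * kron u (kron v w))"
      by (rule mult_smult_assoc_mat[OF K[OF p] k])
    have Kc: "?K p * kron u (kron v w) \<in> carrier_mat ?n 1"
      by (rule mult_carrier_mat[OF K[OF p] k])
    show "(associator DG p \<cdot>\<^sub>m ?K p) * kron u (kron v w) = 0\<^sub>m ?n 1"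
    proof (cases "x = \<one> \<and> y = \<one> \<and> z = \<one>")
      case False
      then have "associator DG p = 0" using pe by auto
      then show ?thesis using 1 smult_zero_left[OF Kc] by simp
    next
      case True
      have "?K p * kron u (kron v w) =
          kron (raction X (s1, \<one>) * u) (kron (raction Y (t1, \<one>) * v) (raction Z (r1, \<one>) * w))"
        using Kk[of "(s1, x)" "(t1, y)" "(r1, z)"] b True pe by auto
      moreover have "s1 \<noteq> s \<or> t1 \<noteq> t \<or> r1 \<noteq> r" using ne pe True by auto
      moreover have "s1 \<noteq> s \<Longrightarrow> raction X (s1, \<one>) * u = 0\<^sub>m (rdim X) 1"
        "t1 \<noteq> t \<Longrightarrow> raction Y (t1, \<one>) * v = 0\<^sub>m (rdim Y) 1"
        "r1 \<noteq> r \<Longrightarrow> raction Z (r1, \<one>) * w = 0\<^sub>m (rdim Z) 1"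
        using rep_homog[OF X b(1) one_closed a(1) u] rep_homog[OF Y b(3) one_closed a(2) v]
          rep_homog[OF Z b(5) one_closed a(3) w] a by simp_all
      moreover have "kron A (kron B C) = 0\<^sub>m ?n 1"
        if "A = 0\<^sub>m (rdim X) 1 \<or> B = 0\<^sub>m (rdim Y) 1 \<or> C = 0\<^sub>m (rdim Z) 1"
          and "A \<in> carrier_mat (rdim X) 1" "B \<in> carrier_mat (rdim Y) 1" "C \<in> carrier_mat (rdim Z) 1"
        for A B C :: "'k mat"
        using that(1) kron_zero(2)[OF kron_carrier[OF that(3,4)], of "rdim X" 1]
          kron_zero(2)[OF that(4), of "rdim Y" 1] kron_zero(1)[OF that(3), of "rdim Z" 1]
          kron_zero(1)[OF that(2), of "rdim Y * rdim Z" 1] by (auto simp: mult.assoc)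
      moreover have "raction X (s1, \<one>) * u \<in> carrier_mat (rdim X) 1"
        "raction Y (t1, \<one>) * v \<in> carrier_mat (rdim Y) 1" "raction Z (r1, \<one>) * w \<in> carrier_mat (rdim Z) 1"
        using mult_carrier_mat[OF rep_carrier[OF X b(1) one_closed] uc]
          mult_carrier_mat[OF rep_carrier[OF Y b(3) one_closed] vc]
          mult_carrier_mat[OF rep_carrier[OF Z b(5) one_closed] wc] by simp_all
      ultimately have "?K p * kron u (kron v w) = 0\<^sub>m ?n 1" by metis
      then show ?thesis using 1 by simp
    qed
  qed (use a in auto)
  also have "\<dots> = inverse (\<omega> s t r) \<cdot>\<^sub>m kron u (kron v w)"
    using mult_smult_assoc_mat[OF K k, of "((s, \<one>), (t, \<one>), (r, \<one>))"] a
      Kk[of "(s, \<one>)" "(t, \<one>)" "(r, \<one>)"] u v w by (simp add: homog_def)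
  finally show ?thesis .
qed

definition idx :: "'g \<Rightarrow> nat" where
  "idx = (SOME f. bij_betw f (carrier G) {..<card (carrier G)})"

lemma idx_bij: "bij_betw idx (carrier G) {..<card (carrier G)}"
proof -
  have "\<exists>f. bij_betw f (carrier G) {..<card (carrier G)}"
    using ex_bij_betw_finite_nat[OF finite_carrier] by (simp add: lessThan_atLeast0)
  then show ?thesis unfolding idx_def by (rule someI_ex)
qed

abbreviation n where "n \<equiv> card (carrier G)"

definition ev :: "'g \<Rightarrow> 'k mat" where "ev y = ucol n (idx y)"
definition rv :: "'g \<Rightarrow> 'k mat" where "rv y = urow n (idx y)"

lemma ev_carrier [simp]: "ev y \<in> carrier_mat n 1" and rv_carrier [simp]: "rv y \<in> carrier_mat 1 n"
  by (simp_all add: ev_def rv_def)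

lemma rv_ev:
  assumes "y \<in> carrier G" "z \<in> carrier G"
  shows "rv y * ev z = (if y = z then 1\<^sub>m 1 else 0\<^sub>m 1 1)"
proof -
  have "idx y < n" "idx z < n" "idx y = idx z \<longleftrightarrow> y = z"
    using idx_bij assms by (auto simp: bij_betw_def inj_on_def)
  then show ?thesis
    using urow_ucol[of "idx y" n "idx z"] by (simp add: ev_def rv_def)
qed

lemma separating_ev: "separating n (ev ` carrier G)"
proof -
  have "{ucol n j |j. j < n} = (ucol n ` (idx ` carrier G) :: 'k mat set)"
    using idx_bij by (auto simp: bij_betw_def)
  also have "\<dots> = ev ` carrier G"
    by (simp add: image_image ev_def)
  finally have "{ucol n j |j. j < n} = ev ` carrier G" .
  then show ?thesis using separating_ucol[of n, where 'a = 'k] by simp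
qed

definition colmat :: "nat \<Rightarrow> ('g \<Rightarrow> 'k mat) \<Rightarrow> 'k mat" where
  "colmat m W = matsum m n (carrier G) (\<lambda>y. W y * rv y)"

lemma colmat_carrier [simp]: "colmat m W \<in> carrier_mat m n"
  by (simp add: colmat_def)

lemma colmat_ev:
  assumes W: "\<And>y. y \<in> carrier G \<Longrightarrow> W y \<in> carrier_mat m 1" and z: "z \<in> carrier G"
  shows "colmat m W * ev z = W z"
proof -
  have "colmat m W * ev z = matsum m 1 (carrier G) (\<lambda>y. W y * rv y * ev z)"
    unfolding colmat_def by (rule matsum_mult) (auto intro!: mult_carrier_mat[OF W])
  also have "\<dots> = matsum m 1 (carrier G) (\<lambda>y. if y = z then W z else 0\<^sub>m m 1)"
  proof (rule matsum_cong)
    fix y assume y: "y \<in> carrier G"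
    show "W y * rv y * ev z = (if y = z then W z else 0\<^sub>m m 1)"
      using assoc_mult_mat[OF W[OF y] rv_carrier ev_carrier] right_mult_one_mat[OF W[OF z]]
        right_mult_zero_mat[OF W[OF y]] by (simp add: rv_ev y z)
  qed
  also have "\<dots> = W z"
    using matsum_single[of "carrier G" z "\<lambda>y. if y = z then W z else 0\<^sub>m m 1" m 1] W z by simp
  finally show ?thesis .
qed

lemma ev_rv_sum: "matsum n n (carrier G) (\<lambda>y. ev y * rv y) = 1\<^sub>m n"
proof -
  have "colmat n ev = 1\<^sub>m n"
    by (rule separatingD[OF separating_ev]) (auto simp: colmat_ev left_mult_one_mat[OF ev_carrier])
  then show ?thesis by (simp add: colmat_def)
qed

text \<open>
  The coordinate of a tensor with respect to the basis vector \<open>ev y\<close> in the first factor.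
\<close>

definition component :: "nat \<Rightarrow> 'g \<Rightarrow> 'k mat" where
  "component N y = kron (rv y) (1\<^sub>m N)"

lemma component_carrier [simp]: "component N y \<in> carrier_mat N (n * N)"
  using kron_carrier[OF rv_carrier one_carrier_mat, of y N] by (simp add: component_def)

lemma component_kron:
  assumes "y \<in> carrier G" "z \<in> carrier G" "w \<in> carrier_mat N 1"
  shows "component N y * kron (ev z) w = (if y = z then w else 0\<^sub>m N 1)"
  using kron_mult[OF rv_carrier one_carrier_mat ev_carrier assms(3), of y z] rv_ev[OF assms(1,2)]
    kron_one1(2)[OF assms(3)] kron_zero(2)[OF assms(3), of 1 1] assms(3)
  by (simp add: component_def)

lemma component_sum:
  assumes W: "\<And>z. z \<in> carrier G \<Longrightarrow> W z \<in> carrier_mat N 1" and y: "y \<in> carrier G"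
  shows "component N y * matsum (n * N) 1 (carrier G) (\<lambda>z. kron (ev z) (W z)) = W y"
proof -
  have k: "kron (ev z) (W z) \<in> carrier_mat (n * N) 1" if "z \<in> carrier G" for z
    using kron_carrier[OF ev_carrier W[OF that]] by simp
  have "component N y * matsum (n * N) 1 (carrier G) (\<lambda>z. kron (ev z) (W z)) =
      matsum N 1 (carrier G) (\<lambda>z. component N y * kron (ev z) (W z))"
    by (rule mult_matsum[OF k component_carrier])
  also have "\<dots> = matsum N 1 (carrier G) (\<lambda>z. if z = y then W y else 0\<^sub>m N 1)"
    by (rule matsum_cong) (simp add: component_kron[OF y _ W])
  also have "\<dots> = W y"
    using matsum_single[of "carrier G" y "\<lambda>z. if z = y then W y else 0\<^sub>m N 1" N 1] W y by simp
  finally show ?thesis .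
qed

lemma component_expand:
  assumes v: "v \<in> carrier_mat (n * N) 1"
  shows "v = matsum (n * N) 1 (carrier G) (\<lambda>y. kron (ev y) (component N y * v))"
proof -
  have er: "ev y * rv y \<in> carrier_mat n n" for y
    by (rule mult_carrier_mat[OF ev_carrier rv_carrier])
  have "v = kron (1\<^sub>m n) (1\<^sub>m N) * v" using v by (simp add: kron_one)
  also have "\<dots> = matsum (n * N) (n * N) (carrier G) (\<lambda>y. kron (ev y * rv y) (1\<^sub>m N)) * v"
    unfolding ev_rv_sum[symmetric] by (subst kron_matsum[OF er one_carrier_mat]) simp
  also have "\<dots> = matsum (n * N) 1 (carrier G) (\<lambda>y. kron (ev y * rv y) (1\<^sub>m N) * v)"
    by (rule matsum_mult[OF kron_carrier[OF er one_carrier_mat] v])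
  also have "\<dots> = matsum (n * N) 1 (carrier G) (\<lambda>y. kron (ev y) (component N y * v))"
  proof (rule matsum_cong)
    fix y
    have c: "component N y * v \<in> carrier_mat N 1" by (rule mult_carrier_mat[OF component_carrier v])
    have "kron (ev y * rv y) (1\<^sub>m N) = kron (ev y) (1\<^sub>m N) * component N y"
      unfolding component_def
      using kron_mult[OF ev_carrier one_carrier_mat rv_carrier one_carrier_mat, of y N y] by simp
    then have "kron (ev y * rv y) (1\<^sub>m N) * v = kron (ev y) (1\<^sub>m N) * (component N y * v)"
      using assoc_mult_mat[OF _ component_carrier v, of "kron (ev y) (1\<^sub>m N)" "n * N"]
        kron_carrier[OF ev_carrier one_carrier_mat, of y N] by simp
    also have "\<dots> = kron (ev y) (1\<^sub>m N) * kron (1\<^sub>m 1) (component N y * v)"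
      by (simp only: kron_one1(2)[OF c])
    also have "\<dots> = kron (ev y) (component N y * v)"
      using kron_mult[OF ev_carrier one_carrier_mat one_carrier_mat c] left_mult_one_mat[OF c]
        right_mult_one_mat[OF ev_carrier] by simp
    finally show "kron (ev y * rv y) (1\<^sub>m N) * v = kron (ev y) (component N y * v)" .
  qed
  finally show ?thesis .
qed

text \<open>
  The left ideal generated by \<open>e\<^sub>g # 1\<close>, with \<open>ev y\<close> in the role of \<open>e\<^sub>h # y\<close> for
  \<open>h = y g y ^-1\<close>. Module maps out of it correspond to vectors of degree \<open>g\<close> (\<open>free_hom\<close>), so by
  naturality a half-braiding is determined by its values on these modules.
\<close>

definition free :: "'g \<Rightarrow> ('g \<times> 'g, 'k) hrep" where
  "free g = \<lparr>rdim = n, raction = (\<lambda>(c, x). colmat n (\<lambda>y.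
     if c = conjg (x \<otimes> y) g then theta c x y \<cdot>\<^sub>m ev (x \<otimes> y) else 0\<^sub>m n 1))\<rparr>"

lemma rdim_free [simp]: "rdim (free g) = n" by (simp add: free_def)

lemma free_action:
  assumes "y \<in> carrier G"
  shows "raction (free g) (c, x) * ev y =
    (if c = conjg (x \<otimes> y) g then theta c x y \<cdot>\<^sub>m ev (x \<otimes> y) else 0\<^sub>m n 1)"
  unfolding free_def using assms by (simp add: colmat_ev)

lemma free_carrier [simp]: "raction (free g) a \<in> carrier_mat n n"
  by (cases a) (simp add: free_def)

lemma free_rep:
  assumes g: "g \<in> carrier G"
  shows "is_rep DG (free g)"
proof (rule is_repI)
  show "raction (free g) (c, x) \<in> carrier_mat (rdim (free g)) (rdim (free g))" for c x by simp
  fix c x h y assume a: "c \<in> carrier G" "x \<in> carrier G" "h \<in> carrier G" "y \<in> carrier G"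
  show "raction (free g) (c, x) * raction (free g) (h, y) =
    (if c = conjg x h then theta c x y \<cdot>\<^sub>m raction (free g) (c, x \<otimes> y)
     else 0\<^sub>m (rdim (free g)) (rdim (free g)))"
  proof (rule separatingD[OF separating_ev])
    fix v assume "v \<in> ev ` carrier G"
    then obtain z where z: "z \<in> carrier G" and v: "v = ev z" by auto
    have 1: "c = conjg x h \<and> c = conjg (x \<otimes> y \<otimes> z) g \<longleftrightarrow> h = conjg (y \<otimes> z) g \<and> c = conjg (x \<otimes> (y \<otimes> z)) g"
    proof -
      have "conjg x (conjg (y \<otimes> z) g) = conjg (x \<otimes> y \<otimes> z) g"
        using a z g by (simp add: word_simps)
      moreover have "conjg x h = conjg x (conjg (y \<otimes> z) g) \<Longrightarrow> h = conjg (y \<otimes> z) g"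
        using a z g by (simp del: m_assoc add: right_cancel)
      moreover have "x \<otimes> y \<otimes> z = x \<otimes> (y \<otimes> z)" using a z by (simp add: m_assoc)
      ultimately show ?thesis by metis
    qed
    have 2: "theta c x (y \<otimes> z) * theta (conjg (y \<otimes> z) g) y z = theta c x y * theta c (x \<otimes> y) z"
      if "c = conjg (x \<otimes> (y \<otimes> z)) g"
      using theta_cocycle[of c x y z] a z g that by (simp add: conj_by_def word_simps mult_ac)
    have "raction (free g) (c, x) * raction (free g) (h, y) * v =
        raction (free g) (c, x) * (raction (free g) (h, y) * ev z)"
      unfolding v by (rule assoc_mult_mat[OF free_carrier free_carrier ev_carrier])
    also have "\<dots> = (if h = conjg (y \<otimes> z) g \<and> c = conjg (x \<otimes> (y \<otimes> z)) g
        then (theta (conjg (y \<otimes> z) g) y z * theta c x (y \<otimes> z)) \<cdot>\<^sub>m ev (x \<otimes> (y \<otimes> z)) else 0\<^sub>m n 1)"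
      using free_action[OF z] free_action[of "y \<otimes> z" g c x] a z
        right_mult_zero_mat[OF free_carrier]
      by (auto simp: mult_smult_distrib[OF free_carrier ev_carrier])
    also have "\<dots> = (if c = conjg x h \<and> c = conjg (x \<otimes> y \<otimes> z) g
        then (theta c x y * theta c (x \<otimes> y) z) \<cdot>\<^sub>m ev (x \<otimes> y \<otimes> z) else 0\<^sub>m n 1)"
      unfolding 1 using 2 a z by (auto simp: m_assoc mult.commute)
    also have "\<dots> = (if c = conjg x h then theta c x y \<cdot>\<^sub>m raction (free g) (c, x \<otimes> y)
       else 0\<^sub>m (rdim (free g)) (rdim (free g))) * v"
      using free_action[OF z] mult_smult_assoc_mat[OF free_carrier ev_carrier]
        left_mult_zero_mat[OF ev_carrier] by (auto simp: v)
    finally show "raction (free g) (c, x) * raction (free g) (h, y) * v =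
      (if c = conjg x h then theta c x y \<cdot>\<^sub>m raction (free g) (c, x \<otimes> y)
       else 0\<^sub>m (rdim (free g)) (rdim (free g))) * v" .
  qed (auto intro!: mult_carrier_mat[OF free_carrier free_carrier])
next
  show "matsum (rdim (free g)) (rdim (free g)) (carrier G) (\<lambda>c. raction (free g) (c, \<one>)) = 1\<^sub>m (rdim (free g))"
  proof (rule separatingD[OF separating_ev])
    fix v assume "v \<in> ev ` carrier G"
    then obtain z where z: "z \<in> carrier G" and v: "v = ev z" by auto
    have "matsum n n (carrier G) (\<lambda>c. raction (free g) (c, \<one>)) * ev z =
        matsum n 1 (carrier G) (\<lambda>c. raction (free g) (c, \<one>) * ev z)"
      by (rule matsum_mult[OF free_carrier ev_carrier])
    also have "\<dots> = raction (free g) (conjg z g, \<one>) * ev z"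
    proof (rule matsum_single)
      show "raction (free g) (conjg z g, \<one>) * ev z \<in> carrier_mat n 1"
        by (rule mult_carrier_mat[OF free_carrier ev_carrier])
    qed (use z g in \<open>auto simp: free_action\<close>)
    also have "\<dots> = ev z" using z g by (simp add: free_action)
    finally show "matsum (rdim (free g)) (rdim (free g)) (carrier G) (\<lambda>c. raction (free g) (c, \<one>)) * v =
        1\<^sub>m (rdim (free g)) * v"
      by (simp add: v left_mult_one_mat[OF ev_carrier])
  qed auto
qed

lemma free_homog: "\<lbrakk>g \<in> carrier G; y \<in> carrier G\<rbrakk> \<Longrightarrow> homog (free g) (conjg y g) (ev y)"
  by (simp add: homog_def free_action)

lemma free_act:
  "\<lbrakk>g \<in> carrier G; x \<in> carrier G; y \<in> carrier G\<rbrakk> \<Longrightarrow>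
    act (free g) x (conjg y g) * ev y = theta (conjg (x \<otimes> y) g) x y \<cdot>\<^sub>m ev (x \<otimes> y)"
  by (simp add: act_def free_action word_simps)

lemma free_act_one:
  "\<lbrakk>g \<in> carrier G; y \<in> carrier G\<rbrakk> \<Longrightarrow> act (free g) y g * ev \<one> = ev y"
  using free_act[of g y \<one>] by simp

lemma free_hom:
  assumes X: "is_rep DG X" and g: "g \<in> carrier G" and v: "homog X g v"
  shows "is_rep_hom DG (free g) X (colmat (rdim X) (\<lambda>y. act X y g * v))"
  unfolding is_rep_hom_def
proof (intro conjI ballI)
  let ?f = "colmat (rdim X) (\<lambda>y. act X y g * v)"
  note vc = homog_carrier[OF v]
  have Wc: "act X y g * v \<in> carrier_mat (rdim X) 1" if "y \<in> carrier G" for y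
    by (rule mult_carrier_mat[OF act_carrier[OF X that g] vc])
  have f_ev: "?f * ev z = act X z g * v" if "z \<in> carrier G" for z
    by (rule colmat_ev) (use Wc that in auto)
  show "?f \<in> carrier_mat (rdim X) (rdim (free g))" by simp
  fix a assume "a \<in> qbasis DG"
  then obtain c x where a: "a = (c, x)" "c \<in> carrier G" "x \<in> carrier G" by auto
  have R: "raction X a \<in> carrier_mat (rdim X) (rdim X)" using X a by simp
  show "?f * raction (free g) a = raction X a * ?f"
  proof (rule separatingD[OF separating_ev])
    fix w assume "w \<in> ev ` carrier G"
    then obtain z where z: "z \<in> carrier G" and w: "w = ev z" by auto
    have "?f * raction (free g) a * w = ?f * (raction (free g) a * ev z)"
      unfolding w by (rule assoc_mult_mat[OF colmat_carrier free_carrier ev_carrier])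
    also have "\<dots> = (if c = conjg (x \<otimes> z) g then theta c x z \<cdot>\<^sub>m (act X (x \<otimes> z) g * v) else 0\<^sub>m (rdim X) 1)"
      using f_ev[of "x \<otimes> z"] a z mult_smult_distrib[OF colmat_carrier ev_carrier]
        right_mult_zero_mat[OF colmat_carrier] by (simp add: free_action)
    also have "\<dots> = raction X a * (act X z g * v)"
    proof -
      have e: "conjg x (conjg z g) = conjg (x \<otimes> z) g" using a z g by (simp add: word_simps)
      show ?thesis
        using rep_homog[OF X a(2,3) _ act_homog[OF X z g v]] act_act[OF X a(3) z g vc] g z
        unfolding e a(1) by simp
    qed
    also have "\<dots> = raction X a * (?f * ev z)" by (simp only: f_ev[OF z])
    also have "\<dots> = raction X a * ?f * w"
      unfolding w by (rule assoc_mult_mat[symmetric, OF R colmat_carrier ev_carrier])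
    finally show "?f * raction (free g) a * w = raction X a * ?f * w" .
  qed (use R in \<open>auto intro!: mult_carrier_mat[OF colmat_carrier free_carrier] mult_carrier_mat[OF R colmat_carrier]\<close>)
qed

text \<open>
  The unit object. Its half-braiding shows that the projections \<open>braid y \<one>\<close> below sum to the identity.
\<close>

definition trivial_rep :: "('g \<times> 'g, 'k) hrep" where
  "trivial_rep = \<lparr>rdim = 1, raction = (\<lambda>(c, x). if c = \<one> then 1\<^sub>m 1 else 0\<^sub>m 1 1)\<rparr>"

lemma trivial_rep: "is_rep DG trivial_rep"
proof (rule is_repI)
  fix g x h y assume "g \<in> carrier G" "x \<in> carrier G" "h \<in> carrier G" "y \<in> carrier G"
  moreover from this have "\<one> = conjg x h \<Longrightarrow> h = \<one>" by (metis inv_solve_right' inv_closed l_cancel_one' l_one m_closed)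
  ultimately show "raction trivial_rep (g, x) * raction trivial_rep (h, y) =
      (if g = conjg x h then theta g x y \<cdot>\<^sub>m raction trivial_rep (g, x \<otimes> y)
       else 0\<^sub>m (rdim trivial_rep) (rdim trivial_rep))"
    by (auto simp: trivial_rep_def)
next
  have "matsum 1 1 (carrier G) (\<lambda>g. raction trivial_rep (g, \<one>)) = raction trivial_rep (\<one>, \<one>)"
    by (rule matsum_single) (auto simp: trivial_rep_def)
  then show "matsum (rdim trivial_rep) (rdim trivial_rep) (carrier G) (\<lambda>g. raction trivial_rep (g, \<one>)) =
      1\<^sub>m (rdim trivial_rep)"
    by (simp add: trivial_rep_def)
qed (auto simp: trivial_rep_def)

end

section \<open>Objects of the Drinfeld center\<close>

locale center_object = finite_cocycle G \<omega>
  for G :: "('g, 'm) monoid_scheme" (structure) and \<omega> :: "'g \<Rightarrow> 'g \<Rightarrow> 'g \<Rightarrow> 'k :: field" +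
  fixes Z :: "('g \<times> 'g, 'k) hrep" and u :: "('g \<times> 'g, 'k) hrep \<Rightarrow> 'k mat"
  assumes center: "(Z, u) \<in> drinfeld_center DG"
begin

abbreviation N where "N \<equiv> rdim Z"

lemma Z: "is_rep DG Z"
  using center by (simp add: drinfeld_center_def)

lemma u_hom: "is_rep DG X \<Longrightarrow> is_rep_hom DG (rep_tensor DG Z X) (rep_tensor DG X Z) (u X)"
  and u_invertible: "is_rep DG X \<Longrightarrow> invertible_mat (u X)"
  using center by (auto simp: drinfeld_center_def half_braiding_def)

lemma u_natural: "\<lbrakk>is_rep DG X; is_rep DG Y; is_rep_hom DG X Y f\<rbrakk> \<Longrightarrow>
    u Y * kron (1\<^sub>m N) f = kron f (1\<^sub>m N) * u X"
  using center by (auto simp: drinfeld_center_def half_braiding_def)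

lemma u_hexagon: "\<lbrakk>is_rep DG X; is_rep DG Y\<rbrakk> \<Longrightarrow>
    rep_assoc DG X Y Z * u (rep_tensor DG X Y) * rep_assoc DG Z X Y =
    kron (1\<^sub>m (rdim X)) (u Y) * rep_assoc DG X Z Y * kron (u X) (1\<^sub>m (rdim Y))"
  using center by (auto simp: drinfeld_center_def half_braiding_def)

lemma u_carrier: "is_rep DG X \<Longrightarrow> u X \<in> carrier_mat (rdim X * N) (N * rdim X)"
  using u_hom by (auto simp: is_rep_hom_def)

text \<open>
  The coefficients of the half-braiding: on the free module of degree \<open>g\<close> it sends the tensor of \<open>z\<close>
  and the generator to the sum over \<open>y\<close> of \<open>ev y\<close> tensored with \<open>braid y g * z\<close>.
\<close>

definition braid :: "'g \<Rightarrow> 'g \<Rightarrow> 'k mat" where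
  "braid y g = component N y * u (free g) * kron (1\<^sub>m N) (ev \<one>)"

lemma insert_ev: "kron (1\<^sub>m N) (ev y) \<in> carrier_mat (N * n) N"
  using kron_carrier[OF one_carrier_mat ev_carrier, of N y] by simp

lemma u_free_carrier: "g \<in> carrier G \<Longrightarrow> u (free g) \<in> carrier_mat (n * N) (N * n)"
  using u_carrier[OF free_rep] by simp

lemma braid_carrier [simp]: "g \<in> carrier G \<Longrightarrow> braid y g \<in> carrier_mat N N"
  unfolding braid_def
  by (rule mult_carrier_mat[OF mult_carrier_mat[OF component_carrier u_free_carrier] insert_ev])

lemma kron_ev:
  assumes "z \<in> carrier_mat N 1"
  shows "kron z (ev y) = kron (1\<^sub>m N) (ev y) * z"
  using kron_mult[OF one_carrier_mat ev_carrier assms one_carrier_mat, of y] kron_one1(1)[OF assms]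
    left_mult_one_mat[OF assms] right_mult_one_mat[OF ev_carrier] by simp

lemma braid_vec:
  assumes g: "g \<in> carrier G" and z: "z \<in> carrier_mat N 1"
  shows "braid y g * z \<in> carrier_mat N 1" "component N y * (u (free g) * kron z (ev \<one>)) = braid y g * z"
proof -
  note u = u_free_carrier[OF g]
  note cu = mult_carrier_mat[OF component_carrier u]
  show "braid y g * z \<in> carrier_mat N 1"
    by (rule mult_carrier_mat[OF braid_carrier[OF g] z])
  have "u (free g) * kron z (ev \<one>) = u (free g) * kron (1\<^sub>m N) (ev \<one>) * z"
    using assoc_mult_mat[OF u insert_ev z] by (simp add: kron_ev[OF z])
  then show "component N y * (u (free g) * kron z (ev \<one>)) = braid y g * z"
    using assoc_mult_mat[OF component_carrier mult_carrier_mat[OF u insert_ev] z]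
      assoc_mult_mat[OF component_carrier u insert_ev] by (simp add: braid_def)
qed

lemma u_free:
  assumes g: "g \<in> carrier G" and z: "z \<in> carrier_mat N 1"
  shows "u (free g) * kron z (ev \<one>) = matsum (n * N) 1 (carrier G) (\<lambda>y. kron (ev y) (braid y g * z))"
proof -
  have "u (free g) * kron z (ev \<one>) \<in> carrier_mat (n * N) 1"
    using mult_carrier_mat[OF u_free_carrier[OF g] kron_carrier[OF z ev_carrier]] by simp
  from component_expand[OF this] show ?thesis by (simp only: braid_vec(2)[OF g z])
qed

text \<open>
  Naturality along the map from the free module to \<open>X\<close> that sends the generator to \<open>v\<close>.
\<close>

lemma u_general:
  assumes X: "is_rep DG X" and g: "g \<in> carrier G" and v: "homog X g v" and z: "z \<in> carrier_mat N 1"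
  shows "u X * kron z v = matsum (rdim X * N) 1 (carrier G) (\<lambda>y. kron (act X y g * v) (braid y g * z))"
proof -
  let ?W = "\<lambda>y. act X y g * v" and ?m = "rdim X"
  let ?f = "colmat ?m ?W"
  note vc = homog_carrier[OF v] and uf = u_free_carrier[OF g]
  have Wc: "?W y \<in> carrier_mat ?m 1" if "y \<in> carrier G" for y
    by (rule mult_carrier_mat[OF act_carrier[OF X that g] vc])
  have f_ev: "?f * ev y = ?W y" if "y \<in> carrier G" for y
    by (rule colmat_ev) (use Wc that in auto)
  have k1: "kron (1\<^sub>m N) ?f \<in> carrier_mat (N * ?m) (N * n)" by simp
  have k2: "kron ?f (1\<^sub>m N) \<in> carrier_mat (?m * N) (n * N)" by simp
  have ke: "kron z (ev \<one>) \<in> carrier_mat (N * n) 1"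
    using kron_carrier[OF z ev_carrier] by simp
  have kT: "kron (ev y) (braid y g * z) \<in> carrier_mat (n * N) 1" for y
    using kron_carrier[OF ev_carrier braid_vec(1)[OF g z]] by simp
  have "kron z v = kron (1\<^sub>m N) ?f * kron z (ev \<one>)"
    using kron_mult[OF one_carrier_mat colmat_carrier z ev_carrier, of ?m ?W \<one>] f_ev[OF one_closed]
      act_one[OF g v] left_mult_one_mat[OF z] by simp
  then have "u X * kron z v = u X * kron (1\<^sub>m N) ?f * kron z (ev \<one>)"
    using assoc_mult_mat[OF u_carrier[OF X] k1 ke] by simp
  also have "\<dots> = kron ?f (1\<^sub>m N) * u (free g) * kron z (ev \<one>)"
    using u_natural[OF free_rep[OF g] X free_hom[OF X g v]] by simp
  also have "\<dots> = kron ?f (1\<^sub>m N) * (u (free g) * kron z (ev \<one>))"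
    by (rule assoc_mult_mat[OF k2 uf ke])
  also have "\<dots> = matsum (?m * N) 1 (carrier G) (\<lambda>y. kron ?f (1\<^sub>m N) * kron (ev y) (braid y g * z))"
    unfolding u_free[OF g z] by (rule mult_matsum[OF kT k2])
  also have "\<dots> = matsum (?m * N) 1 (carrier G) (\<lambda>y. kron (?W y) (braid y g * z))"
  proof (rule matsum_cong)
    fix y assume "y \<in> carrier G"
    then show "kron ?f (1\<^sub>m N) * kron (ev y) (braid y g * z) = kron (?W y) (braid y g * z)"
      using kron_mult[OF colmat_carrier one_carrier_mat ev_carrier braid_vec(1)[OF g z]] f_ev
        left_mult_one_mat[OF braid_vec(1)[OF g z]] by simp
  qed
  finally show ?thesis .
qed

text \<open>
  The half-braiding commutes with the projections to the homogeneous components.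
\<close>

lemma braid_homog:
  assumes a: "y \<in> carrier G" "g \<in> carrier G" "h \<in> carrier G" and z: "homog Z h z"
  shows "homog Z (shift y g h) (braid y g * z)"
proof -
  note zc = homog_carrier[OF z] and F = free_rep[OF a(2)]
  let ?F = "free g"
  note Tc = braid_vec(1)[OF a(2) zc]
  have e1: "homog ?F g (ev \<one>)" using free_homog[OF a(2) one_closed] a by simp
  let ?P = "raction (rep_tensor DG ?F Z) (h \<otimes> g, \<one>)" and ?Q = "raction (rep_tensor DG Z ?F) (h \<otimes> g, \<one>)"
  have P: "?P \<in> carrier_mat (n * N) (n * N)" and Q: "?Q \<in> carrier_mat (N * n) (N * n)"
    using raction_tensor_carrier[of ?F Z] raction_tensor_carrier[of Z ?F] by simp_all
  have ke: "kron z (ev \<one>) \<in> carrier_mat (N * n) 1"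
    using kron_carrier[OF zc ev_carrier] by simp
  have kT: "kron (ev y) (braid y g * z) \<in> carrier_mat (n * N) 1" for y
    using kron_carrier[OF ev_carrier Tc] by simp
  let ?v = "u ?F * kron z (ev \<one>)"
  have RT: "raction Z (inv (conjg x g) \<otimes> (h \<otimes> g), \<one>) * (braid x g * z) \<in> carrier_mat N 1"
    if "x \<in> carrier G" for x
    by (rule mult_carrier_mat[OF rep_carrier[OF Z] Tc]) (use a that in auto)
  have "?v = u ?F * (?Q * kron z (ev \<one>))"
    using tensor_homog[OF Z F a(3,2) z e1] by (simp add: homog_def)
  also have "\<dots> = u ?F * ?Q * kron z (ev \<one>)"
    by (rule assoc_mult_mat[symmetric, OF u_free_carrier[OF a(2)] Q ke])
  also have "\<dots> = ?P * u ?F * kron z (ev \<one>)"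
    using u_hom[OF F] a by (auto simp: is_rep_hom_def)
  also have "\<dots> = ?P * ?v"
    by (rule assoc_mult_mat[OF P u_free_carrier[OF a(2)] ke])
  also have "\<dots> = matsum (n * N) 1 (carrier G) (\<lambda>x. ?P * kron (ev x) (braid x g * z))"
    unfolding u_free[OF a(2) zc] by (rule mult_matsum[OF kT P])
  also have "\<dots> = matsum (n * N) 1 (carrier G)
      (\<lambda>x. kron (ev x) (raction Z (inv (conjg x g) \<otimes> (h \<otimes> g), \<one>) * (braid x g * z)))"
  proof (rule matsum_cong)
    fix x assume x: "x \<in> carrier G"
    have hx: "homog ?F (conjg x g) (ev x)" by (rule free_homog[OF a(2) x])
    show "?P * kron (ev x) (braid x g * z) =
        kron (ev x) (raction Z (inv (conjg x g) \<otimes> (h \<otimes> g), \<one>) * (braid x g * z))"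
      using tensor_action_general[OF F Z _ one_closed _ hx Tc, of "h \<otimes> g"] act_one[OF _ hx] a x by simp
  qed
  finally have "component N y * ?v = raction Z (inv (conjg y g) \<otimes> (h \<otimes> g), \<one>) * (braid y g * z)"
    using component_sum[OF RT a(1)] by simp
  moreover have "inv (conjg y g) \<otimes> (h \<otimes> g) = shift y g h"
    using a by (simp add: shift_def word_simps)
  ultimately show ?thesis
    using braid_vec[OF a(2) zc, of y] by (simp add: homog_def)
qed

text \<open>
  The hexagon for two free modules, evaluated on their generators. The left side moves both at once
  and involves a single group element; comparing coefficients shows that different \<open>x\<close> and \<open>y\<close> give zero.
\<close>

lemma braid_braid:
  assumes a: "y \<in> carrier G" "x \<in> carrier G" "g \<in> carrier G" "f \<in> carrier G" "h \<in> carrier G"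
    and z: "homog Z h z"
  shows "braid x f * (braid y g * z) = (if x = y then tau y h g f \<cdot>\<^sub>m (braid y (g \<otimes> f) * z) else 0\<^sub>m N 1)"
proof -
  let ?F = "free g" and ?E = "free f"
  let ?FE = "rep_tensor DG ?F ?E"
  note zc = homog_carrier[OF z] and F = free_rep[OF a(3)] and E = free_rep[OF a(4)]
  note FE = tensor_rep[OF F E]
  have gf: "g \<otimes> f \<in> carrier G" using a by simp
  have e1: "homog ?F g (ev \<one>)" using free_homog[OF a(3) one_closed] a by simp
  have e2: "homog ?E f (ev \<one>)" using free_homog[OF a(4) one_closed] a by simp
  let ?e = "kron (ev \<one>) (ev \<one>)"
  have e: "homog ?FE (g \<otimes> f) ?e" by (rule tensor_homog[OF F E a(3,4) e1 e2])
  have ec: "?e \<in> carrier_mat (n * n) 1" using kron_carrier[OF ev_carrier ev_carrier] by simp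
  let ?k = "kron z ?e"
  have kc: "?k \<in> carrier_mat (N * n * n) 1" using kron_carrier[OF zc ec] by (simp add: mult.assoc)
  have A1: "rep_assoc DG ?F ?E Z \<in> carrier_mat (n * n * N) (n * n * N)"
    using rep_assoc_carrier[of ?F ?E Z] by simp
  have A2: "rep_assoc DG Z ?F ?E \<in> carrier_mat (N * n * n) (N * n * n)"
    using rep_assoc_carrier[of Z ?F ?E] by simp
  have A3: "rep_assoc DG ?F Z ?E \<in> carrier_mat (n * N * n) (n * N * n)"
    using rep_assoc_carrier[of ?F Z ?E] by simp
  have U: "u ?FE \<in> carrier_mat (n * n * N) (N * n * n)"
    using u_carrier[OF FE] by (simp add: mult.assoc)
  have U1: "kron (u ?F) (1\<^sub>m n) \<in> carrier_mat (n * N * n) (N * n * n)"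
    using kron_carrier[OF u_free_carrier[OF a(3)] one_carrier_mat[of n]] by simp
  have U2: "kron (1\<^sub>m n) (u ?E) \<in> carrier_mat (n * n * N) (n * N * n)"
    using kron_carrier[OF one_carrier_mat[of n] u_free_carrier[OF a(4)]] by (simp add: mult.assoc)
  define w where "w r = braid r (g \<otimes> f) * z" for r
  define q where "q r = braid r g * z" for r
  have wc: "w r \<in> carrier_mat N 1" and qc: "q r \<in> carrier_mat N 1" for r
    unfolding w_def q_def by (rule braid_vec(1)[OF gf zc], rule braid_vec(1)[OF a(3) zc])
  define cw where "cw r = inverse (\<omega> h g f) * (gamma r (conjg r g) (conjg r f) *
      inverse (\<omega> (conjg r g) (conjg r f) (shift r (g \<otimes> f) h)))" for r
  define cq where "cq r = inverse (\<omega> (conjg r g) (shift r g h) f)" for r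
  have Lc: "cw r \<cdot>\<^sub>m kron (ev r) (w r) \<in> carrier_mat (n * N) 1" for r
    using kron_carrier[OF ev_carrier wc] by simp
  have Rc: "cq r \<cdot>\<^sub>m (u ?E * kron (q r) (ev \<one>)) \<in> carrier_mat (n * N) 1" for r
    using mult_carrier_mat[OF u_free_carrier[OF a(4)] kron_carrier[OF qc ev_carrier]] by simp

  have lhs: "rep_assoc DG ?F ?E Z * u ?FE * rep_assoc DG Z ?F ?E * ?k =
      matsum (n * (n * N)) 1 (carrier G) (\<lambda>r. kron (ev r) (cw r \<cdot>\<^sub>m kron (ev r) (w r)))"
  proof -
    have kk: "kron (kron (ev r) (ev r)) (w r) \<in> carrier_mat (n * n * N) 1" for r
      using kron_carrier[OF kron_carrier[OF ev_carrier ev_carrier] wc] by simp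
    have uk: "u ?FE * ?k \<in> carrier_mat (n * n * N) 1" by (rule mult_carrier_mat[OF U kc])
    have "rep_assoc DG ?F ?E Z * u ?FE * rep_assoc DG Z ?F ?E * ?k =
        rep_assoc DG ?F ?E Z * u ?FE * (rep_assoc DG Z ?F ?E * ?k)"
      by (rule assoc_mult_mat[OF mult_carrier_mat[OF A1 U] A2 kc])
    also have "\<dots> = rep_assoc DG ?F ?E Z * u ?FE * (inverse (\<omega> h g f) \<cdot>\<^sub>m ?k)"
      using rep_assoc_action[OF Z F E a(5,3,4) z e1 e2] by simp
    also have "\<dots> = inverse (\<omega> h g f) \<cdot>\<^sub>m (rep_assoc DG ?F ?E Z * (u ?FE * ?k))"
      using mult_smult_distrib[OF mult_carrier_mat[OF A1 U] kc] assoc_mult_mat[OF A1 U kc] by simp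
    also have "\<dots> = rep_assoc DG ?F ?E Z * (inverse (\<omega> h g f) \<cdot>\<^sub>m (u ?FE * ?k))"
      using mult_smult_distrib[OF A1 uk] by simp
    also have "inverse (\<omega> h g f) \<cdot>\<^sub>m (u ?FE * ?k) = u ?FE * kron (inverse (\<omega> h g f) \<cdot>\<^sub>m z) ?e"
      using mult_smult_distrib[OF U kc] by (simp add: kron_smult)
    also have "\<dots> = matsum (n * n * N) 1 (carrier G)
        (\<lambda>r. kron (act ?FE r (g \<otimes> f) * ?e) (braid r (g \<otimes> f) * (inverse (\<omega> h g f) \<cdot>\<^sub>m z)))"
      using u_general[OF FE gf e, of "inverse (\<omega> h g f) \<cdot>\<^sub>m z"] zc by simp
    also have "rep_assoc DG ?F ?E Z * \<dots> = matsum (n * n * N) 1 (carrier G)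
        (\<lambda>r. rep_assoc DG ?F ?E Z *
          kron (act ?FE r (g \<otimes> f) * ?e) (braid r (g \<otimes> f) * (inverse (\<omega> h g f) \<cdot>\<^sub>m z)))"
    proof (rule mult_matsum[OF _ A1])
      fix r assume r: "r \<in> carrier G"
      have "inverse (\<omega> h g f) \<cdot>\<^sub>m z \<in> carrier_mat N 1" using zc by simp
      from kron_carrier[OF homog_carrier[OF act_homog[OF FE r gf e]] braid_vec(1)[OF gf this]]
      show "kron (act ?FE r (g \<otimes> f) * ?e) (braid r (g \<otimes> f) * (inverse (\<omega> h g f) \<cdot>\<^sub>m z))
          \<in> carrier_mat (n * n * N) 1" by simp
    qed
    also have "\<dots> = matsum (n * (n * N)) 1 (carrier G) (\<lambda>r. kron (ev r) (cw r \<cdot>\<^sub>m kron (ev r) (w r)))"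
      unfolding mult.assoc
    proof (rule matsum_cong)
      fix r assume r: "r \<in> carrier G"
      have h1: "homog ?F (conjg r g) (ev r)" and h2: "homog ?E (conjg r f) (ev r)"
        and h3: "homog Z (shift r (g \<otimes> f) h) (w r)"
        unfolding w_def using free_homog[OF a(3) r] free_homog[OF a(4) r] braid_homog[OF r gf a(5) z] by auto
      have 1: "act ?FE r (g \<otimes> f) * ?e = gamma r (conjg r g) (conjg r f) \<cdot>\<^sub>m kron (ev r) (ev r)"
        using tensor_action[OF F E _ r a(3,4) e1 e2, of "conjg r (g \<otimes> f)"] r a
          free_act_one[OF a(3) r] free_act_one[OF a(4) r] by (simp add: act_def[of ?FE])
      have 2: "braid r (g \<otimes> f) * (inverse (\<omega> h g f) \<cdot>\<^sub>m z) = inverse (\<omega> h g f) \<cdot>\<^sub>m w r"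
        unfolding w_def by (rule mult_smult_distrib[OF braid_carrier[OF gf] zc])
      have 3: "kron (kron (ev r) (ev r)) (w r) = kron (ev r) (kron (ev r) (w r))"
        by (rule kron_assoc[OF ev_carrier ev_carrier wc])
      have "rep_assoc DG ?F ?E Z * kron (ev r) (kron (ev r) (w r)) =
          inverse (\<omega> (conjg r g) (conjg r f) (shift r (g \<otimes> f) h)) \<cdot>\<^sub>m kron (ev r) (kron (ev r) (w r))"
        by (rule rep_assoc_action[OF F E Z _ _ _ h1 h2 h3]) (use a r in auto)
      then show "rep_assoc DG ?F ?E Z *
          kron (act ?FE r (g \<otimes> f) * ?e) (braid r (g \<otimes> f) * (inverse (\<omega> h g f) \<cdot>\<^sub>m z)) =
          kron (ev r) (cw r \<cdot>\<^sub>m kron (ev r) (w r))"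
        unfolding 1 2 kron_smult
        using mult_smult_distrib[OF A1 kk[of r, unfolded 3]] by (simp add: 3 cw_def kron_smult mult_ac)
    qed
    finally show ?thesis .
  qed

  have rhs: "kron (1\<^sub>m n) (u ?E) * rep_assoc DG ?F Z ?E * kron (u ?F) (1\<^sub>m n) * ?k =
      matsum (n * (n * N)) 1 (carrier G) (\<lambda>r. kron (ev r) (cq r \<cdot>\<^sub>m (u ?E * kron (q r) (ev \<one>))))"
  proof -
    have kze: "kron z (ev \<one>) \<in> carrier_mat (N * n) 1" using kron_carrier[OF zc ev_carrier] by simp
    have keq: "kron (ev r) (q r) \<in> carrier_mat (n * N) 1" for r using kron_carrier[OF ev_carrier qc] by simp
    have kqe: "kron (q r) (ev \<one>) \<in> carrier_mat (N * n) 1" for r using kron_carrier[OF qc ev_carrier] by simp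
    have k3: "kron (ev r) (kron (q r) (ev \<one>)) \<in> carrier_mat (n * N * n) 1" for r
      using kron_carrier[OF ev_carrier kqe] by (simp add: mult.assoc)
    have "kron (u ?F) (1\<^sub>m n) * ?k = kron (u ?F) (1\<^sub>m n) * kron (kron z (ev \<one>)) (ev \<one>)"
      by (simp only: kron_assoc[OF zc ev_carrier ev_carrier])
    also have "\<dots> = kron (u ?F * kron z (ev \<one>)) (ev \<one>)"
      using kron_mult[OF u_free_carrier[OF a(3)] one_carrier_mat kze ev_carrier]
        left_mult_one_mat[OF ev_carrier] by simp
    also have "\<dots> = matsum (n * N * n) 1 (carrier G) (\<lambda>r. kron (kron (ev r) (q r)) (ev \<one>))"
      unfolding u_free[OF a(3) zc] q_def[symmetric]
      using kron_matsum[of "carrier G" "\<lambda>r. kron (ev r) (q r)" "n * N" 1 "ev \<one>" n 1] keq by simp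
    also have "\<dots> = matsum (n * N * n) 1 (carrier G) (\<lambda>r. kron (ev r) (kron (q r) (ev \<one>)))"
      by (simp only: kron_assoc[OF ev_carrier qc ev_carrier])
    finally have 1: "kron (u ?F) (1\<^sub>m n) * ?k = \<dots>" .
    have "kron (1\<^sub>m n) (u ?E) * rep_assoc DG ?F Z ?E * kron (u ?F) (1\<^sub>m n) * ?k =
        kron (1\<^sub>m n) (u ?E) * rep_assoc DG ?F Z ?E * (kron (u ?F) (1\<^sub>m n) * ?k)"
      by (rule assoc_mult_mat[OF mult_carrier_mat[OF U2 A3] U1 kc])
    also have "\<dots> = matsum (n * n * N) 1 (carrier G) (\<lambda>r. kron (1\<^sub>m n) (u ?E) * rep_assoc DG ?F Z ?E *
        kron (ev r) (kron (q r) (ev \<one>)))"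
      unfolding 1 by (rule mult_matsum[OF k3 mult_carrier_mat[OF U2 A3]])
    also have "\<dots> = matsum (n * (n * N)) 1 (carrier G) (\<lambda>r. kron (ev r) (cq r \<cdot>\<^sub>m (u ?E * kron (q r) (ev \<one>))))"
      unfolding mult.assoc[of n n N]
    proof (rule matsum_cong)
      fix r assume r: "r \<in> carrier G"
      have h1: "homog ?F (conjg r g) (ev r)" and h2: "homog Z (shift r g h) (q r)"
        unfolding q_def using free_homog[OF a(3) r] braid_homog[OF r a(3) a(5) z] by auto
      have "kron (1\<^sub>m n) (u ?E) * rep_assoc DG ?F Z ?E * kron (ev r) (kron (q r) (ev \<one>)) =
          kron (1\<^sub>m n) (u ?E) * (rep_assoc DG ?F Z ?E * kron (ev r) (kron (q r) (ev \<one>)))"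
        by (rule assoc_mult_mat[OF U2 A3 k3])
      also have "rep_assoc DG ?F Z ?E * kron (ev r) (kron (q r) (ev \<one>)) =
          cq r \<cdot>\<^sub>m kron (ev r) (kron (q r) (ev \<one>))"
        unfolding cq_def by (rule rep_assoc_action[OF F Z E _ _ _ h1 h2 e2]) (use a r in auto)
      also have "kron (1\<^sub>m n) (u ?E) * (cq r \<cdot>\<^sub>m kron (ev r) (kron (q r) (ev \<one>))) =
          cq r \<cdot>\<^sub>m kron (ev r) (u ?E * kron (q r) (ev \<one>))"
        using mult_smult_distrib[OF U2 k3]
          kron_mult[OF one_carrier_mat u_free_carrier[OF a(4)] ev_carrier kqe]
          left_mult_one_mat[OF ev_carrier] by simp
      finally show "kron (1\<^sub>m n) (u ?E) * rep_assoc DG ?F Z ?E * kron (ev r) (kron (q r) (ev \<one>)) =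
          kron (ev r) (cq r \<cdot>\<^sub>m (u ?E * kron (q r) (ev \<one>)))"
        by (simp add: kron_smult)
    qed
    finally show ?thesis .
  qed

  have "component (n * N) y * matsum (n * (n * N)) 1 (carrier G) (\<lambda>r. kron (ev r) (cw r \<cdot>\<^sub>m kron (ev r) (w r))) =
      component (n * N) y * matsum (n * (n * N)) 1 (carrier G) (\<lambda>r. kron (ev r) (cq r \<cdot>\<^sub>m (u ?E * kron (q r) (ev \<one>))))"
    using u_hexagon[OF F E] lhs rhs by simp
  then have eq: "cw y \<cdot>\<^sub>m kron (ev y) (w y) = cq y \<cdot>\<^sub>m (u ?E * kron (q y) (ev \<one>))"
    using component_sum[of "\<lambda>r. cw r \<cdot>\<^sub>m kron (ev r) (w r)" "n * N" y]
      component_sum[of "\<lambda>r. cq r \<cdot>\<^sub>m (u ?E * kron (q r) (ev \<one>))" "n * N" y] Lc Rc a by simp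
  have "component N x * (cw y \<cdot>\<^sub>m kron (ev y) (w y)) = cw y \<cdot>\<^sub>m (if x = y then w y else 0\<^sub>m N 1)"
    using mult_smult_distrib[OF component_carrier, of "kron (ev y) (w y)" N 1]
      kron_carrier[OF ev_carrier wc] component_kron[OF a(2,1) wc] by simp
  moreover have "component N x * (cq y \<cdot>\<^sub>m (u ?E * kron (q y) (ev \<one>))) = cq y \<cdot>\<^sub>m (braid x f * q y)"
  proof -
    have "u ?E * kron (q y) (ev \<one>) \<in> carrier_mat (n * N) 1"
      using mult_carrier_mat[OF u_free_carrier[OF a(4)] kron_carrier[OF qc ev_carrier]] by simp
    from mult_smult_distrib[OF component_carrier this] show ?thesis
      using braid_vec(2)[OF a(4) qc] by simp
  qed
  ultimately have "cq y \<cdot>\<^sub>m (braid x f * q y) = cw y \<cdot>\<^sub>m (if x = y then w y else 0\<^sub>m N 1)"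
    using eq by simp
  moreover have "cq y \<noteq> 0" using a by (simp add: cq_def)
  ultimately have "braid x f * q y = (cw y / cq y) \<cdot>\<^sub>m (if x = y then w y else 0\<^sub>m N 1)"
    by (rule smult_cancel)
  moreover have "cw y / cq y = tau y h g f"
    using a by (simp add: cw_def cq_def scalar_defs word_simps field_simps)
  ultimately show ?thesis by (simp add: w_def q_def)
qed

text \<open>
  Linearity of the half-braiding over \<open>\<Sum>h. e\<^sub>h # y\<close>, again on the generator of a free module.
  The sums on both sides are reindexed so that the first tensor factor is \<open>ev r\<close>; the coefficient at
  \<open>r = y x\<close> is the claim.
\<close>

lemma act_braid:
  assumes a: "y \<in> carrier G" "x \<in> carrier G" "g \<in> carrier G" "h \<in> carrier G" and z: "homog Z h z"
  shows "act Z y (shift x g h) * (braid x g * z) = kappa y x h g \<cdot>\<^sub>m (braid (conjg y x) (conjg y g) * (act Z y h * z))"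
proof -
  let ?F = "free g" and ?q = "conjg y g" and ?c = "conjg y (h \<otimes> g)"
  note zc = homog_carrier[OF z] and F = free_rep[OF a(3)]
  have q: "?q \<in> carrier G" and c: "?c \<in> carrier G" using a by simp_all
  have e1: "homog ?F g (ev \<one>)" using free_homog[OF a(3) one_closed] a by simp
  have ey: "homog ?F ?q (ev y)" using free_homog[OF a(3,1)] .
  have yz: "homog Z (conjg y h) (act Z y h * z)" using act_homog[OF Z a(1,4) z] .
  note yzc = homog_carrier[OF yz]
  let ?z = "act Z y h * z"
  let ?P = "raction (rep_tensor DG ?F Z) (?c, y)" and ?Q = "raction (rep_tensor DG Z ?F) (?c, y)"
  have P: "?P \<in> carrier_mat (n * N) (n * N)" and Q: "?Q \<in> carrier_mat (N * n) (N * n)"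
    using raction_tensor_carrier[of ?F Z] raction_tensor_carrier[of Z ?F] by simp_all
  have ke: "kron z (ev \<one>) \<in> carrier_mat (N * n) 1" using kron_carrier[OF zc ev_carrier] by simp
  have kT: "kron (ev r) (braid r g * z) \<in> carrier_mat (n * N) 1" for r
    using kron_carrier[OF ev_carrier braid_vec(1)[OF a(3) zc]] by simp
  have kz: "kron ?z (ev y) \<in> carrier_mat (N * n) 1" using kron_carrier[OF yzc ev_carrier] by simp
  define s where "s = gamma y (conjg y h) ?q"
  define A where "A r = theta (conjg r g) (r \<otimes> inv y) y \<cdot>\<^sub>m (braid (r \<otimes> inv y) ?q * ?z)" for r
  define B where "B r = (gamma y (conjg r g) (conjg y (shift (inv y \<otimes> r) g h)) *
      theta (conjg r g) y (inv y \<otimes> r)) \<cdot>\<^sub>m (act Z y (shift (inv y \<otimes> r) g h) * (braid (inv y \<otimes> r) g * z))" for r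
  have Ac: "A r \<in> carrier_mat N 1" for r
    using braid_vec(1)[OF q yzc] by (simp add: A_def)
  have Bc: "B r \<in> carrier_mat N 1" if "r \<in> carrier G" for r
    using mult_carrier_mat[OF act_carrier[OF Z a(1)] braid_vec(1)[OF a(3) zc]] that a by (simp add: B_def)
  have kA: "kron (ev r) (A r) \<in> carrier_mat (n * N) 1" for r using kron_carrier[OF ev_carrier Ac] by simp
  have bij: "matsum p 1 (carrier G) W = matsum p 1 (carrier G) (\<lambda>r. W (t r))"
    if "bij_betw t (carrier G) (carrier G)" for p and W :: "'g \<Rightarrow> 'k mat" and t
    unfolding matsum_def using sum.reindex_bij_betw[OF that, of "\<lambda>r. W r $$ _"] by simp
  have bij1: "bij_betw (\<lambda>r. r \<otimes> inv y) (carrier G) (carrier G)"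
    by (rule bij_betwI[of _ _ _ "\<lambda>r. r \<otimes> y"]) (use a in \<open>auto simp: m_assoc\<close>)
  have bij2: "bij_betw (\<lambda>r. inv y \<otimes> r) (carrier G) (carrier G)"
    by (rule bij_betwI[of _ _ _ "\<lambda>r. y \<otimes> r"]) (use a in \<open>auto simp: cancel_words\<close>)
  have lhs: "u ?F * (?Q * kron z (ev \<one>)) = s \<cdot>\<^sub>m matsum (n * N) 1 (carrier G) (\<lambda>r. kron (ev r) (A r))"
  proof -
    have "?Q * kron z (ev \<one>) = s \<cdot>\<^sub>m kron ?z (ev y)"
      using tensor_action[OF Z F c a(1,4,3) z e1] free_act_one[OF a(3,1)] by (simp add: s_def)
    then have "u ?F * (?Q * kron z (ev \<one>)) = s \<cdot>\<^sub>m (u ?F * kron ?z (ev y))"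
      using mult_smult_distrib[OF u_free_carrier[OF a(3)] kz] by simp
    also have "u ?F * kron ?z (ev y) = matsum (n * N) 1 (carrier G) (\<lambda>r. kron (act ?F r ?q * ev y) (braid r ?q * ?z))"
      using u_general[OF F q ey yzc] by simp
    also have "\<dots> = matsum (n * N) 1 (carrier G)
        (\<lambda>r. kron (act ?F (r \<otimes> inv y) ?q * ev y) (braid (r \<otimes> inv y) ?q * ?z))"
      by (rule bij[OF bij1])
    also have "\<dots> = matsum (n * N) 1 (carrier G) (\<lambda>r. kron (ev r) (A r))"
    proof (rule matsum_cong)
      fix r assume r: "r \<in> carrier G"
      have "act ?F (r \<otimes> inv y) ?q * ev y = theta (conjg r g) (r \<otimes> inv y) y \<cdot>\<^sub>m ev r"
        using free_act[OF a(3) _ a(1), of "r \<otimes> inv y"] r a by (simp add: m_assoc)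
      then show "kron (act ?F (r \<otimes> inv y) ?q * ev y) (braid (r \<otimes> inv y) ?q * ?z) = kron (ev r) (A r)"
        by (simp add: A_def kron_smult)
    qed
    finally show ?thesis .
  qed
  have rhs: "?P * (u ?F * kron z (ev \<one>)) = matsum (n * N) 1 (carrier G) (\<lambda>r. kron (ev r) (B r))"
  proof -
    have "?P * (u ?F * kron z (ev \<one>)) = matsum (n * N) 1 (carrier G) (\<lambda>r. ?P * kron (ev r) (braid r g * z))"
      unfolding u_free[OF a(3) zc] by (rule mult_matsum[OF kT P])
    also have "\<dots> = matsum (n * N) 1 (carrier G) (\<lambda>r. ?P * kron (ev (inv y \<otimes> r)) (braid (inv y \<otimes> r) g * z))"
      by (rule bij[OF bij2])
    also have "\<dots> = matsum (n * N) 1 (carrier G) (\<lambda>r. kron (ev r) (B r))"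
    proof (rule matsum_cong)
      fix r assume r: "r \<in> carrier G"
      let ?t = "inv y \<otimes> r"
      have t: "?t \<in> carrier G" using r a by simp
      have "conjg y (conjg ?t g \<otimes> shift ?t g h) = ?c" "conjg y (conjg ?t g) = conjg r g"
        using r a by (simp_all add: shift_def word_simps)
      moreover have "act ?F y (conjg ?t g) * ev ?t = theta (conjg r g) y ?t \<cdot>\<^sub>m ev r"
        using free_act[OF a(3,1) t] r a by (simp add: cancel_words)
      ultimately show "?P * kron (ev ?t) (braid ?t g * z) = kron (ev r) (B r)"
        using tensor_action[OF F Z c a(1) _ _ free_homog[OF a(3) t] braid_homog[OF t a(3,4) z]] a t
        by (simp add: B_def kron_smult)
    qed
    finally show ?thesis .
  qed
  have "u ?F * ?Q = ?P * u ?F"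
    using u_hom[OF F] c a by (auto simp: is_rep_hom_def)
  then have "u ?F * (?Q * kron z (ev \<one>)) = ?P * (u ?F * kron z (ev \<one>))"
    using assoc_mult_mat[OF u_free_carrier[OF a(3)] Q ke] assoc_mult_mat[OF P u_free_carrier[OF a(3)] ke] by simp
  then have "component N (y \<otimes> x) * (s \<cdot>\<^sub>m matsum (n * N) 1 (carrier G) (\<lambda>r. kron (ev r) (A r))) =
      component N (y \<otimes> x) * matsum (n * N) 1 (carrier G) (\<lambda>r. kron (ev r) (B r))"
    unfolding lhs rhs by simp
  then have "s \<cdot>\<^sub>m A (y \<otimes> x) = B (y \<otimes> x)"
    using component_sum[of A N "y \<otimes> x"] component_sum[of B N "y \<otimes> x"] Ac Bc a
      mult_smult_distrib[OF component_carrier matsum_carrier[of "n * N" 1 "carrier G"]] by simp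
  then have "(gamma y (conjg (y \<otimes> x) g) (conjg y (shift x g h)) * theta (conjg (y \<otimes> x) g) y x) \<cdot>\<^sub>m
      (act Z y (shift x g h) * (braid x g * z)) =
      (s * theta (conjg (y \<otimes> x) g) (conjg y x) y) \<cdot>\<^sub>m (braid (conjg y x) ?q * ?z)"
    using a by (simp add: A_def B_def cancel_words)
  from smult_cancel[OF this] show ?thesis
    using a by (simp add: kappa_def s_def)
qed

text \<open>
  By \<open>braid_braid\<close> the maps \<open>braid y \<one>\<close> are orthogonal idempotents on a homogeneous component, so
  their sum is idempotent. It is also the half-braiding with the unit object, hence invertible.
\<close>

lemma braid_one_sum:
  assumes h: "h \<in> carrier G" and z: "homog Z h z"
  shows "matsum N 1 (carrier G) (\<lambda>y. braid y \<one> * z) = z"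
proof -
  let ?u = "u trivial_rep"
  note zc = homog_carrier[OF z]
  have U: "?u \<in> carrier_mat N N"
    using u_carrier[OF trivial_rep] by (simp add: trivial_rep_def)
  have t1: "homog trivial_rep \<one> (1\<^sub>m 1)"
    by (simp add: homog_def trivial_rep_def)
  have u_sum: "?u * v = matsum N 1 (carrier G) (\<lambda>y. braid y \<one> * v)" if v: "v \<in> carrier_mat N 1" for v
  proof -
    have "?u * v = ?u * kron v (1\<^sub>m 1)" by (simp only: kron_one1(1)[OF v])
    also have "\<dots> = matsum N 1 (carrier G) (\<lambda>y. kron (act trivial_rep y \<one> * 1\<^sub>m 1) (braid y \<one> * v))"
      using u_general[OF trivial_rep one_closed t1 v] by (simp add: trivial_rep_def)
    also have "\<dots> = matsum N 1 (carrier G) (\<lambda>y. braid y \<one> * v)"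
      by (rule matsum_cong) (simp add: act_def trivial_rep_def kron_one1(2)[OF braid_vec(1)[OF one_closed v]])
    finally show ?thesis .
  qed
  have Tc: "braid y \<one> * z \<in> carrier_mat N 1" for y by (rule braid_vec(1)[OF one_closed zc])
  have "?u * (?u * z) = matsum N 1 (carrier G) (\<lambda>y. ?u * (braid y \<one> * z))"
    unfolding u_sum[OF zc] by (rule mult_matsum[OF Tc U])
  also have "\<dots> = matsum N 1 (carrier G) (\<lambda>y. braid y \<one> * z)"
  proof (rule matsum_cong)
    fix y assume y: "y \<in> carrier G"
    have T: "braid x \<one> * (braid y \<one> * z) = (if x = y then braid y \<one> * z else 0\<^sub>m N 1)" if "x \<in> carrier G" for x
    proof -
      have "tau y h \<one> \<one> = 1" using y h by (simp add: scalar_defs word_simps)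
      then show ?thesis using braid_braid[OF y that one_closed one_closed h z] by simp
    qed
    have "?u * (braid y \<one> * z) = matsum N 1 (carrier G) (\<lambda>x. braid x \<one> * (braid y \<one> * z))"
      by (rule u_sum[OF Tc])
    also have "\<dots> = braid y \<one> * (braid y \<one> * z)"
      by (rule matsum_single) (use y T Tc in auto)
    finally show "?u * (braid y \<one> * z) = braid y \<one> * z" using T y by simp
  qed
  finally have idem: "?u * (?u * z) = ?u * z" by (simp only: u_sum[OF zc])
  obtain B where B: "B * ?u = 1\<^sub>m N" "B \<in> carrier_mat N N"
  proof -
    from u_invertible[OF trivial_rep] obtain B where "inverts_mat ?u B" "inverts_mat B ?u"
      by (auto simp: invertible_mat_def)
    then have 1: "?u * B = 1\<^sub>m N" "B * ?u = 1\<^sub>m (dim_row B)" using U by (auto simp: inverts_mat_def)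
    have "dim_col B = N" using 1(1) by (metis index_mult_mat(3) index_one_mat(3))
    moreover have "dim_row B = N" using 1(2) U by (metis carrier_matD(2) index_mult_mat(3) index_one_mat(3))
    ultimately show ?thesis using that 1 by (metis carrier_matI)
  qed
  have uz: "?u * z \<in> carrier_mat N 1" by (rule mult_carrier_mat[OF U zc])
  have "?u * z = B * (?u * (?u * z))"
    using assoc_mult_mat[OF B(2) U uz] B(1) left_mult_one_mat[OF uz] by simp
  also have "\<dots> = B * (?u * z)" by (simp only: idem)
  also have "\<dots> = z"
    using assoc_mult_mat[OF B(2) U zc] B(1) left_mult_one_mat[OF zc] by simp
  finally show ?thesis by (simp only: u_sum[OF zc])
qed

text \<open>
  The second grading of an object of the center, by the group element with which the half-braiding acts.
\<close>

definition bihom :: "'g \<Rightarrow> 'g \<Rightarrow> 'k mat \<Rightarrow> bool" where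
  "bihom h x z \<longleftrightarrow> homog Z h z \<and> braid x \<one> * z = z"

lemma bihomD: "bihom h x z \<Longrightarrow> homog Z h z"
  and bihom_carrier: "bihom h x z \<Longrightarrow> z \<in> carrier_mat N 1"
  by (simp_all add: bihom_def homog_def)

lemma tau_one:
  assumes "x \<in> carrier G" "h \<in> carrier G" "g \<in> carrier G"
  shows "tau x h \<one> g = 1" "tau x h g \<one> = 1"
  using assms by (simp_all add: scalar_defs word_simps)

lemma shift_one: "\<lbrakk>x \<in> carrier G; h \<in> carrier G\<rbrakk> \<Longrightarrow> shift x \<one> h = h"
  by (simp add: shift_def word_simps)

lemma kappa_one: "\<lbrakk>y \<in> carrier G; x \<in> carrier G; h \<in> carrier G\<rbrakk> \<Longrightarrow> kappa y x h \<one> = 1"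
  by (simp add: kappa_def)

lemma separating_bihom:
  "separating N {z. \<exists>h\<in>carrier G. \<exists>x\<in>carrier G. bihom h x z}"
  unfolding separating_def
proof (intro conjI allI ballI impI)
  fix r and F F' :: "'k mat"
  assume F: "F \<in> carrier_mat r N" "F' \<in> carrier_mat r N"
    and eq: "\<forall>z\<in>{z. \<exists>h\<in>carrier G. \<exists>x\<in>carrier G. bihom h x z}. F * z = F' * z"
  show "F = F'"
  proof (rule separatingD[OF separating_homog[OF Z] F])
    fix z assume "z \<in> {v. \<exists>g\<in>carrier G. homog Z g v}"
    then obtain h where h: "h \<in> carrier G" and z: "homog Z h z" by auto
    have Tc: "braid x \<one> * z \<in> carrier_mat N 1" for x by (rule braid_vec(1)[OF one_closed homog_carrier[OF z]])
    have "bihom h x (braid x \<one> * z)" if x: "x \<in> carrier G" for x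
      using braid_homog[OF x one_closed h z] braid_braid[OF x x one_closed one_closed h z] x h
      by (simp add: bihom_def shift_one tau_one)
    then have "F * (braid x \<one> * z) = F' * (braid x \<one> * z)" if "x \<in> carrier G" for x
      using eq h that by blast
    then have "matsum r 1 (carrier G) (\<lambda>x. F * (braid x \<one> * z)) = matsum r 1 (carrier G) (\<lambda>x. F' * (braid x \<one> * z))"
      by (intro matsum_cong) auto
    then have "F * matsum N 1 (carrier G) (\<lambda>x. braid x \<one> * z) = F' * matsum N 1 (carrier G) (\<lambda>x. braid x \<one> * z)"
      by (simp only: mult_matsum[OF Tc F(1)] mult_matsum[OF Tc F(2)])
    then show "F * z = F' * z" by (simp only: braid_one_sum[OF h z])
  qed
qed (auto simp: bihom_def homog_def)

lemma act_bihom: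
  assumes a: "y \<in> carrier G" "h \<in> carrier G" "x \<in> carrier G" and z: "bihom h x z"
  shows "bihom (conjg y h) (conjg y x) (act Z y h * z)"
  using act_homog[OF Z a(1,2) bihomD[OF z]] act_braid[OF a(1,3) one_closed a(2) bihomD[OF z]] z a
  by (simp add: bihom_def shift_one kappa_one)

lemma braid_bihom:
  assumes a: "g \<in> carrier G" "h \<in> carrier G" "x \<in> carrier G" and z: "bihom h x z"
  shows "bihom (shift x g h) x (braid x g * z)"
  using braid_homog[OF a(3,1,2) bihomD[OF z]] braid_braid[OF a(3,3,1) one_closed a(2) bihomD[OF z]] z a
  by (simp add: bihom_def tau_one)

lemma u_bihom:
  assumes X: "is_rep DG X" and a: "g \<in> carrier G" "h \<in> carrier G" "x \<in> carrier G"
    and v: "homog X g v" and z: "bihom h x z"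
  shows "u X * kron z v = kron (act X x g * v) (braid x g * z)"
proof -
  note zc = bihom_carrier[OF z]
  have ac: "act X y g * v \<in> carrier_mat (rdim X) 1" if "y \<in> carrier G" for y
    by (rule mult_carrier_mat[OF act_carrier[OF X that a(1)] homog_carrier[OF v]])
  have "u X * kron z v = matsum (rdim X * N) 1 (carrier G) (\<lambda>y. kron (act X y g * v) (braid y g * z))"
    by (rule u_general[OF X a(1) v zc])
  also have "\<dots> = kron (act X x g * v) (braid x g * z)"
  proof (rule matsum_single)
    show "kron (act X x g * v) (braid x g * z) \<in> carrier_mat (rdim X * N) 1"
      using kron_carrier[OF ac[OF a(3)] braid_vec(1)[OF a(1) zc]] by simp
    fix y assume y: "y \<in> carrier G" "y \<noteq> x"
    have "braid y g * z = braid y g * (braid x \<one> * z)" using z by (simp add: bihom_def)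
    also have "\<dots> = 0\<^sub>m N 1" using braid_braid[OF a(3) y(1) one_closed a(1,2) bihomD[OF z]] y(2) by simp
    finally show "kron (act X y g * v) (braid y g * z) = 0\<^sub>m (rdim X * N) 1"
      using kron_zero(1)[OF ac[OF y(1)], of N 1] by simp
  qed (use a in auto)
  finally show ?thesis .
qed

text \<open>
  Vectors are tagged with their two degrees, as the zero vector does not determine them.
\<close>

definition vectors :: "(('g \<times> 'g) \<times> 'k mat) set" where
  "vectors = {((h, x), z) | h x z. h \<in> carrier G \<and> x \<in> carrier G \<and> bihom h x z}"

definition hdeg :: "('g \<times> 'g) \<times> 'k mat \<Rightarrow> 'g" where "hdeg v = fst (fst v)"

definition xdeg :: "('g \<times> 'g) \<times> 'k mat \<Rightarrow> 'g" where "xdeg v = snd (fst v)"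

definition scale :: "'k \<Rightarrow> ('g \<times> 'g) \<times> 'k mat \<Rightarrow> ('g \<times> 'g) \<times> 'k mat" where
  "scale c v = (fst v, c \<cdot>\<^sub>m snd v)"

definition Yop :: "'g \<Rightarrow> ('g \<times> 'g) \<times> 'k mat \<Rightarrow> ('g \<times> 'g) \<times> 'k mat" where
  "Yop y v = ((conjg y (hdeg v), conjg y (xdeg v)), act Z y (hdeg v) * snd v)"

definition Top :: "'g \<Rightarrow> ('g \<times> 'g) \<times> 'k mat \<Rightarrow> ('g \<times> 'g) \<times> 'k mat" where
  "Top g v = ((shift (xdeg v) g (hdeg v), xdeg v), braid (xdeg v) g * snd v)"

lemmas op_defs = hdeg_def xdeg_def scale_def Yop_def Top_def

sublocale twisted_module G \<omega> vectors hdeg xdeg scale Yop Top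
proof unfold_locales
  fix v s t y w g f
  assume "v \<in> vectors"
  then obtain h x z where v: "v = ((h, x), z)" and a [simp]: "h \<in> carrier G" "x \<in> carrier G" and z: "bihom h x z"
    by (auto simp: vectors_def)
  note zc = bihom_carrier[OF z] and zh = bihomD[OF z]
  have sz: "bihom h x (c \<cdot>\<^sub>m z)" for c
    using z homog_smult[OF Z a(1) zh] mult_smult_distrib[OF braid_carrier[OF one_closed] zc]
    by (simp add: bihom_def)
  show "hdeg v \<in> carrier G" "xdeg v \<in> carrier G" "hdeg (scale s v) = hdeg v" "xdeg (scale s v) = xdeg v"
    "scale s (scale t v) = scale (s * t) v" "scale 1 v = v"
    by (simp_all add: v op_defs)
  show "scale s v \<in> vectors" using sz by (auto simp: v vectors_def op_defs)
  show "Yop \<one> v = v" using act_one[OF a(1) zh] by (simp add: v op_defs)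
  show "Top \<one> v = v" using z by (simp add: v op_defs shift_one bihom_def)
  show "Yop y v \<in> vectors" "hdeg (Yop y v) = conjg y (hdeg v)" "xdeg (Yop y v) = conjg y (xdeg v)"
    "Yop y (scale s v) = scale s (Yop y v)" if "y \<in> carrier G"
    using that act_bihom[OF that a z] mult_smult_distrib[OF act_carrier[OF Z that a(1)] zc]
    by (auto simp: v op_defs vectors_def)
  show "Top g v \<in> vectors" "hdeg (Top g v) = shift (xdeg v) g (hdeg v)" "xdeg (Top g v) = xdeg v"
    "Top g (scale s v) = scale s (Top g v)" if "g \<in> carrier G"
    using that braid_bihom[OF that a z] mult_smult_distrib[OF braid_carrier[OF that] zc]
    by (auto simp: v op_defs vectors_def)
  show "Yop y (Yop w v) = scale (theta (conjg (y \<otimes> w) (hdeg v)) y w) (Yop (y \<otimes> w) v)"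
    if "y \<in> carrier G" "w \<in> carrier G"
    using act_act[OF Z that a(1) zc] that by (simp add: v op_defs word_simps)
  show "Top f (Top g v) = scale (tau (xdeg v) (hdeg v) g f) (Top (g \<otimes> f) v)"
    if "g \<in> carrier G" "f \<in> carrier G"
    using braid_braid[OF a(2,2) that a(1) zh] that by (simp add: v op_defs) (simp add: shift_def word_simps)
  show "Yop y (Top g v) = scale (kappa y (xdeg v) (hdeg v) g) (Top (conjg y g) (Yop y v))"
    if "y \<in> carrier G" "g \<in> carrier G"
    using act_braid[OF that(1) a(2) that(2) a(1) zh] that by (simp add: v op_defs) (simp add: shift_def word_simps)
qed

end

section \<open>The double braiding and the exponent\<close>

text \<open>
  The tag records the two degrees of either factor; the products of the degrees would not determine
  the scalars.
\<close>

type_synonym ('g, 'k) pure_tensor = "(('g \<times> 'g) \<times> ('g \<times> 'g)) \<times> 'k mat"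

locale center_pair = finite_cocycle G \<omega> + A: center_object G \<omega> Z u + B: center_object G \<omega> Z' u'
  for G :: "('g, 'm) monoid_scheme" (structure) and \<omega> :: "'g \<Rightarrow> 'g \<Rightarrow> 'g \<Rightarrow> 'k :: field"
    and Z u Z' u'
begin

definition pure where
  "pure a b = ((fst a, fst b), kron (snd a) (snd b))"

definition ht :: "('g, 'k) pure_tensor \<Rightarrow> 'g" where
  "ht = (\<lambda>(((h, x), (l, x')), m). h \<otimes> l)"

definition xt :: "('g, 'k) pure_tensor \<Rightarrow> 'g" where
  "xt = (\<lambda>(((h, x), (l, x')), m). x \<otimes> x')"

definition sct :: "'k \<Rightarrow> ('g, 'k) pure_tensor \<Rightarrow> ('g, 'k) pure_tensor" where
  "sct c = (\<lambda>(d, m). (d, c \<cdot>\<^sub>m m))"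

definition Yt :: "'g \<Rightarrow> ('g, 'k) pure_tensor \<Rightarrow> ('g, 'k) pure_tensor" where
  "Yt y = (\<lambda>(((h, x), (l, x')), m).
     (((conjg y h, conjg y x), (conjg y l, conjg y x')),
      gamma y (conjg y h) (conjg y l) \<cdot>\<^sub>m (kron (act Z y h) (act Z' y l) * m)))"

definition Tt :: "'g \<Rightarrow> ('g, 'k) pure_tensor \<Rightarrow> ('g, 'k) pure_tensor" where
  "Tt g = (\<lambda>(((h, x), (l, x')), m).
     (((shift x (conjg x' g) h, x), (shift x' g l, x')),
      tensor_factor x h x' l g \<cdot>\<^sub>m (kron (A.braid x (conjg x' g)) (B.braid x' g) * m)))"

sublocale tensor_modules G \<omega> A.vectors A.hdeg A.xdeg A.scale A.Yop A.Top
  B.vectors B.hdeg B.xdeg B.scale B.Yop B.Top pure ht xt sct Yt Tt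
proof unfold_locales
  fix a b s y g
  assume "a \<in> A.vectors" "b \<in> B.vectors"
  then obtain h x z l x' w where ab: "a = ((h, x), z)" "b = ((l, x'), w)"
    and c [simp]: "h \<in> carrier G" "x \<in> carrier G" "l \<in> carrier G" "x' \<in> carrier G"
    and z: "A.bihom h x z" and w: "B.bihom l x' w"
    by (auto simp: A.vectors_def B.vectors_def)
  note zc = A.bihom_carrier[OF z] and wc = B.bihom_carrier[OF w]
  note defs = A.op_defs B.op_defs pure_def ht_def xt_def sct_def Yt_def Tt_def
  show "ht (pure a b) = A.hdeg a \<otimes> B.hdeg b" "xt (pure a b) = A.xdeg a \<otimes> B.xdeg b"
    "sct s (pure a b) = pure (A.scale s a) b" "pure a (B.scale s b) = pure (A.scale s a) b"
    by (simp_all add: ab defs kron_smult)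
  show "Yt y (pure a b) = sct (gamma y (conjg y (A.hdeg a)) (conjg y (B.hdeg b))) (pure (A.Yop y a) (B.Yop y b))"
    if "y \<in> carrier G"
    using kron_mult[OF act_carrier[OF A.Z that c(1)] act_carrier[OF B.Z that c(3)] zc wc]
    by (simp add: ab defs)
  show "Tt g (pure a b) = sct (tensor_factor (A.xdeg a) (A.hdeg a) (B.xdeg b) (B.hdeg b) g)
      (pure (A.Top (conjg (B.xdeg b) g) a) (B.Top g b))" if "g \<in> carrier G"
    using kron_mult[OF A.braid_carrier B.braid_carrier zc wc, of "conjg x' g" g] that
    by (simp add: ab defs)
qed

abbreviation M where "M \<equiv> u' Z * u Z'"

lemma M_carrier: "M \<in> carrier_mat (rdim Z * rdim Z') (rdim Z * rdim Z')"
  using mult_carrier_mat[OF B.u_carrier[OF A.Z] A.u_carrier[OF B.Z]] .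

text \<open>
  Two instances of \<open>u_bihom\<close>, the second one for the vectors that the first one produces.
\<close>

lemma monodromy_pure:
  assumes "a \<in> A.vectors" "b \<in> B.vectors"
  shows "M * snd (pure a b) = snd (case_prod pure (monodromy (a, b)))"
proof -
  obtain h x z l x' w where ab: "a = ((h, x), z)" "b = ((l, x'), w)"
    and c [simp]: "h \<in> carrier G" "x \<in> carrier G" "l \<in> carrier G" "x' \<in> carrier G"
    and z: "A.bihom h x z" and w: "B.bihom l x' w"
    using assms by (auto simp: A.vectors_def B.vectors_def)
  note zc = A.bihom_carrier[OF z] and wc = B.bihom_carrier[OF w]
  let ?w = "act Z' x l * w" and ?z = "A.braid x l * z"
  have w': "B.bihom (conjg x l) (conjg x x') ?w" by (rule B.act_bihom[OF c(2,3,4) w])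
  have z': "A.bihom (shift x l h) x ?z" by (rule A.braid_bihom[OF c(3,1,2) z])
  have "M * kron z w = u' Z * (u Z' * kron z w)"
    using assoc_mult_mat[OF B.u_carrier[OF A.Z] A.u_carrier[OF B.Z], of "kron z w" 1]
      kron_carrier[OF zc wc] by simp
  also have "u Z' * kron z w = kron ?w ?z"
    by (rule A.u_bihom[OF B.Z c(3,1,2) B.bihomD[OF w] z])
  also have "u' Z * kron ?w ?z =
      kron (act Z (conjg x x') (shift x l h) * ?z) (B.braid (conjg x x') (shift x l h) * ?w)"
    by (rule B.u_bihom[OF A.Z _ _ _ A.bihomD[OF z'] w']) simp_all
  finally show ?thesis
    by (simp add: ab pure_def monodromy_def A.op_defs B.op_defs)
qed

theorem monodromy_power:
  assumes e: "\<And>x. x \<in> carrier G \<Longrightarrow> x [^] (e::nat) = \<one>"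
  shows "M ^\<^sub>m (e * e) = 1\<^sub>m (rdim Z * rdim Z')"
proof (rule separatingD[OF separating_kron[OF A.separating_bihom B.separating_bihom]])
  let ?n = "rdim Z * rdim Z'"
  fix k assume "k \<in> {kron z w |z w. z \<in> {z. \<exists>h\<in>carrier G. \<exists>x\<in>carrier G. A.bihom h x z} \<and>
      w \<in> {z. \<exists>h\<in>carrier G. \<exists>x\<in>carrier G. B.bihom h x z}}"
  then obtain z w h x l x' where k: "k = kron z w" and c: "h \<in> carrier G" "x \<in> carrier G" "l \<in> carrier G" "x' \<in> carrier G"
    and z: "A.bihom h x z" and w: "B.bihom l x' w" by auto
  have kc: "k \<in> carrier_mat ?n 1"
    using kron_carrier[OF A.bihom_carrier[OF z] B.bihom_carrier[OF w]] k by simp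
  let ?p = "(((h, x), z), ((l, x'), w))"
  have p: "?p \<in> A.vectors \<times> B.vectors"
    using c z w by (auto simp: A.vectors_def B.vectors_def)
  have pi: "(monodromy ^^ i) ?p \<in> A.vectors \<times> B.vectors" for i
    by (induction i) (use p monodromy_closed in auto)
  have "M ^\<^sub>m i * k = snd (case_prod pure ((monodromy ^^ i) ?p))" for i
  proof (induction i)
    case 0 show ?case using kc carrier_matD(1)[OF M_carrier] k by (simp add: pure_def)
  next
    case (Suc i)
    have "M ^\<^sub>m Suc i * k = M * (M ^\<^sub>m i * k)"
      by (simp only: pow_mat_Suc_left[OF M_carrier] assoc_mult_mat[OF M_carrier pow_carrier_mat[OF M_carrier] kc])
    also have "\<dots> = snd (case_prod pure (monodromy ((monodromy ^^ i) ?p)))"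
    proof -
      obtain a b where ab: "(monodromy ^^ i) ?p = (a, b)" "a \<in> A.vectors" "b \<in> B.vectors"
        using pi[of i] by auto
      then show ?thesis using Suc monodromy_pure[OF ab(2,3)] by simp
    qed
    finally show ?case by simp
  qed
  then have "M ^\<^sub>m (e * e) * k = snd (case_prod pure ?p)"
    using monodromy_order[OF e p] by simp
  then show "M ^\<^sub>m (e * e) * k = 1\<^sub>m ?n * k"
    using kc k by (simp add: pure_def)
qed (rule pow_carrier_mat[OF M_carrier], rule one_carrier_mat)

end

text \<open>
  The exponents that trivialise all double braidings are closed under remainders, so the least
  positive one divides all others.
\<close>

lemma quasi_hopf_exponent_dvd:
  assumes E: "E \<ge> 1"
    and pow: "\<And>U V. \<lbrakk>U \<in> drinfeld_center H; V \<in> drinfeld_center H\<rbrakk> \<Longrightarrow>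
      (center_braiding V U * center_braiding U V) ^\<^sub>m E = 1\<^sub>m (rdim (fst U) * rdim (fst V))"
    and carrier: "\<And>U V. \<lbrakk>U \<in> drinfeld_center H; V \<in> drinfeld_center H\<rbrakk> \<Longrightarrow>
      center_braiding V U * center_braiding U V \<in>
        carrier_mat (rdim (fst U) * rdim (fst V)) (rdim (fst U) * rdim (fst V))"
  shows "quasi_hopf_exponent H dvd E"
proof -
  define P where "P m \<longleftrightarrow> (\<forall>U\<in>drinfeld_center H. \<forall>V\<in>drinfeld_center H.
        (center_braiding V U * center_braiding U V) ^\<^sub>m m = 1\<^sub>m (rdim (fst U) * rdim (fst V)))" for m
  define L where "L = quasi_hopf_exponent H"
  have L_eq: "L = (LEAST m. m \<ge> 1 \<and> P m)" by (simp add: L_def quasi_hopf_exponent_def P_def)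
  have PE: "P E" using pow by (simp add: P_def)
  have L: "L \<ge> 1" "P L" using LeastI[of "\<lambda>m. m \<ge> 1 \<and> P m" E] E PE by (auto simp: L_eq)
  have least: "\<not> P m" if "m < L" "m \<ge> 1" for m
    using not_less_Least[of m "\<lambda>m. m \<ge> 1 \<and> P m"] that by (simp add: L_eq)
  have "P (E mod L)"
    unfolding P_def
  proof (intro ballI)
    fix U V assume UV: "U \<in> drinfeld_center H" "V \<in> drinfeld_center H"
    let ?A = "center_braiding V U * center_braiding U V" and ?n = "rdim (fst U) * rdim (fst V)"
    note A = carrier[OF UV]
    have AL: "?A ^\<^sub>m L = 1\<^sub>m ?n" using L UV by (simp add: P_def)
    have "?A ^\<^sub>m (i * L) = 1\<^sub>m ?n" for i
      by (induction i) (use carrier_matD(1)[OF A] in \<open>simp_all add: pow_mat_add[OF A] AL\<close>)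
    then have "1\<^sub>m ?n * ?A ^\<^sub>m (E mod L) = ?A ^\<^sub>m E"
      using pow_mat_add[OF A, of "E div L * L" "E mod L"] by (simp add: div_mult_mod_eq)
    then show "?A ^\<^sub>m (E mod L) = 1\<^sub>m ?n"
      using pow[OF UV] left_mult_one_mat[OF pow_carrier_mat[OF A], of "E mod L"] by simp
  qed
  then have "E mod L = 0"
    using least[of "E mod L"] L by (cases "E mod L = 0") auto
  then show ?thesis by (auto simp: L_def)
qed

lemma (in group) group_exponent_pow:
  assumes "finite (carrier G)"
  shows "group_exponent G \<ge> 1" "x \<in> carrier G \<Longrightarrow> x [^] group_exponent G = \<one>"
proof -
  have "0 \<notin> ord ` carrier G"
    using ord_ge_1[OF assms] by force
  then have "group_exponent G \<noteq> 0"
    using assms by (simp add: group_exponent_def Lcm_0_iff)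
  then show "group_exponent G \<ge> 1" by simp
  assume x: "x \<in> carrier G"
  then have "ord x dvd group_exponent G"
    by (simp add: group_exponent_def)
  then show "x [^] group_exponent G = \<one>"
    using pow_eq_id[OF x] by simp
qed

theorem theorem1p3:
  fixes G :: "('g, 'm) monoid_scheme"
    and \<omega> :: "'g \<Rightarrow> 'g \<Rightarrow> 'g \<Rightarrow> 'k :: {alg_closed_field, field_char_0}"
  assumes "group G"
    and "finite (carrier G)"
    and "normalized_3cocycle G \<omega>"
  shows "quasi_hopf_exponent (twisted_quantum_double G \<omega>) dvd (group_exponent G)\<^sup>2"
proof (rule quasi_hopf_exponent_dvd)
  interpret group G by fact
  note e = group_exponent_pow[OF assms(2)]
  show "1 \<le> (group_exponent G)\<^sup>2" using e(1) by simp
  fix U V :: "('g \<times> 'g, 'k) hrep \<times> (('g \<times> 'g, 'k) hrep \<Rightarrow> 'k mat)"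
  assume UV: "U \<in> drinfeld_center (twisted_quantum_double G \<omega>)"
    "V \<in> drinfeld_center (twisted_quantum_double G \<omega>)"
  interpret center_pair G \<omega> "fst U" "snd U" "fst V" "snd V"
    by unfold_locales (use assms UV in auto)
  show "(center_braiding V U * center_braiding U V) ^\<^sub>m (group_exponent G)\<^sup>2 =
      1\<^sub>m (rdim (fst U) * rdim (fst V))"
    unfolding center_braiding_def power2_eq_square by (rule monodromy_power) (rule e(2))
  show "center_braiding V U * center_braiding U V \<in>
      carrier_mat (rdim (fst U) * rdim (fst V)) (rdim (fst U) * rdim (fst V))"
    unfolding center_braiding_def by (rule M_carrier)
qed

end
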